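(* For every integer $k \geqslant 1$ there exists a sequence of compact right-angled polyhedra $R_k(n)$ in hyperbolic 3-space $\mathbb{H}^3$, indexed by integers $n$ tending to infinity, such that $$ \lim_{n \to \infty} \frac{\operatorname{vol}(R_k(n))}{\operatorname{vert}(R_k(n))} = \frac{k}{k+1} \cdot \frac{5 v_3}{8}. $$
   Context: A compact right-angled polyhedron in $\mathbb{H}^3$ is a compact convex polyhedron with nonempty interior (in particular with no ideal vertices) all of whose dihedral angles equal $\pi/2$. For such a polyhedron $R$, $\operatorname{vol}(R)$ denotes its hyperbolic volume and $\operatorname{vert}(R)$ its number of vertices. The Lobachevsky function is $\Lambda(x) = -\int_0^x \log|2\sin t|\,dt$, and $v_3 = 3\Lambda(\pi/3) = 1.01494\ldots$ is the volume of the regular ideal tetrahedron in $\mathbb{H}^3$. *)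

theory Defs
  imports "HOL-Analysis.Analysis"
begin

text \<open>
  Hyperbolic 3-space is the projective (Klein) model: the open unit ball of \<open>\<real>\<^sup>3\<close> with the Riemannian
  metric below, which is the pullback of the Minkowski form \<open>- dt\<^sup>2 + |dy|\<^sup>2\<close> under the map
  \<open>x \<mapsto> (1, x) / sqrt (1 - |x|\<^sup>2)\<close> onto the upper sheet of the hyperboloid (curvature \<open>-1\<close>).
  In this model hyperbolic planes, half-spaces and geodesic segments are the traces on the ball of
  Euclidean planes, half-spaces and segments; hence hyperbolic convexity, faces, edges and vertices
  are the Euclidean ones. Angles and volume are not: they are measured with the metric.
\<close>

definition H3 :: "(real^3) set" where
  "H3 = ball 0 1"

definition klein_metric :: "real^3 \<Rightarrow> real^3 \<Rightarrow> real^3 \<Rightarrow> real" where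
  "klein_metric x u v =
     (u \<bullet> v) / (1 - (norm x)\<^sup>2) + (x \<bullet> u) * (x \<bullet> v) / (1 - (norm x)\<^sup>2)\<^sup>2"

definition hyp_angle :: "real^3 \<Rightarrow> real^3 \<Rightarrow> real^3 \<Rightarrow> real" where
  "hyp_angle x u v =
     arccos (klein_metric x u v / (sqrt (klein_metric x u u) * sqrt (klein_metric x v v)))"

text \<open>The Riemannian volume density is the square root of the Gram determinant of the metric.\<close>

definition klein_density :: "real^3 \<Rightarrow> real" where
  "klein_density x = sqrt (det (\<chi> i j. klein_metric x (axis i 1) (axis j 1)))"

lemma klein_density_eq:
  assumes "x \<in> H3"
  shows "klein_density x = 1 / (1 - (norm x)\<^sup>2)\<^sup>2"
proof -
  define s where "s = 1 - (norm x)\<^sup>2"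
  have s: "s > 0"
    using assms by (simp add: s_def H3_def dist_norm power_less_one_iff)
  have n: "x$1 * x$1 + x$2 * x$2 + x$3 * x$3 = 1 - s"
    by (simp add: s_def power2_norm_eq_inner inner_vec_def sum_3)
  have ax: "x \<bullet> axis i 1 = x$i" for i by (simp add: inner_axis)
  have M: "klein_metric x (axis i 1) (axis j 1) =
      (if i = j then 1 / s else 0) + x$i * x$j / s\<^sup>2" for i j
    unfolding klein_metric_def ax by (simp add: inner_axis_axis s_def)
  have "det (\<chi> i j. klein_metric x (axis i 1) (axis j 1)) =
      1 / s ^ 3 + (x$1 * x$1 + x$2 * x$2 + x$3 * x$3) / s ^ 4"
    unfolding M det_3 using s
    by (simp add: field_simps power2_eq_square power3_eq_cube power4_eq_xxxx)
  also have "\<dots> = (1 / s\<^sup>2)\<^sup>2"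
    unfolding n using s by (simp add: field_simps power2_eq_square power3_eq_cube power4_eq_xxxx)
  finally show ?thesis
    using s by (simp add: klein_density_def s_def real_sqrt_unique)
qed

definition hyp_vol :: "(real^3) set \<Rightarrow> real" where
  "hyp_vol S = (LINT x:S|lborel. klein_density x)"

definition compact_hyp_polyhedron :: "(real^3) set \<Rightarrow> bool" where
  "compact_hyp_polyhedron P \<longleftrightarrow> polyhedron P \<and> compact P \<and> P \<subseteq> H3 \<and> interior P \<noteq> {}"

text \<open>
  \<open>inward_normal E F x u\<close>: at the point \<open>x\<close> of the edge \<open>E\<close>, the tangent vector \<open>u\<close> is orthogonal
  to \<open>E\<close> and points into the facet \<open>F\<close>. The angle between two vectors does not depend on their
  lengths, so \<open>u\<close> need not be a unit vector.
\<close>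

definition inward_normal ::
  "(real^3) set \<Rightarrow> (real^3) set \<Rightarrow> real^3 \<Rightarrow> real^3 \<Rightarrow> bool" where
  "inward_normal E F x u \<longleftrightarrow>
     u \<noteq> 0 \<and> x + u \<in> F \<and> (\<forall>y\<in>E. klein_metric x u (y - x) = 0)"

definition dihedral_angles :: "(real^3) set \<Rightarrow> real set" where
  "dihedral_angles P =
     {hyp_angle x u v | E F G x u v.
        E edge_of P \<and> F facet_of P \<and> G facet_of P \<and> F \<noteq> G \<and> E \<subseteq> F \<inter> G \<and>
        x \<in> rel_interior E \<and> inward_normal E F x u \<and> inward_normal E G x v}"

definition compact_right_angled_polyhedron :: "(real^3) set \<Rightarrow> bool" where
  "compact_right_angled_polyhedron P \<longleftrightarrow>
     compact_hyp_polyhedron P \<and> (\<forall>\<theta>\<in>dihedral_angles P. \<theta> = pi / 2)"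

definition vert :: "(real^3) set \<Rightarrow> nat" where
  "vert P = card {v. v extreme_point_of P}"

definition Lobachevsky :: "real \<Rightarrow> real" where
  "Lobachevsky x = - (LBINT t=0..x. ln \<bar>2 * sin t\<bar>)"

definition v3 :: real where
  "v3 = 3 * Lobachevsky (pi / 3)"

end

theory Submission
  imports Defs
begin

text \<open>
  The polyhedron \<open>R\<^sub>k(n)\<close> is a stack of \<open>k\<close> congruent Loebell polyhedra with a common axis of
  \<open>n\<close>-fold symmetry; dihedral angles at the common \<open>n\<close>-gons add up to \<open>\<pi>\<close>, so that the facets on both
  sides merge and the vertices of these \<open>n\<close>-gons disappear. It is given directly by its supporting
  planes: two caps orthogonal to the axis and \<open>n\<close> side planes on each of \<open>k + 1\<close> levels, those of
  consecutive levels being rotated by \<open>\<pi>/n\<close>. Two of these planes are orthogonal or do not meet,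
  hence the polyhedron is right-angled, and its \<open>2n(k + 1)\<close> vertices are triples of pairwise
  orthogonal planes.

  In cylindrical coordinates about the axis the volume is \<open>nk\<close> times the integral of an explicit
  function over the unit square. As \<open>n\<close> grows, these functions converge boundedly to the one that
  computes the volume, in the upper half-space, above hemispheres centred at the vertices of the
  tiling by equilateral triangles; in polar coordinates the limit is \<open>15/4 \<Lambda>(\<pi>/3) = 5/4 v\<^sub>3\<close>.
\<close>

section \<open>Right-angled polyhedra as intersections of half-spaces\<close>

text \<open>The factor k/(k + 1) counts storeys against levels: each of the k storeys contributes
  asymptotically n * 5/4 * v3 to the volume, whereas each of the k + 1 levels of sides carries 2n
  vertices. The obstacle is that the polyhedra have no limit of finite volume: as n grows, c tends
  to 1, the sides recede from the axis and the volume grows like n. A limit appears only after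
  rescaling angles and heights at the size \<open>a = pi / n\<close>. For this reason the radial
  integral is evaluated exactly for every n, which leaves the density
  \<open>a * s / (cell_max p q - 1)\<close>, whose numerator and denominator are both of order a^2.
  The equilateral tiling comes from cosh s = cos a / cos (2a), which makes s / a tend to sqrt 3:
  sides of one level are 2a apart, and consecutive levels are shifted by a in angle and by s in
  height. Adjacent sides are orthogonal, and so are the limiting hemispheres; with centres at
  distance 2 their radius is sqrt 2, whence the heights 2 - p^2 - 3 q^2 (squared) above the plane
  with coordinates p and sqrt 3 * q.\<close>

lemma klein_metric_eq_inner:
  "klein_metric x u w = u \<bullet> (w /\<^sub>R (1 - (norm x)\<^sup>2) + ((x \<bullet> w) / (1 - (norm x)\<^sup>2)\<^sup>2) *\<^sub>R x)"
  by (simp add: klein_metric_def inner_add_right field_simps inner_commute)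

lemma klein_metric_commute: "klein_metric x u w = klein_metric x w u"
  by (simp add: klein_metric_def inner_commute mult.commute)

text \<open>Up to a positive factor, \<open>v - (v \<bullet> x) *\<^sub>R x\<close> is the metric
  gradient at x of the linear form v, that is, the hyperbolic normal of the Euclidean plane through
  x with Euclidean normal v.\<close>

lemma klein_metric_conormal:
  assumes "x \<in> H3"
  shows "klein_metric x u (v - (v \<bullet> x) *\<^sub>R x) = (u \<bullet> v) / (1 - (norm x)\<^sup>2)"
proof -
  define s where "s = 1 - (norm x)\<^sup>2"
  have s: "s > 0"
    using assms by (simp add: s_def H3_def dist_norm power_less_one_iff)
  have xx: "x \<bullet> x = 1 - s" by (simp add: s_def power2_norm_eq_inner)
  have "x \<bullet> (v - (v \<bullet> x) *\<^sub>R x) = s * (v \<bullet> x)"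
    by (simp only: inner_diff_right inner_scaleR_right xx) (simp add: inner_commute algebra_simps)
  moreover have "u \<bullet> (v - (v \<bullet> x) *\<^sub>R x) = u \<bullet> v - (v \<bullet> x) * (x \<bullet> u)"
    by (simp add: inner_diff_right inner_commute)
  ultimately show ?thesis
    unfolding klein_metric_def s_def[symmetric] using s
    by (simp add: field_simps power2_eq_square)
qed

lemma klein_metric_pos:
  assumes "x \<in> H3" "u \<noteq> 0"
  shows "klein_metric x u u > 0"
proof -
  define s where "s = 1 - (norm x)\<^sup>2"
  have s: "s > 0"
    using assms by (simp add: s_def H3_def dist_norm power_less_one_iff)
  then have "(u \<bullet> u) / s > 0" "(x \<bullet> u) * (x \<bullet> u) / s\<^sup>2 \<ge> 0"
    using assms by auto
  then show ?thesis unfolding klein_metric_def s_def by linarith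
qed

text \<open>With b and b' for the products of v and v' with x, the hypothesis \<open>orth\<close>
  says that the Minkowski normals (b, v) and (b', v') are orthogonal. The vectors tangent to the
  first plane and metrically orthogonal to the edge direction d form a line; both u and the metric
  normal of the second plane lie on it, so u is orthogonal to every w tangent to the second
  plane.\<close>

lemma right_angle_between_orthogonal_planes:
  fixes x d u w v v' :: "real^3"
  assumes x: "x \<in> H3" and d: "d \<noteq> 0" "v \<bullet> d = 0" "v' \<bullet> d = 0"
    and v: "v \<noteq> 0" "v' \<noteq> 0" and orth: "v \<bullet> v' = (v \<bullet> x) * (v' \<bullet> x)"
    and u: "v \<bullet> u = 0" "klein_metric x u d = 0"
    and w: "v' \<bullet> w = 0"
  shows "klein_metric x u w = 0"
proof -
  \<comment> \<open>The covector of the metric product with d: orthogonality to d becomes a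
    Euclidean condition, and the line in question is spanned by a cross product.\<close>
  define e where "e = d /\<^sub>R (1 - (norm x)\<^sup>2) + ((x \<bullet> d) / (1 - (norm x)\<^sup>2)\<^sup>2) *\<^sub>R x"
  define \<nu> where "\<nu> = v' - (v' \<bullet> x) *\<^sub>R x"
  have e: "y \<bullet> e = klein_metric x y d" for y
    unfolding e_def klein_metric_eq_inner ..
  have s: "1 - (norm x)\<^sup>2 > 0"
    using x by (simp add: H3_def dist_norm power_less_one_iff)
  have ed: "d \<bullet> e > 0" using klein_metric_pos[OF x d(1)] e by simp
  have "\<nu> \<noteq> 0"
  proof
    assume "\<nu> = 0"
    then have "klein_metric x v' \<nu> = 0" by (simp add: klein_metric_def)
    then show False using klein_metric_conormal[OF x, of v' v'] v s \<nu>_def by simp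
  qed
  moreover have "v \<bullet> \<nu> = 0" unfolding \<nu>_def using orth by (simp add: inner_diff_right)
  moreover have "e \<bullet> \<nu> = 0"
    using klein_metric_conormal[OF x, of d v'] d(3) e[of \<nu>]
    by (simp add: \<nu>_def inner_commute klein_metric_commute)
  moreover have "e \<bullet> u = 0" using u(2) e[of u] by (metis inner_commute)
  \<comment> \<open>If e were parallel to v, it would be Euclidean orthogonal to d, whereas its
    product with d is the metric square of d.\<close>
  moreover have ve: "cross3 v e \<noteq> 0"
  proof
    assume "cross3 v e = 0"
    then have "cross3 d (cross3 v e) = 0" by simp
    then have "(d \<bullet> e) *\<^sub>R v = 0" using d(2) by (simp add: Lagrange inner_commute)
    then show False using ed v by simp
  qed
  moreover have "collinear {0, cross3 v e, y}" if "v \<bullet> y = 0" "e \<bullet> y = 0" for y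
  proof -
    have "cross3 y (cross3 v e) = 0" using that by (simp add: Lagrange inner_commute)
    then show ?thesis using cross_eq_0[of y "cross3 v e"] by (simp add: insert_commute)
  qed
  ultimately have "collinear {0, cross3 v e, \<nu>}" "collinear {0, cross3 v e, u}" using u(1) by blast+
  then obtain a b where ab: "\<nu> = a *\<^sub>R cross3 v e" "u = b *\<^sub>R cross3 v e"
    using ve unfolding collinear_lemma by (metis scale_zero_left)
  moreover have "a \<noteq> 0" using ab \<open>\<nu> \<noteq> 0\<close> by auto
  ultimately have "u = (b / a) *\<^sub>R \<nu>" by simp
  then have "klein_metric x u w = (b / a) * klein_metric x w \<nu>"
    by (simp add: klein_metric_commute[of x w] klein_metric_def inner_commute[of _ w] algebra_simps add_divide_distrib)
  also have "klein_metric x w \<nu> = 0"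
    unfolding \<nu>_def klein_metric_conormal[OF x] using w by (simp add: inner_commute)
  finally show ?thesis by simp
qed

lemma halfspaces_interior:
  fixes N :: "('a::euclidean_space \<times> real) set"
  assumes "finite N" "\<And>v b. (v, b) \<in> N \<Longrightarrow> v \<bullet> x < b"
  shows "x \<in> interior {x. \<forall>(v, b)\<in>N. v \<bullet> x \<le> b}"
proof -
  have "open (\<Inter>p\<in>N. {x. fst p \<bullet> x < snd p})"
    using assms(1) by (intro open_INT) (auto simp: open_halfspace_lt)
  moreover have "x \<in> (\<Inter>p\<in>N. {x. fst p \<bullet> x < snd p})" using assms(2) by auto
  moreover have "(\<Inter>p\<in>N. {x. fst p \<bullet> x < snd p}) \<subseteq> {x. \<forall>(v, b)\<in>N. v \<bullet> x \<le> b}"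
    by fastforce
  ultimately show ?thesis by (meson interiorI)
qed

lemma halfspaces_polyhedron:
  fixes N :: "('a::euclidean_space \<times> real) set"
  assumes "finite N"
  shows "polyhedron {x. \<forall>(v, b)\<in>N. v \<bullet> x \<le> b}"
proof -
  have "polyhedron (\<Inter>p\<in>N. {x. fst p \<bullet> x \<le> snd p})"
    using assms by (intro polyhedron_Inter) (auto simp: polyhedron_halfspace_le)
  moreover have "(\<Inter>p\<in>N. {x. fst p \<bullet> x \<le> snd p}) = {x. \<forall>(v, b)\<in>N. v \<bullet> x \<le> b}"
    by (auto; fastforce)
  ultimately show ?thesis by simp
qed

text \<open>A relative interior point of F is a boundary point of P, so some constraint is tight
  there. The face cut out by this constraint contains F and is proper because P has interior; F has
  codimension one and therefore fills it. The converse may fail, since \<open>N\<close> is allowed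
  to be redundant.\<close>

lemma facet_of_halfspaces:
  fixes N :: "('a::euclidean_space \<times> real) set"
  assumes N: "finite N" "\<forall>(v, b)\<in>N. v \<noteq> 0"
    and P: "P = {x. \<forall>(v, b)\<in>N. v \<bullet> x \<le> b}" "interior P \<noteq> {}"
    and F: "F facet_of P"
  shows "\<exists>v b. (v, b) \<in> N \<and> F = P \<inter> {x. v \<bullet> x = b}"
proof -
  have cP: "convex P" using halfspaces_polyhedron[OF N(1)] P(1) polyhedron_imp_convex by blast
  have Ff: "F face_of P" and ne: "F \<noteq> {}" and dimF: "aff_dim F = aff_dim P - 1"
    using F by (auto simp: facet_of_def)
  have "convex F" using Ff by (rule face_of_imp_convex)
  then obtain y where y: "y \<in> rel_interior F" using ne rel_interior_eq_empty by blast
  then have yF: "y \<in> F" and yP: "y \<in> P" using rel_interior_subset Ff face_of_imp_subset by blast+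
  have "F \<noteq> P" using dimF by auto
  then have "F \<inter> interior P = {}" using Ff by (intro face_of_disjoint_interior)
  then have "y \<notin> interior P" using yF by blast
  then obtain v b where vb: "(v, b) \<in> N" "\<not> v \<bullet> y < b"
    using halfspaces_interior[OF N(1), of y] P(1) by blast
  then have tight: "v \<bullet> y = b" using yP P(1) by force
  have G: "(P \<inter> {x. v \<bullet> x = b}) face_of P"
    using vb P(1) by (intro face_of_Int_supporting_hyperplane_le cP) auto
  then have sub: "F \<subseteq> P \<inter> {x. v \<bullet> x = b}"
    using subset_of_face_of[OF G face_of_imp_subset[OF Ff]] y yP tight by blast
  obtain z where "z \<in> interior P" using P by blast
  have "P \<inter> {x. v \<bullet> x = b} \<noteq> P"
  proof
    assume "P \<inter> {x. v \<bullet> x = b} = P"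
    then have "interior P \<subseteq> interior {x. v \<bullet> x = b}" by (metis inf.cobounded2 interior_mono)
    then show False using P(2) N(2) vb(1) by (auto simp: interior_hyperplane)
  qed
  then have "aff_dim (P \<inter> {x. v \<bullet> x = b}) < aff_dim P"
    using face_of_aff_dim_lt G cP by blast
  moreover have "F face_of (P \<inter> {x. v \<bullet> x = b})"
    using Ff sub by (meson face_of_subset inf_le1)
  moreover have "convex (P \<inter> {x. v \<bullet> x = b})" using G by (rule face_of_imp_convex)
  ultimately have "F = P \<inter> {x. v \<bullet> x = b}"
    using dimF face_of_aff_dim_lt[of "P \<inter> {x. v \<bullet> x = b}" F] by fastforce
  then show ?thesis using vb(1) by blast
qed

text \<open>The equation \<open>v \<bullet> v' = b * b'\<close> is Minkowski orthogonality of the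
  normals (b, v) and (b', v'). It is asked only of planes that share a point of P, because faces far
  apart are not orthogonal.\<close>

proposition compact_right_angled_polyhedron_halfspaces:
  fixes N :: "((real^3) \<times> real) set"
  assumes N: "finite N" "\<forall>(v, b)\<in>N. v \<noteq> 0"
    and P: "P = {x. \<forall>(v, b)\<in>N. v \<bullet> x \<le> b}" "interior P \<noteq> {}" "P \<subseteq> H3"
    and orth: "\<And>v b v' b' x. (v, b) \<in> N \<Longrightarrow> (v', b') \<in> N \<Longrightarrow> (v, b) \<noteq> (v', b') \<Longrightarrow> x \<in> P \<Longrightarrow>
      v \<bullet> x = b \<Longrightarrow> v' \<bullet> x = b' \<Longrightarrow> v \<bullet> v' = b * b'"
  shows "compact_right_angled_polyhedron P"
proof -
  have poly: "polyhedron P" using halfspaces_polyhedron[OF N(1)] P(1) by simp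
  moreover have "bounded P" using P(3) bounded_subset[OF bounded_ball] unfolding H3_def by blast
  ultimately have c: "compact_hyp_polyhedron P"
    using P by (simp add: compact_hyp_polyhedron_def compact_eq_bounded_closed polyhedron_imp_closed)
  have "\<theta> = pi / 2" if \<theta>P: "\<theta> \<in> dihedral_angles P" for \<theta>
  proof -
    obtain E F G x u w where \<theta>: "\<theta> = hyp_angle x u w"
      and E: "E edge_of P" and F: "F facet_of P" and G: "G facet_of P" and FG: "F \<noteq> G" "E \<subseteq> F \<inter> G"
      and x: "x \<in> rel_interior E" and u: "inward_normal E F x u" and w: "inward_normal E G x w"
      using \<theta>P unfolding dihedral_angles_def by blast
    obtain v b where v: "(v, b) \<in> N" "F = P \<inter> {x. v \<bullet> x = b}"
      using facet_of_halfspaces[OF N P(1,2) F] by blast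
    obtain v' b' where v': "(v', b') \<in> N" "G = P \<inter> {x. v' \<bullet> x = b'}"
      using facet_of_halfspaces[OF N P(1,2) G] by blast
    have xE: "x \<in> E" using x rel_interior_subset by blast
    have "E \<noteq> {x}" using E by (auto simp: edge_of_def)
    then obtain y where y: "y \<in> E" "y \<noteq> x" using xE by blast
    have t: "x \<in> P" "v \<bullet> x = b" "v' \<bullet> x = b'" "v \<bullet> y = b" "v' \<bullet> y = b'"
      using xE y FG v v' by auto
    have "v \<bullet> v' = b * b'" using orth[OF v(1) v'(1) _ t(1-3)] FG v v' by blast
    moreover have "v \<bullet> u = 0" "v' \<bullet> w = 0" "klein_metric x u (y - x) = 0"
      using u w v v' t y unfolding inward_normal_def by (auto simp: inner_add_right)
    ultimately have "klein_metric x u w = 0"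
      using right_angle_between_orthogonal_planes[of x "y - x" v v' u w] N(2) v v' P(3) t y
      by (auto simp: inner_diff_right)
    then show ?thesis by (simp add: \<theta> hyp_angle_def)
  qed
  then show ?thesis using c by (simp add: compact_right_angled_polyhedron_def)
qed

text \<open>Vertices become linear algebra: along a direction annihilated by all tight normals one
  can move a little both ways, since the finitely many slack constraints stay slack; conversely, a
  segment of P through x in its interior lies in every plane that is tight at x.\<close>

lemma extreme_point_of_halfspaces:
  fixes N :: "('a::euclidean_space \<times> real) set"
  assumes N: "finite N" and P: "P = {x. \<forall>(v, b)\<in>N. v \<bullet> x \<le> b}"
  shows "x extreme_point_of P \<longleftrightarrow>
    x \<in> P \<and> (\<forall>d. (\<forall>(v, b)\<in>N. v \<bullet> x = b \<longrightarrow> v \<bullet> d = 0) \<longrightarrow> d = 0)" (is "_ \<longleftrightarrow> _ \<and> ?R")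
proof (intro iffI conjI)
  assume ex: "x extreme_point_of P"
  show xP: "x \<in> P" using ex by (simp add: extreme_point_of_def)
  show ?R
  proof (intro allI impI)
    fix d assume d: "\<forall>(v, b)\<in>N. v \<bullet> x = b \<longrightarrow> v \<bullet> d = 0"
    have "\<exists>e>0. \<forall>t. \<bar>t\<bar> \<le> e \<longrightarrow> (\<forall>p\<in>N. fst p \<bullet> (x + t *\<^sub>R d) \<le> snd p)"
    proof -
      have ev: "\<forall>p\<in>N. \<forall>\<^sub>F t in nhds 0. fst p \<bullet> (x + t *\<^sub>R d) \<le> snd p"
      proof
        fix p assume p: "p \<in> N"
        show "\<forall>\<^sub>F t in nhds 0. fst p \<bullet> (x + t *\<^sub>R d) \<le> snd p"
        proof (cases "fst p \<bullet> x = snd p")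
          case True
          then have "fst p \<bullet> d = 0" using d p by (cases p) auto
          then show ?thesis using True by (simp add: inner_add_right)
        next
          case False
          then have "fst p \<bullet> x < snd p" using xP P p by (cases p) force
          moreover have "((\<lambda>t. fst p \<bullet> (x + t *\<^sub>R d)) \<longlongrightarrow> fst p \<bullet> (x + 0 *\<^sub>R d)) (nhds 0)"
            by (intro tendsto_intros filterlim_ident)
          ultimately have "\<forall>\<^sub>F t in nhds 0. fst p \<bullet> (x + t *\<^sub>R d) < snd p"
            by (intro order_tendstoD(2)) auto
          then show ?thesis by (rule eventually_mono) simp
        qed
      qed
      then have "\<forall>\<^sub>F t in nhds 0. \<forall>p\<in>N. fst p \<bullet> (x + t *\<^sub>R d) \<le> snd p"
        using N by (simp add: eventually_ball_finite)
      then obtain e where "e > 0" "\<And>t. dist t 0 < e \<Longrightarrow> \<forall>p\<in>N. fst p \<bullet> (x + t *\<^sub>R d) \<le> snd p"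
        unfolding eventually_nhds_metric by blast
      then show ?thesis by (intro exI[of _ "e/2"]) auto
    qed
    then obtain e where e: "e > 0" "\<And>t. \<bar>t\<bar> \<le> e \<Longrightarrow> \<forall>p\<in>N. fst p \<bullet> (x + t *\<^sub>R d) \<le> snd p" by blast
    have in': "x + e *\<^sub>R d \<in> P" "x - e *\<^sub>R d \<in> P"
      using e(2)[of e] e(2)[of "-e"] e(1) P by force+
    show "d = 0"
    proof (rule ccontr)
      assume "d \<noteq> 0"
      then have ne: "x - e *\<^sub>R d \<noteq> x + e *\<^sub>R d" using e(1)
        by (simp add: diff_eq_eq add.assoc flip: scaleR_2)
      have "x = midpoint (x - e *\<^sub>R d) (x + e *\<^sub>R d)"
        by (simp add: midpoint_def scaleR_2[symmetric])
      then have "x \<in> open_segment (x - e *\<^sub>R d) (x + e *\<^sub>R d)"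
        using ne midpoint_in_open_segment by metis
      then show False using ex in' by (auto simp: extreme_point_of_def)
    qed
  qed
next
  assume r: "x \<in> P \<and> ?R"
  show "x extreme_point_of P"
    unfolding extreme_point_of_def
  proof (intro conjI ballI notI)
    show "x \<in> P" using r by simp
    fix y z assume yz: "y \<in> P" "z \<in> P" "x \<in> open_segment y z"
    then obtain t where t: "0 < t" "t < 1" "x = (1 - t) *\<^sub>R y + t *\<^sub>R z" and ne: "y \<noteq> z"
      by (auto simp: in_segment)
    have "v \<bullet> (z - y) = 0" if vb: "(v, b) \<in> N" "v \<bullet> x = b" for v b
    proof -
      have le: "v \<bullet> y \<le> b" "v \<bullet> z \<le> b" using yz P vb by auto
      have eq: "(1 - t) * (b - v \<bullet> y) + t * (b - v \<bullet> z) = 0"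
        using vb(2) t by (simp add: inner_add_right algebra_simps)
      have "(1 - t) * (b - v \<bullet> y) \<ge> 0" "t * (b - v \<bullet> z) \<ge> 0" using le t by auto
      then have "(1 - t) * (b - v \<bullet> y) = 0" "t * (b - v \<bullet> z) = 0" using eq by linarith+
      then show ?thesis using t by (simp add: inner_diff_right)
    qed
    then have "z - y = 0" using r by blast
    then show False using ne by simp
  qed
qed

section \<open>Stacks of Loebell polyhedra\<close>

lemma tanh_artanh_real:
  assumes "\<bar>z::real\<bar> < 1" shows "tanh (artanh z) = z"
proof -
  have "exp (- 2 * artanh z) = inverse ((1 + z) / (1 - z))"
    using assms by (simp add: artanh_def exp_minus)
  also have "\<dots> = (1 - z) / (1 + z)" by simp
  finally have "tanh (artanh z) = (1 - (1 - z) / (1 + z)) / (1 + (1 - z) / (1 + z))"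
    unfolding tanh_real_altdef by (simp only:)
  also have "\<dots> = z" using assms by (simp add: field_simps)
  finally show ?thesis .
qed

lemma one_minus_tanh_square: "1 - (tanh x)\<^sup>2 = 1 / (cosh x)\<^sup>2" for x :: real
proof -
  have "(cosh x)\<^sup>2 - (sinh x)\<^sup>2 = 1" by (rule hyperbolic_pythagoras)
  moreover have "(cosh x)\<^sup>2 \<noteq> 0" by simp
  ultimately show ?thesis unfolding tanh_def power_divide by (metis diff_divide_distrib divide_self)
qed

lemma cosh_minus_tanh_sinh: "cosh x - tanh t * sinh x = cosh (t - x) / cosh t" for x t :: real
  by (simp add: cosh_diff tanh_def diff_divide_distrib)

lemma cosh_mono_abs: "\<bar>x\<bar> \<le> \<bar>y\<bar> \<Longrightarrow> cosh x \<le> cosh y" for x y :: real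
  using cosh_real_nonneg_le_iff[of "\<bar>x\<bar>" "\<bar>y\<bar>"] by simp

lemma inner_real3: "x \<bullet> y = x$1 * y$1 + x$2 * y$2 + x$3 * y$3" for x y :: "real^3"
  by (simp add: inner_vec_def sum_3)

lemma H3_iff: "x \<in> H3 \<longleftrightarrow> (x$1)\<^sup>2 + (x$2)\<^sup>2 + (x$3)\<^sup>2 < 1"
proof -
  have "x \<in> H3 \<longleftrightarrow> (norm x)\<^sup>2 < 1" by (simp add: H3_def abs_square_less_1)
  then show ?thesis by (simp add: dot_square_norm[symmetric] inner_real3 power2_eq_square[of "_ $ _"])
qed

text \<open>
  The plane \<open>v \<bullet> x = b\<close> has Minkowski normal \<open>(b, v)\<close>; the span of the normals of two planes
  that meet inside the ball is positive definite.
\<close>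

lemma ultraparallel_planes:
  fixes v v' x :: "'a::real_inner"
  assumes x: "norm x < 1" "v \<bullet> x = b" "v' \<bullet> x = b'"
    and q: "v \<bullet> v - b * b = q" "v' \<bullet> v' - b' * b' = q" "v \<bullet> v' - b * b' \<le> - q"
  shows "b + b' = 0"
proof -
  let ?w = "v + v'"
  have "?w \<bullet> ?w - (?w \<bullet> x)\<^sup>2 \<le> 0"
    using q x by (simp add: inner_add_left inner_add_right power2_eq_square algebra_simps inner_commute)
  moreover have "(?w \<bullet> x)\<^sup>2 \<le> (?w \<bullet> ?w) * (x \<bullet> x)" by (rule Cauchy_Schwarz_ineq)
  ultimately have "(?w \<bullet> ?w) * (1 - x \<bullet> x) \<le> 0" by (simp add: algebra_simps)
  moreover have "1 - x \<bullet> x > 0" using x(1) by (simp add: norm_eq_sqrt_inner)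
  ultimately have "?w \<bullet> ?w \<le> 0" by (meson mult_pos_pos not_le)
  then have "?w = 0" by (metis inner_ge_zero inner_eq_zero_iff order_antisym)
  then show ?thesis using x by (metis inner_add_left inner_zero_left)
qed

section \<open>Constants of the tower and angles that are multiples of pi/n\<close>

locale tower =
  fixes n k :: nat
  assumes n_ge: "5 \<le> n" and k_ge: "1 \<le> k"
begin

definition a :: real where "a = pi / real n"
definition u :: real where "u = cos a"
text \<open>The lower bound on n in the locale makes this positive; together with c < 1 it means
  that a plane at distance artanh (sqrt c) from the axis exists.\<close>

definition c :: real where "c = cos (2 * a)"
definition s :: real where "s = arcosh (u / c)"

lemma n_a: "real n * a = pi" using n_ge by (simp add: a_def)

lemma a_bounds: "0 < a" "a \<le> pi / 5"
  using n_ge by (auto simp: a_def field_simps)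

lemma c_u: "c = 2 * u\<^sup>2 - 1" by (simp add: c_def u_def cos_double_cos)

lemma u_bounds: "1 / 2 < u" "u < 1"
proof -
  have "cos (pi / 3) < cos a" using a_bounds by (intro cos_monotone_0_pi) (auto intro: pi_half_less_two)
  then show "1 / 2 < u" by (simp add: u_def cos_60)
  have "cos a < cos 0" using a_bounds pi_gt_zero by (intro cos_monotone_0_pi) auto
  then show "u < 1" by (simp add: u_def)
qed

lemma c_pos: "0 < c"
  unfolding c_def using a_bounds pi_gt_zero by (intro cos_gt_zero) auto

lemma c_less: "c < u\<^sup>2" "c < u" "c < 1"
proof -
  have "u\<^sup>2 < u" using u_bounds by (simp add: power2_eq_square)
  then show "c < u\<^sup>2" "c < u" "c < 1" using u_bounds c_u by linarith+
qed

lemma sin_a_pos: "0 < sin a"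
  using a_bounds pi_gt_zero by (intro sin_gt_zero) auto

lemma cosh_s: "cosh s = u / c"
  unfolding s_def using c_less c_pos by (intro cosh_arcosh_real) (simp add: field_simps)

lemma s_pos: "0 < s"
proof -
  have "u / c > 1" using c_less c_pos by simp
  then show ?thesis unfolding s_def using arcosh_real_gt_1_iff[of "u / c"] by linarith
qed

lemma cosh_s_ge: "\<bar>x\<bar> \<ge> s \<Longrightarrow> u / c \<le> cosh x"
  using cosh_mono_abs[of s x] s_pos cosh_s by simp

lemma cos_multiple_cong:
  fixes d :: int
  shows "cos (of_int d * a) = cos (of_int (d mod (2 * int n)) * a)"
    and "sin (of_int d * a) = sin (of_int (d mod (2 * int n)) * a)"
proof -
  have "of_int d * a = of_int (d mod (2 * int n)) * a + 2 * pi * of_int (d div (2 * int n))"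
  proof -
    have "(of_int d :: real) = of_int (d mod (2 * int n)) + 2 * real n * of_int (d div (2 * int n))"
    proof -
      have "d = d mod (2 * int n) + 2 * int n * (d div (2 * int n))" by simp
      then have "(of_int d :: real) = of_int (d mod (2 * int n) + 2 * int n * (d div (2 * int n)))" by (rule arg_cong)
      then show ?thesis by (simp only: of_int_add of_int_mult of_int_of_nat_eq of_int_numeral)
    qed
    then have "of_int d * a = of_int (d mod (2 * int n)) * a + 2 * (real n * a) * of_int (d div (2 * int n))"
      by (simp add: algebra_simps)
    then show ?thesis using n_a by simp
  qed
  then show "cos (of_int d * a) = cos (of_int (d mod (2 * int n)) * a)"
    and "sin (of_int d * a) = sin (of_int (d mod (2 * int n)) * a)"
    by (simp_all add: cos_add sin_add sin_int_2pin cos_int_2pin)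
qed

lemma cos_multiple_reflect: "cos (of_int (2 * int n - r) * a) = cos (of_int r * a)"
proof -
  have "of_int (2 * int n - r) * a = 2 * pi - of_int r * a"
    using n_a by (simp add: algebra_simps)
  then show ?thesis by (simp add: cos_diff)
qed

text \<open>The cosine decreases with the distance to the nearest multiple of 2 pi, and 2 pi is 2n
  steps of \<open>a\<close>: a residue between j and 2n - j is at least j steps away from zero on
  either side.\<close>

lemma cos_multiple_le:
  fixes d j :: int
  assumes "0 \<le> j" "j \<le> d mod (2 * int n)" "d mod (2 * int n) \<le> 2 * int n - j"
  shows "cos (of_int d * a) \<le> cos (of_int j * a)"
proof -
  define r where "r = d mod (2 * int n)"
  have aux: "cos (of_int r * a) \<le> cos (of_int j * a)" if "j \<le> r" "r \<le> int n" for r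
  proof (rule cos_monotone_0_pi_le)
    show "0 \<le> of_int j * a" "of_int j * a \<le> of_int r * a"
      using assms that a_bounds by (auto intro: mult_right_mono)
    have "of_int r * a \<le> real n * a" using that a_bounds by (intro mult_right_mono) linarith+
    then show "of_int r * a \<le> pi" using n_a by simp
  qed
  have "cos (of_int r * a) \<le> cos (of_int j * a)"
  proof (cases "r \<le> int n")
    case True then show ?thesis using aux assms r_def by simp
  next
    case False
    then have "cos (of_int (2 * int n - r) * a) \<le> cos (of_int j * a)"
      using assms r_def by (intro aux) auto
    then show ?thesis by (simp only: cos_multiple_reflect)
  qed
  then show ?thesis using cos_multiple_cong(1)[of d] r_def by simp
qed

lemma cos_odd_le:
  fixes d :: int
  assumes "odd d" shows "cos (of_int d * a) \<le> u"
proof -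
  define r where "r = d mod (2 * int n)"
  have r: "0 \<le> r" "r < 2 * int n" "odd r" using assms n_ge by (auto simp: r_def dvd_mod_iff)
  then have "1 \<le> r" by (cases "r = 0") auto
  then have "cos (of_int d * a) \<le> cos (of_int 1 * a)"
    using r r_def by (intro cos_multiple_le) auto
  then show ?thesis by (simp add: u_def)
qed

text \<open>Directions of one parity are spaced by 2a, so one of them lies within a of
  \<phi>.\<close>

lemma nearest_multiple:
  fixes p :: int
  shows "\<exists>m. even (m - p) \<and> u \<le> cos (\<phi> - of_int m * a)"
proof -
  define w where "w = \<phi> / a"
  define y where "y = (w - of_int p) / 2"
  define q where "q = round y"
  define m where "m = p + 2 * q"
  have "\<bar>of_int q - y\<bar> \<le> 1 / 2"
    unfolding q_def by (rule of_int_round_abs_le)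
  moreover have "w = 2 * y + of_int p" by (simp add: y_def field_simps)
  moreover have "(of_int m :: real) = of_int p + 2 * of_int q" by (simp add: m_def)
  ultimately have "\<bar>\<phi> / a - of_int m\<bar> \<le> 1" unfolding w_def[symmetric] by linarith
  then have "\<bar>\<phi> / a - of_int m\<bar> * a \<le> 1 * a" using a_bounds by (intro mult_right_mono) auto
  moreover have "\<bar>\<phi> / a - of_int m\<bar> * a = \<bar>(\<phi> / a - of_int m) * a\<bar>"
    using a_bounds by (simp add: abs_mult)
  moreover have "(\<phi> / a - of_int m) * a = \<phi> - of_int m * a"
    using a_bounds by (simp add: field_simps)
  ultimately have "\<bar>\<phi> - of_int m * a\<bar> \<le> a" by simp
  then have "cos a \<le> cos \<bar>\<phi> - of_int m * a\<bar>"
    using a_bounds pi_gt_zero by (intro cos_monotone_0_pi_le) auto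
  then show ?thesis unfolding u_def by (intro exI[of _ m]) (auto simp: m_def)
qed

text \<open>
  The side \<open>side i m\<close> is the plane at distance \<open>artanh (sqrt c)\<close> from the axis in the direction of
  angle \<open>m a\<close>, translated along the axis by \<open>s i\<close>. The distance makes neighbouring sides of one
  level orthogonal, and \<open>cosh s = u / c\<close> does the same for those of consecutive levels. The index
  \<open>m\<close> only matters modulo \<open>2n\<close>, and the sides of level \<open>i\<close> are those with \<open>m \<equiv> i\<close> modulo 2.
\<close>

definition side :: "nat \<Rightarrow> int \<Rightarrow> (real^3) \<times> real" where
  "side i m = (vector [cos (of_int m * a), sin (of_int m * a), sqrt c * sinh (s * real i)],
               sqrt c * cosh (s * real i))"

text \<open>The Minkowski normal is the image of the unit vector along the axis under translation by
  s k; in the coordinates of the ball the plane lies at height tanh (s k).\<close>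

definition top_cap :: "(real^3) \<times> real" where
  "top_cap = (vector [0, 0, cosh (s * real k)], sinh (s * real k))"

definition bottom_cap :: "(real^3) \<times> real" where
  "bottom_cap = (vector [0, 0, -1], 0)"

definition normals :: "((real^3) \<times> real) set" where
  "normals = {side i m | i m. i \<le> k \<and> even (m - int i)} \<union> {top_cap, bottom_cap}"

definition body :: "(real^3) set" where
  "body = {x. \<forall>(v, b)\<in>normals. v \<bullet> x \<le> b}"

definition hor :: "real^3 \<Rightarrow> int \<Rightarrow> real" where
  "hor x m = x$1 * cos (of_int m * a) + x$2 * sin (of_int m * a)"

text \<open>The distance from the axis, measured in their own directions, at which the sides of
  level i lie at Euclidean height z. The half-space of a side becomes
  \<open>hor x m \<le> lvl i (x$3)\<close>: angle and height are separated, and all estimates on the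
  body rest on this.\<close>

definition lvl :: "nat \<Rightarrow> real \<Rightarrow> real" where
  "lvl i z = sqrt c * (cosh (s * real i) - z * sinh (s * real i))"

lemma side_cong: "side i m = side i (m mod (2 * int n))"
  by (simp add: side_def cos_multiple_cong(1)[of m] cos_multiple_cong(2)[of m])

lemma finite_normals: "finite normals"
proof -
  have "{side i m | i m. i \<le> k \<and> even (m - int i)} \<subseteq> (\<lambda>(i, m). side i m) ` ({..k} \<times> {0..<2 * int n})"
  proof
    fix p assume "p \<in> {side i m | i m. i \<le> k \<and> even (m - int i)}"
    then obtain i m where p: "p = side i m" "i \<le> k" by blast
    moreover have "m mod (2 * int n) \<in> {0..<2 * int n}" using n_ge by simp
    ultimately have "(i, m mod (2 * int n)) \<in> {..k} \<times> {0..<2 * int n}" by simp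
    then show "p \<in> (\<lambda>(i, m). side i m) ` ({..k} \<times> {0..<2 * int n})"
      by (rule rev_image_eqI) (simp add: p(1) side_cong[symmetric])
  qed
  then have "finite {side i m | i m. i \<le> k \<and> even (m - int i)}" by (rule finite_subset) simp
  then show ?thesis by (simp add: normals_def)
qed

lemma normals_cases [consumes 1, case_names side top bottom]:
  assumes "p \<in> normals"
  obtains i m where "p = side i m" "i \<le> k" "even (m - int i)" | "p = top_cap" | "p = bottom_cap"
  using assms unfolding normals_def by blast

lemma normals_nonzero: "\<forall>(v, b)\<in>normals. v \<noteq> 0"
proof -
  have "fst p \<noteq> 0" if "p \<in> normals" for p
    using that
  proof (cases p rule: normals_cases)
    case (side i m)
    show ?thesis
    proof
      assume "fst p = 0"
      then have "fst p $ 1 = 0" "fst p $ 2 = 0" by simp_all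
      then show False using sin_cos_squared_add[of "of_int m * a"] side by (simp add: side_def)
    qed
  next
    case top
    then have "fst p $ 3 \<noteq> 0" by (simp add: top_cap_def)
    then show ?thesis by auto
  next
    case bottom
    then have "fst p $ 3 \<noteq> 0" by (simp add: bottom_cap_def)
    then show ?thesis by auto
  qed
  then show ?thesis by (simp add: case_prod_beta)
qed

lemma side_le_iff: "fst (side i m) \<bullet> x \<le> snd (side i m) \<longleftrightarrow> hor x m \<le> lvl i (x$3)"
  and side_eq_iff: "fst (side i m) \<bullet> x = snd (side i m) \<longleftrightarrow> hor x m = lvl i (x$3)"
  by (auto simp: side_def hor_def lvl_def inner_real3 algebra_simps)

lemma top_cap_le_iff: "fst top_cap \<bullet> x \<le> snd top_cap \<longleftrightarrow> x$3 \<le> tanh (s * real k)"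
  and top_cap_eq_iff: "fst top_cap \<bullet> x = snd top_cap \<longleftrightarrow> x$3 = tanh (s * real k)"
  by (auto simp: top_cap_def inner_real3 tanh_def field_simps)

lemma bottom_cap_le_iff: "fst bottom_cap \<bullet> x \<le> snd bottom_cap \<longleftrightarrow> 0 \<le> x$3"
  and bottom_cap_eq_iff: "fst bottom_cap \<bullet> x = snd bottom_cap \<longleftrightarrow> x$3 = 0"
  by (auto simp: bottom_cap_def inner_real3)

lemma body_iff:
  "x \<in> body \<longleftrightarrow> 0 \<le> x$3 \<and> x$3 \<le> tanh (s * real k) \<and>
     (\<forall>i\<le>k. \<forall>m. even (m - int i) \<longrightarrow> hor x m \<le> lvl i (x$3))"
proof -
  have "x \<in> body \<longleftrightarrow> (\<forall>p\<in>normals. fst p \<bullet> x \<le> snd p)" by (auto simp: body_def)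
  also have "\<dots> \<longleftrightarrow> fst top_cap \<bullet> x \<le> snd top_cap \<and> fst bottom_cap \<bullet> x \<le> snd bottom_cap \<and>
      (\<forall>i\<le>k. \<forall>m. even (m - int i) \<longrightarrow> fst (side i m) \<bullet> x \<le> snd (side i m))"
    unfolding normals_def by blast
  finally show ?thesis unfolding side_le_iff top_cap_le_iff bottom_cap_le_iff by blast
qed

text \<open>In the hyperbolic height t, translation along the axis is addition, so only the distance
  of t from the level s i enters. The remaining factor 1 / cosh t is the radius of the horizontal
  disc of the ball at this height.\<close>

lemma lvl_tanh: "lvl i (tanh t) = sqrt c * cosh (t - s * real i) / cosh t"
  unfolding lvl_def cosh_minus_tanh_sinh by simp

lemma hor_polar: "hor (vector [r * cos \<phi>, r * sin \<phi>, z]) m = r * cos (\<phi> - of_int m * a)"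
  by (simp add: hor_def cos_diff algebra_simps)

lemma hor_square_le: "(hor x m)\<^sup>2 \<le> (x$1)\<^sup>2 + (x$2)\<^sup>2"
proof -
  let ?C = "cos (of_int m * a)" and ?S = "sin (of_int m * a)"
  have "(hor x m)\<^sup>2 + (x$1 * ?S - x$2 * ?C)\<^sup>2 = ((x$1)\<^sup>2 + (x$2)\<^sup>2) * (?S\<^sup>2 + ?C\<^sup>2)"
    unfolding hor_def by algebra
  then have "(hor x m)\<^sup>2 + (x$1 * ?S - x$2 * ?C)\<^sup>2 = (x$1)\<^sup>2 + (x$2)\<^sup>2" by simp
  then show ?thesis by (metis le_add_same_cancel1 zero_le_power2)
qed

text \<open>At hyperbolic height \<tau> take the nearest level j and the nearest direction of its
  parity: the height is off by at most s/2, the angle by at most a. The constraint of this single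
  side keeps the point inside the ball, because c (cosh (s/2))^2 = (c + u)/2 is less than u^2 = (c +
  1)/2.\<close>

lemma body_subset: "body \<subseteq> H3"
proof
  fix x assume x: "x \<in> body"
  define z where "z = x$3"
  define \<tau> where "\<tau> = artanh z"
  have z: "0 \<le> z" "z \<le> tanh (s * real k)" using x by (auto simp: body_iff z_def)
  then have "\<bar>z\<bar> < 1" using tanh_real_lt_1[of "s * real k"] by linarith
  then have t: "tanh \<tau> = z" unfolding \<tau>_def by (rule tanh_artanh_real)
  have \<tau>: "0 \<le> \<tau>" "\<tau> \<le> s * real k" using z t by (metis tanh_real_nonneg_iff, metis tanh_real_le_iff)
  define j where "j = nat (round (\<tau> / s))"
  have r: "0 \<le> round (\<tau> / s)" "round (\<tau> / s) \<le> int k"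
  proof -
    have "round (0::real) \<le> round (\<tau> / s)" using \<tau> s_pos by (intro round_mono) auto
    then show "0 \<le> round (\<tau> / s)" by simp
    have "round (\<tau> / s) \<le> round (real k)" using \<tau> s_pos by (intro round_mono) (simp add: field_simps)
    then show "round (\<tau> / s) \<le> int k" by simp
  qed
  then have jk: "j \<le> k" and "real j = of_int (round (\<tau> / s))" by (auto simp: j_def)
  then have "\<bar>real j - \<tau> / s\<bar> \<le> 1 / 2" using of_int_round_abs_le by metis
  then have "\<bar>real j - \<tau> / s\<bar> * s \<le> 1 / 2 * s" using s_pos by (intro mult_right_mono) auto
  moreover have "\<bar>real j - \<tau> / s\<bar> * s = \<bar>(real j - \<tau> / s) * s\<bar>" using s_pos by (simp add: abs_mult)
  moreover have "(real j - \<tau> / s) * s = - (\<tau> - s * real j)" using s_pos by (simp add: field_simps)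
  ultimately have "\<bar>\<tau> - s * real j\<bar> \<le> s / 2" by (simp add: abs_minus_commute)
  then have "cosh (\<tau> - s * real j) \<le> cosh (s / 2)" using s_pos by (intro cosh_mono_abs) auto
  then have "(cosh (\<tau> - s * real j))\<^sup>2 \<le> (cosh (s / 2))\<^sup>2" by (intro power_mono) auto
  also have "\<dots> = (cosh s + 1) / 2"
    using cosh_double_cosh[of "s / 2"] by simp
  also have "\<dots> = (c + u) / (2 * c)" using c_pos by (simp add: cosh_s field_simps)
  finally have ch: "c * (cosh (\<tau> - s * real j))\<^sup>2 \<le> (c + u) / 2" using c_pos by (simp add: field_simps)
  obtain \<rho> \<phi> where p: "x$1 = \<rho> * cos \<phi>" "x$2 = \<rho> * sin \<phi>" "0 \<le> \<rho>"
  proof -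
    obtain r p where rp: "x$1 = r * cos p" "x$2 = r * sin p" using polar_Ex by blast
    show thesis
    proof (cases "0 \<le> r")
      case True then show ?thesis using that rp by blast
    next
      case False then show ?thesis using that[of "-r" "p + pi"] rp by simp
    qed
  qed
  obtain m where m: "even (m - int j)" "u \<le> cos (\<phi> - of_int m * a)" using nearest_multiple by blast
  have hor: "hor x m = \<rho> * cos (\<phi> - of_int m * a)" using p by (simp add: hor_def cos_diff algebra_simps)
  have "\<rho> * u \<le> hor x m" unfolding hor using m p by (intro mult_left_mono) auto
  also have "\<dots> \<le> sqrt c * cosh (\<tau> - s * real j) / cosh \<tau>"
    using x jk m t by (metis body_iff lvl_tanh z_def)
  finally have "(\<rho> * u)\<^sup>2 \<le> (sqrt c * cosh (\<tau> - s * real j) / cosh \<tau>)\<^sup>2"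
    using p u_bounds by (intro power_mono) auto
  also have "\<dots> = c * (cosh (\<tau> - s * real j))\<^sup>2 * (1 - z\<^sup>2)"
    using c_pos t[symmetric] by (simp add: power_mult_distrib power_divide one_minus_tanh_square)
  also have "\<dots> \<le> (c + u) / 2 * (1 - z\<^sup>2)"
    using ch \<open>\<bar>z\<bar> < 1\<close> by (intro mult_right_mono) (auto simp: abs_square_le_1)
  also have "\<dots> < u\<^sup>2 * (1 - z\<^sup>2)"
    using u_bounds c_u \<open>\<bar>z\<bar> < 1\<close> by (intro mult_strict_right_mono) (auto simp: abs_square_less_1)
  finally have "\<rho>\<^sup>2 < 1 - z\<^sup>2" using u_bounds by (simp add: power_mult_distrib)
  moreover have "(x$1)\<^sup>2 + (x$2)\<^sup>2 = \<rho>\<^sup>2"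
    using p by (simp add: power_mult_distrib flip: distrib_left)
  ultimately show "x \<in> H3" by (simp add: H3_iff z_def)
qed

lemma body_interior: "interior body \<noteq> {}"
proof -
  \<comment> \<open>On the axis, halfway up the lowest storey.\<close>
  define x :: "real^3" where "x = vector [0, 0, tanh (s / 2)]"
  have "v \<bullet> x < b" if vb: "(v, b) \<in> normals" for v b
  proof -
    show ?thesis
      using vb
    proof (cases "(v, b)" rule: normals_cases)
      case (side i m)
      have "0 < sqrt c * (cosh (s * real i) - tanh (s / 2) * sinh (s * real i))"
        unfolding cosh_minus_tanh_sinh using c_pos by simp
      then show ?thesis using side by (auto simp: side_def x_def inner_real3 algebra_simps)
    next
      case top
      have "tanh (s / 2) < tanh (s * real k)"
        unfolding tanh_real_less_iff using s_pos k_ge by (simp add: field_simps)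
      then have "tanh (s / 2) * cosh (s * real k) < tanh (s * real k) * cosh (s * real k)"
        by (intro mult_strict_right_mono) auto
      also have "\<dots> = sinh (s * real k)" by (simp add: tanh_def)
      finally have "tanh (s / 2) * cosh (s * real k) < sinh (s * real k)" .
      then show ?thesis using top by (auto simp: top_cap_def x_def inner_real3 algebra_simps)
    next
      case bottom
      then show ?thesis using s_pos by (auto simp: bottom_cap_def x_def inner_real3)
    qed
  qed
  then have "x \<in> interior body" unfolding body_def by (intro halfspaces_interior finite_normals)
  then show ?thesis by blast
qed

section \<open>Which supporting planes meet inside the ball\<close>

lemma cap_side_disjoint:
  assumes "x \<in> H3" "x$3 = tanh (s * real h)" "hor x m = lvl i (x$3)"
  shows "i = h"
proof (rule ccontr)
  assume "i \<noteq> h"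
  have "\<bar>s * real h - s * real i\<bar> = s * \<bar>real h - real i\<bar>"
    using s_pos by (simp add: abs_mult flip: right_diff_distrib)
  also have "\<dots> \<ge> s * 1" using s_pos \<open>i \<noteq> h\<close> by (intro mult_left_mono) auto
  finally have "u / c \<le> cosh (s * real h - s * real i)" by (intro cosh_s_ge) simp
  then have "(u / c)\<^sup>2 \<le> (cosh (s * real h - s * real i))\<^sup>2"
    using u_bounds c_pos by (intro power_mono) auto
  then have "u\<^sup>2 / c \<le> c * (cosh (s * real h - s * real i))\<^sup>2"
    using c_pos by (simp add: power_divide field_simps power2_eq_square)
  \<comment> \<open>At height s h the ball is a disc of radius 1 / cosh (s h), while a side of
    another level stays at distance at least (u / sqrt c) / cosh (s h) from the axis.\<close>
  moreover have "1 < u\<^sup>2 / c" using c_less c_pos by simp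
  ultimately have "1 < c * (cosh (s * real h - s * real i))\<^sup>2" by linarith
  moreover have "(hor x m)\<^sup>2 < 1 - (x$3)\<^sup>2"
    using hor_square_le[of x m] assms(1) unfolding H3_iff by linarith
  then have "c * (cosh (s * real h - s * real i))\<^sup>2 / (cosh (s * real h))\<^sup>2 < 1 / (cosh (s * real h))\<^sup>2"
    unfolding assms(3) unfolding assms(2) lvl_tanh one_minus_tanh_square
    using c_pos by (simp add: power_mult_distrib power_divide)
  ultimately show False by (simp add: divide_less_cancel)
qed

text \<open>The Minkowski product of two normals: only the difference of the directions and that of
  the levels enter. For equal indices it gives 1 - c, the common square of all sides.\<close>

lemma side_inner:
  "fst (side i m) \<bullet> fst (side i' m') - snd (side i m) * snd (side i' m') =
    cos (of_int (m - m') * a) - c * cosh (s * real i - s * real i')"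
proof -
  have sq: "sqrt c * x * (sqrt c * y) = c * (x * y)" for x y using c_pos by simp
  show ?thesis
    by (simp add: side_def inner_real3 sq left_diff_distrib cos_diff cosh_diff)
       (simp add: algebra_simps)
qed

text \<open>Otherwise \<open>ultraparallel_planes\<close>, with q = 1 - c the common Minkowski
  square, would make the two offsets cancel, but both are positive. The conclusion is a necessary
  condition for two sides to meet inside the ball.\<close>

lemma sides_not_orthogonal:
  assumes x: "x \<in> H3" "hor x m = lvl i (x$3)" "hor x m' = lvl i' (x$3)"
  shows "cos (of_int (m - m') * a) - c * cosh (s * real i - s * real i') > - (1 - c)"
proof (rule ccontr)
  assume "\<not> ?thesis"
  then have "fst (side i m) \<bullet> fst (side i' m') - snd (side i m) * snd (side i' m') \<le> - (1 - c)"
    by (simp add: side_inner)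
  moreover have "fst (side i m) \<bullet> fst (side i m) - snd (side i m) * snd (side i m) = 1 - c" for i m
    by (simp add: side_inner)
  moreover have "norm x < 1" using x by (simp add: H3_def)
  ultimately have "snd (side i m) + snd (side i' m') = 0"
    using x by (intro ultraparallel_planes[where x = x and q = "1 - c"]) (auto simp: side_eq_iff)
  moreover have "snd (side i m) > 0" for i m using c_pos by (simp add: side_def)
  ultimately show False by (metis add_pos_pos less_irrefl)
qed

text \<open>The lower bound on the product of meeting sides leaves few residues r of m - m'. On one
  level r is even, and r = 0 means equal planes; beyond r = 2 and r = 2n - 2 the cosine is at most
  cos (4a) = 2c^2 - 1, and the bound would say c^2 > c. On consecutive levels r is odd; from r = 3
  on the cosine is at most cos (3a) = 4u^3 - 3u, and the bound would contradict u > 1/2. Levels two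
  or more apart fail even for cosine 1, since 2u^2 = 1 + c. The surviving pairs have product 0 by
  the choice of \<open>c\<close> and \<open>s\<close>.\<close>

lemma adjacent_sides:
  assumes x: "x \<in> H3" "hor x m = lvl i (x$3)" "hor x m' = lvl i' (x$3)"
    and par: "even (m - int i)" "even (m' - int i')" and ne: "side i m \<noteq> side i' m'"
  shows "(i = i' \<and> (m - m') mod (2 * int n) \<in> {2, 2 * int n - 2} \<or>
          \<bar>int i - int i'\<bar> = 1 \<and> (m - m') mod (2 * int n) \<in> {1, 2 * int n - 1}) \<and>
         fst (side i m) \<bullet> fst (side i' m') = snd (side i m) * snd (side i' m')"
proof -
  define r where "r = (m - m') mod (2 * int n)"
  have r: "0 \<le> r" "r < 2 * int n" using n_ge by (auto simp: r_def)
  have cr: "cos (of_int (m - m') * a) = cos (of_int r * a)"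
    unfolding r_def by (rule cos_multiple_cong)
  have B: "cos (of_int (m - m') * a) - c * cosh (s * real i - s * real i') > - (1 - c)"
    using sides_not_orthogonal x by blast
  consider "i = i'" | "\<bar>int i - int i'\<bar> = 1" | "\<bar>int i - int i'\<bar> \<ge> 2" by linarith
  then show ?thesis
  proof cases
    case 1
    have "even (m - m')" using par 1 by presburger
    then have ev: "even r" unfolding r_def by (simp add: dvd_mod_iff)
    have "r \<noteq> 0"
    proof
      assume "r = 0"
      then have "m mod (2 * int n) = m' mod (2 * int n)" unfolding r_def by (simp add: mod_eq_dvd_iff mod_eq_0_iff_dvd)
      then show False using ne 1 side_cong by metis
    qed
    have r2: "r = 2 \<or> r = 2 * int n - 2"
    proof (rule ccontr)
      assume "\<not> ?thesis"
      then have "4 \<le> r" "r \<le> 2 * int n - 4" using ev r \<open>r \<noteq> 0\<close> by presburger+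
      then have "cos (of_int (m - m') * a) \<le> cos (of_int 4 * a)"
        unfolding r_def by (intro cos_multiple_le) auto
      also have "\<dots> = 2 * c\<^sup>2 - 1" using cos_double_cos[of "2 * a"] by (simp add: c_def)
      finally have "2 * c\<^sup>2 - 1 - c > - (1 - c)" using B 1 by simp
      moreover have "c\<^sup>2 \<le> c" using c_pos c_less by (simp add: power2_eq_square)
      ultimately show False by linarith
    qed
    then have "cos (of_int r * a) = cos (of_int 2 * a)" using cos_multiple_reflect[of 2] by auto
    then have "cos (of_int (m - m') * a) = c" using cr by (simp add: c_def)
    then show ?thesis using r2 1 side_inner[of i m i' m'] by (simp add: r_def)
  next
    case 2
    have "odd (m - m')" using par 2 by presburger
    then have od: "odd r" unfolding r_def by (simp add: dvd_mod_iff)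
    have "s * real i - s * real i' = s \<or> s * real i - s * real i' = - s"
    proof -
      have "real i - real i' = 1 \<or> real i - real i' = -1" using 2 by linarith
      then show ?thesis by (metis mult.right_neutral mult_minus_right right_diff_distrib)
    qed
    then have ch: "c * cosh (s * real i - s * real i') = u" using cosh_s c_pos by auto
    have r1: "r = 1 \<or> r = 2 * int n - 1"
    proof (rule ccontr)
      assume "\<not> ?thesis"
      then have "3 \<le> r" "r \<le> 2 * int n - 3" using od r by presburger+
      then have "cos (of_int (m - m') * a) \<le> cos (of_int 3 * a)"
        unfolding r_def by (intro cos_multiple_le) auto
      also have "\<dots> = 4 * u ^ 3 - 3 * u" using cos_treble_cos[of a] by (simp add: u_def)
      finally have "4 * u ^ 3 - 4 * u > - (1 - c)" using B ch by simp
      then have "(1 - u\<^sup>2) * (2 - 4 * u) > 0" using c_u by (simp add: algebra_simps power2_eq_square power3_eq_cube)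
      moreover have "1 - u\<^sup>2 > 0" "2 - 4 * u < 0" using u_bounds by (auto simp: power_less_one_iff)
      ultimately show False by (metis mult_pos_neg less_asym)
    qed
    then have "cos (of_int r * a) = cos (of_int 1 * a)" using cos_multiple_reflect[of 1] by auto
    then have "cos (of_int (m - m') * a) = u" using cr by (simp add: u_def)
    then show ?thesis using r1 2 ch side_inner[of i m i' m'] by (simp add: r_def)
  next
    case 3
    have "\<bar>s * real i - s * real i'\<bar> = s * \<bar>real i - real i'\<bar>"
      using s_pos by (simp add: abs_mult flip: right_diff_distrib)
    also have "\<dots> \<ge> s * 2" using s_pos 3 by (intro mult_left_mono) linarith+
    finally have "cosh (2 * s) \<le> cosh (s * real i - s * real i')" using s_pos by (intro cosh_mono_abs) simp
    moreover have "cosh (2 * s) = 2 * (u / c)\<^sup>2 - 1" using cosh_double_cosh[of s] by (simp add: cosh_s)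
    ultimately have "c * (2 * (u / c)\<^sup>2 - 1) \<le> c * cosh (s * real i - s * real i')"
      using c_pos by (intro mult_left_mono) auto
    then have "1 - c * (2 * (u / c)\<^sup>2 - 1) > - (1 - c)" using B cos_le_one[of "of_int (m - m') * a"] by linarith
    moreover have "c * (2 * (u / c)\<^sup>2 - 1) = (1 + c) / c - c"
      using c_pos c_u by (simp add: field_simps power2_eq_square)
    ultimately have "(1 + c) / c < 2" by simp
    then have False using c_pos c_less by (simp add: field_simps)
    then show ?thesis ..
  qed
qed

theorem body_right_angled: "compact_right_angled_polyhedron body"
proof (rule compact_right_angled_polyhedron_halfspaces[OF finite_normals normals_nonzero body_def
      body_interior body_subset])
  fix v b v' b' x
  assume *: "(v, b) \<in> normals" "(v', b') \<in> normals" "(v, b) \<noteq> (v', b')" "x \<in> body"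
    "v \<bullet> x = b" "v' \<bullet> x = b'"
  define orth where "orth p q \<longleftrightarrow> fst p \<bullet> fst q = snd p * snd q" for p q :: "(real^3) \<times> real"
  have sym: "orth p q \<longleftrightarrow> orth q p" for p q
    unfolding orth_def by (metis inner_commute mult.commute)
  have xH: "x \<in> H3" using body_subset * by blast
  define tight where "tight p \<longleftrightarrow> fst p \<bullet> x = snd p" for p :: "(real^3) \<times> real"
  have ss: "orth (side i m) (side i' m')" if "tight (side i m)" "tight (side i' m')"
    "even (m - int i)" "even (m' - int i')" "side i m \<noteq> side i' m'" for i m i' m'
    using adjacent_sides[of x m i m' i'] that xH unfolding tight_def side_eq_iff orth_def by blast
  have ts: "orth top_cap (side i m)" if "tight (side i m)" "tight top_cap" for i m
  proof -
    have "i = k" using that xH cap_side_disjoint unfolding tight_def side_eq_iff top_cap_eq_iff by blast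
    then show ?thesis by (simp add: orth_def top_cap_def side_def inner_real3)
  qed
  have bs: "orth bottom_cap (side i m)" if "tight (side i m)" "tight bottom_cap" for i m
  proof -
    have "i = 0" using that xH cap_side_disjoint[of x 0] unfolding tight_def side_eq_iff bottom_cap_eq_iff by simp
    then show ?thesis by (simp add: orth_def bottom_cap_def side_def inner_real3)
  qed
  have tb: "\<not> (tight top_cap \<and> tight bottom_cap)"
    using s_pos k_ge unfolding tight_def top_cap_eq_iff bottom_cap_eq_iff by auto
  have "orth p q" if "p \<in> normals" "q \<in> normals" "p \<noteq> q" "tight p" "tight q" for p q
    using that(1)
  proof (cases p rule: normals_cases)
    case p: (side i m)
    show ?thesis using that(2)
      by (cases q rule: normals_cases) (use that p ss ts bs sym in auto)
  next
    case p: top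
    show ?thesis using that(2)
      by (cases q rule: normals_cases) (use that p ts tb in auto)
  next
    case p: bottom
    show ?thesis using that(2)
      by (cases q rule: normals_cases) (use that p bs tb in auto)
  qed
  moreover have "tight (v, b)" "tight (v', b')" using * by (auto simp: tight_def)
  ultimately have "orth (v, b) (v', b')" using *(1-3) by blast
  then show "v \<bullet> v' = b * b'" by (simp add: orth_def)
qed

end

section \<open>Vertices\<close>

text \<open>Used against pairs of planes: the normals of the planes through a vertex annihilate no
  direction in common, so two planes never exhaust them.\<close>

lemma orthogonal_to_pair_exists:
  fixes p q :: "real^3"
  shows "\<exists>d. d \<noteq> 0 \<and> p \<bullet> d = 0 \<and> q \<bullet> d = 0"
proof -
  have "dim {p, q} \<le> card {p, q}" by (intro dim_le_card') auto
  also have "\<dots> \<le> 2" by (simp add: card_insert_if)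
  finally have "dim {p, q} < DIM(real^3)" by simp
  then obtain d where "d \<noteq> 0" "\<And>y. y \<in> span {p, q} \<Longrightarrow> orthogonal d y"
    using orthogonal_to_subspace_exists by blast
  then show ?thesis by (intro exI[of _ d]) (auto simp: orthogonal_def inner_commute[of _ d] span_base)
qed

context tower
begin

lemma cos_multiple_less_1:
  fixes d :: int
  assumes "d mod (2 * int n) \<noteq> 0" shows "cos (of_int d * a) < 1"
proof -
  have "0 \<le> d mod (2 * int n)" "d mod (2 * int n) < 2 * int n" using n_ge by auto
  then have "cos (of_int d * a) \<le> cos (of_int 1 * a)" using assms by (intro cos_multiple_le) auto
  then show ?thesis using u_bounds by (simp add: u_def)
qed

lemma cos_multiple_eq_u:
  fixes d :: int
  assumes "odd d" "cos (of_int d * a) = u"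
  shows "d mod (2 * int n) = 1 \<or> d mod (2 * int n) = 2 * int n - 1"
proof (rule ccontr)
  assume neg: "\<not> ?thesis"
  define r where "r = d mod (2 * int n)"
  have r: "0 \<le> r" "r < 2 * int n" "odd r"
    using n_ge assms(1) by (auto simp: r_def dvd_mod_iff)
  have "r \<noteq> 1" "r \<noteq> 2 * int n - 1" using neg by (auto simp: r_def)
  then have "3 \<le> r" "r \<le> 2 * int n - 3" using r by presburger+
  then have "cos (of_int d * a) \<le> cos (of_int 3 * a)" unfolding r_def by (intro cos_multiple_le) auto
  also have "\<dots> < cos a" using a_bounds pi_gt_zero by (intro cos_monotone_0_pi) auto
  finally show False using assms by (simp add: u_def)
qed

lemma side_cong_mod:
  assumes "(m - m') mod (2 * int n) = 0" shows "side i m = side i m'"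
proof -
  have "m mod (2 * int n) = m' mod (2 * int n)" using assms by (simp add: mod_eq_dvd_iff mod_eq_0_iff_dvd)
  then show ?thesis by (metis side_cong)
qed

section \<open>Candidates for the vertices: where the edges between neighbouring sides end\<close>

definition \<kappa> :: real where "\<kappa> = (u * cosh s - 1) / sinh s"

lemma sinh_s_pos: "0 < sinh s" using s_pos by simp

lemma u_cosh_s: "1 < u * cosh s"
  using c_less c_pos by (simp add: cosh_s field_simps power2_eq_square)

lemma \<kappa>_pos: "0 < \<kappa>" unfolding \<kappa>_def using u_cosh_s sinh_s_pos by simp

text \<open>
  Along the direction of angle \<open>m a\<close>, the bound that level \<open>i + e\<close> imposes on the distance from the
  axis, as a multiple of that distance, is \<open>profile \<gamma> e\<close> for a point on the edge between two sides of
  level \<open>i\<close>; \<open>\<gamma>\<close> is the position on the edge, and \<open>\<kappa>\<close> is where the edge reaches level \<open>i + 1\<close>.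
\<close>

definition profile :: "real \<Rightarrow> real \<Rightarrow> real" where
  "profile \<gamma> e = u * cosh (s * e) - \<gamma> * sinh (s * e)"

definition profile' :: "real \<Rightarrow> real \<Rightarrow> real" where
  "profile' \<gamma> e = u * sinh (s * e) - \<gamma> * cosh (s * e)"

text \<open>As a function of e, a profile solves f'' = s^2 f. For \<gamma> = \<kappa> it is the
  solution with the values u at 0 and 1 at 1, and this form displays both.\<close>

lemma profile_\<kappa>: "profile \<kappa> e = (sinh (s * e) - u * sinh (s * (e - 1))) / sinh s"
proof -
  have "profile \<kappa> e * sinh s = u * cosh (s * e) * sinh s - (\<kappa> * sinh s) * sinh (s * e)"
    by (simp add: profile_def algebra_simps)
  also have "\<kappa> * sinh s = u * cosh s - 1" unfolding \<kappa>_def using sinh_s_pos by simp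
  also have "u * cosh (s * e) * sinh s - (u * cosh s - 1) * sinh (s * e) = sinh (s * e) - u * sinh (s * e - s)"
    by (simp add: sinh_diff algebra_simps)
  finally show ?thesis using sinh_s_pos by (simp add: field_simps)
qed

lemma profile'_\<kappa>: "profile' \<kappa> e = (cosh (s * e) - u * cosh (s * (e - 1))) / sinh s"
proof -
  have "profile' \<kappa> e * sinh s = u * sinh (s * e) * sinh s - (\<kappa> * sinh s) * cosh (s * e)"
    by (simp add: profile'_def algebra_simps)
  also have "\<kappa> * sinh s = u * cosh s - 1" unfolding \<kappa>_def using sinh_s_pos by simp
  also have "u * sinh (s * e) * sinh s - (u * cosh s - 1) * cosh (s * e) = cosh (s * e) - u * cosh (s * e - s)"
    by (simp add: cosh_diff algebra_simps)
  finally show ?thesis using sinh_s_pos by (simp add: field_simps)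
qed

lemma u_cosh_ge_1: "1 \<le> \<bar>e\<bar> \<Longrightarrow> 1 \<le> u * cosh (s * e)"
proof -
  assume "1 \<le> \<bar>e\<bar>"
  then have "cosh s \<le> cosh (s * e)" using s_pos by (intro cosh_mono_abs) (simp add: abs_mult)
  then have "u * cosh s \<le> u * cosh (s * e)" using u_bounds by (intro mult_left_mono) auto
  then show ?thesis using u_cosh_s by linarith
qed

text \<open>This is why no other level cuts a corner off: a side of another level would need a
  cosine above 1. The value \<gamma> = 0 belongs to an edge that ends at a cap; for \<gamma> =
  \<kappa> equality holds at e = 1, the level whose side ends the edge.\<close>

lemma profile_ge_1:
  assumes "\<gamma> = 0 \<or> \<gamma> = \<kappa>" "1 \<le> \<bar>e\<bar>" shows "1 \<le> profile \<gamma> e"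
proof -
  consider "\<gamma> = 0" | "\<gamma> = \<kappa>" "e \<le> -1" | "\<gamma> = \<kappa>" "1 \<le> e" using assms by linarith
  then show ?thesis
  proof cases
    case 1 then show ?thesis using u_cosh_ge_1 assms by (simp add: profile_def)
  next
    case 2
    then have "\<kappa> * sinh (s * e) \<le> 0" using \<kappa>_pos s_pos by (simp add: mult_le_0_iff)
    then show ?thesis using u_cosh_ge_1[OF assms(2)] 2 by (simp add: profile_def)
  next
    case 3
    let ?x = "s * (e - 1)"
    have x: "0 \<le> ?x" using s_pos 3 by simp
    have "sinh (s * e) = sinh (?x + s)" by (simp add: algebra_simps)
    also have "\<dots> = sinh ?x * cosh s + cosh ?x * sinh s" by (simp add: sinh_add)
    also have "\<dots> \<ge> sinh ?x * u + 1 * sinh s"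
      using x sinh_s_pos u_bounds cosh_real_ge_1[of s] cosh_real_ge_1[of ?x]
      by (intro add_mono mult_left_mono mult_right_mono) auto
    finally show ?thesis unfolding 3 profile_\<kappa> using sinh_s_pos by (simp add: field_simps)
  qed
qed

text \<open>Up to sign, \<open>profile'\<close> is the component along the axis of the corner after
  translation to level i + e. Its sign tells on which side of the horizontal plane of that level the
  corner lies, which decides the constraints of the caps.\<close>

lemma profile'_nonpos:
  assumes "\<gamma> = 0 \<or> \<gamma> = \<kappa>" "e \<le> 0" shows "profile' \<gamma> e \<le> 0"
proof -
  have "u * sinh (s * e) \<le> 0" using assms u_bounds s_pos by (simp add: mult_le_0_iff)
  moreover have "0 \<le> \<gamma> * cosh (s * e)" using assms \<kappa>_pos by auto
  ultimately show ?thesis by (simp add: profile'_def)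
qed

lemma profile'_nonneg:
  assumes "\<gamma> = 0 \<and> 0 \<le> e \<or> \<gamma> = \<kappa> \<and> 1 \<le> e" shows "0 \<le> profile' \<gamma> e"
  using assms
proof
  assume "\<gamma> = 0 \<and> 0 \<le> e"
  then show ?thesis using u_bounds s_pos by (simp add: profile'_def)
next
  assume *: "\<gamma> = \<kappa> \<and> 1 \<le> e"
  then have "cosh (s * (e - 1)) \<le> cosh (s * e)" using s_pos by (intro cosh_mono_abs) simp
  moreover have "u * cosh (s * (e - 1)) \<le> 1 * cosh (s * (e - 1))" using u_bounds by (intro mult_right_mono) auto
  ultimately have "0 \<le> cosh (s * e) - u * cosh (s * (e - 1))" by linarith
  then show ?thesis using * sinh_s_pos by (simp add: profile'_\<kappa>)
qed

text \<open>The position \<gamma> of the corner on its edge: zero when a cap ends the edge, and of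
  opposite signs for the level above and the level below because reflection in a level reverses
  \<gamma>.\<close>

definition tilt :: "bool \<Rightarrow> nat \<Rightarrow> real" where
  "tilt up i = (if up then (if i = k then 0 else \<kappa>) else (if i = 0 then 0 else - \<kappa>))"

definition third :: "bool \<Rightarrow> nat \<Rightarrow> int \<Rightarrow> (real^3) \<times> real" where
  "third up i m = (if up then (if i = k then top_cap else side (i + 1) m)
                   else (if i = 0 then bottom_cap else side (i - 1) m))"

text \<open>Together with \<open>sqrt c\<close> times the unit vector in direction m a,
  \<open>corner_t\<close> and \<open>corner_z\<close> are homogeneous coordinates of the corner: the
  time component and the component along the axis of a vector in Minkowski space. Accordingly
  \<open>profile_shift\<close> is the translation by s j along the axis.\<close>

definition corner_t :: "bool \<Rightarrow> nat \<Rightarrow> real" where "corner_t up i = profile (tilt up i) (- real i)"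
definition corner_z :: "bool \<Rightarrow> nat \<Rightarrow> real" where "corner_z up i = - profile' (tilt up i) (- real i)"

text \<open>The corner over the edge between the neighbouring sides \<open>side i (m - 1)\<close> and \<open>side i (m + 1)\<close>,
  cut off by the side (or cap) above or below this edge.\<close>

definition corner :: "bool \<Rightarrow> nat \<Rightarrow> int \<Rightarrow> real^3" where
  "corner up i m = vector [sqrt c / corner_t up i * cos (of_int m * a), sqrt c / corner_t up i * sin (of_int m * a),
                           corner_z up i / corner_t up i]"

lemma profile_flip: "profile \<gamma> (- e) = profile (- \<gamma>) e" "profile' \<gamma> (- e) = - profile' (- \<gamma>) e"
  by (simp_all add: profile_def profile'_def)

lemma tilt_profile:
  assumes "1 \<le> \<bar>e\<bar>" shows "1 \<le> profile (tilt up i) e"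
proof (cases up)
  case True then show ?thesis using assms profile_ge_1 by (auto simp: tilt_def)
next
  case False
  have "1 \<le> profile (- tilt up i) (- e)" using False assms by (intro profile_ge_1) (auto simp: tilt_def)
  then show ?thesis by (simp add: profile_flip)
qed

lemma corner_t_pos: "0 < corner_t up i"
proof (cases "i = 0")
  case True then show ?thesis using u_bounds by (simp add: corner_t_def profile_def)
next
  case False
  then have "1 \<le> corner_t up i" unfolding corner_t_def by (intro tilt_profile) auto
  then show ?thesis by simp
qed

lemma profile_shift:
  "corner_t up i * cosh (s * real j) - corner_z up i * sinh (s * real j) = profile (tilt up i) (real j - real i)"
  "corner_z up i * cosh (s * real j) - corner_t up i * sinh (s * real j) = - profile' (tilt up i) (real j - real i)"
  by (simp_all add: corner_t_def corner_z_def profile_def profile'_def right_diff_distrib cosh_diff sinh_diff algebra_simps)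

lemma corner_hor: "hor (corner up i m) m' = sqrt c / corner_t up i * cos (of_int (m - m') * a)"
  unfolding corner_def hor_polar by (simp add: left_diff_distrib)

lemma corner_lvl: "lvl j (corner up i m $ 3) = sqrt c / corner_t up i * profile (tilt up i) (real j - real i)"
  using corner_t_pos[of up i] by (simp add: corner_def lvl_def field_simps flip: profile_shift)

lemma corner_eq_iff: "hor (corner up i m) m' = lvl j (corner up i m $ 3) \<longleftrightarrow>
    cos (of_int (m - m') * a) = profile (tilt up i) (real j - real i)"
  unfolding corner_hor corner_lvl using corner_t_pos[of up i] c_pos by simp

lemma corner_le_iff: "hor (corner up i m) m' \<le> lvl j (corner up i m $ 3) \<longleftrightarrow>
    cos (of_int (m - m') * a) \<le> profile (tilt up i) (real j - real i)"
  unfolding corner_hor corner_lvl using corner_t_pos[of up i] c_pos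
  by (intro mult_le_cancel_left_pos) simp

text \<open>On level i all sides have the parity opposite to m, so every cosine is at most u, which
  is the value of the profile at 0. On any other level the profile is at least 1.\<close>

lemma corner_in_body:
  assumes "i \<le> k" "odd (m - int i)"
  shows "corner up i m \<in> body"
  unfolding body_iff
proof (intro conjI allI impI)
  have g: "profile' (tilt up i) (- real i) \<le> 0"
  proof (cases up)
    case True then show ?thesis by (intro profile'_nonpos) (auto simp: tilt_def)
  next
    case False
    then have "0 \<le> profile' (- tilt up i) (real i)" by (intro profile'_nonneg) (auto simp: tilt_def)
    then show ?thesis by (simp add: profile_flip)
  qed
  then show "0 \<le> corner up i m $ 3" using corner_t_pos[of up i] by (simp add: corner_def corner_z_def divide_nonpos_pos)
  have "0 \<le> profile' (tilt up i) (real k - real i)"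
  proof (cases up)
    case True then show ?thesis using assms by (intro profile'_nonneg) (auto simp: tilt_def)
  next
    case False
    then have "profile' (- tilt up i) (- (real k - real i)) \<le> 0"
      using assms by (intro profile'_nonpos) (auto simp: tilt_def)
    then show ?thesis by (simp only: profile_flip) simp
  qed
  then have "corner_z up i * cosh (s * real k) \<le> corner_t up i * sinh (s * real k)" using profile_shift(2)[of up i k] by linarith
  then show "corner up i m $ 3 \<le> tanh (s * real k)"
    using corner_t_pos[of up i] by (simp add: corner_def tanh_def field_simps)
  fix j m' assume j: "j \<le> k" "even (m' - int j)"
  show "hor (corner up i m) m' \<le> lvl j (corner up i m $ 3)"
  proof (cases "j = i")
    case True
    then have "odd (m - m')" using j assms by presburger
    then have "cos (of_int (m - m') * a) \<le> u" by (rule cos_odd_le)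
    then show ?thesis unfolding corner_le_iff using True by (simp add: profile_def)
  next
    case False
    then have "1 \<le> profile (tilt up i) (real j - real i)" by (intro tilt_profile) auto
    then show ?thesis unfolding corner_le_iff using cos_le_one[of "of_int (m - m') * a"] by linarith
  qed
qed

lemma corner_tight:
  assumes "i \<le> k"
  shows "fst (side i (m - 1)) \<bullet> corner up i m = snd (side i (m - 1))"
    and "fst (side i (m + 1)) \<bullet> corner up i m = snd (side i (m + 1))"
    and "fst (third up i m) \<bullet> corner up i m = snd (third up i m)"
proof -
  show "fst (side i (m - 1)) \<bullet> corner up i m = snd (side i (m - 1))"
    and "fst (side i (m + 1)) \<bullet> corner up i m = snd (side i (m + 1))"
    unfolding side_eq_iff corner_eq_iff by (simp_all add: profile_def u_def)
  have k1: "profile \<kappa> 1 = 1" using sinh_s_pos by (simp add: profile_\<kappa>)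
  show "fst (third up i m) \<bullet> corner up i m = snd (third up i m)"
  proof (cases up)
    case True
    show ?thesis
    proof (cases "i = k")
      case k: True
      have "profile' (tilt up i) (real k - real i) = 0" using True k by (simp add: tilt_def profile'_def)
      then have "corner_z up i * cosh (s * real k) = corner_t up i * sinh (s * real k)" using profile_shift(2)[of up i k] by linarith
      then show ?thesis using True k corner_t_pos[of up i] unfolding third_def
        by (simp add: top_cap_eq_iff corner_def tanh_def field_simps)
    next
      case k: False
      then show ?thesis using True k1 unfolding third_def
        by (simp add: side_eq_iff corner_eq_iff tilt_def)
    qed
  next
    case False
    show ?thesis
    proof (cases "i = 0")
      case k: True
      then show ?thesis using False unfolding third_def
        by (simp add: bottom_cap_eq_iff corner_def corner_z_def profile'_def tilt_def)
    next
      case k: False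
      then have "profile (tilt up i) (real (i - 1) - real i) = 1"
        using k1 False profile_flip(1)[of "- \<kappa>" 1] by (simp add: tilt_def of_nat_diff)
      then show ?thesis using False k unfolding third_def
        by (simp add: side_eq_iff corner_eq_iff)
    qed
  qed
qed

text \<open>The numbers h and g are the components of d along and across the direction m a. The
  sides m + 1 and m - 1 are mirror images in this direction, so g enters with opposite signs and a
  subtraction isolates it.\<close>

lemma side_inner_pm:
  fixes d :: "real^3"
  assumes h_def: "h = d$1 * cos (of_int m * a) + d$2 * sin (of_int m * a)"
    and g_def: "g = d$2 * cos (of_int m * a) - d$1 * sin (of_int m * a)"
  shows "fst (side i (m + 1)) \<bullet> d = h * u + g * sin a + sqrt c * sinh (s * real i) * d$3"
    and "fst (side i (m - 1)) \<bullet> d = h * u - g * sin a + sqrt c * sinh (s * real i) * d$3"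
    and "fst (side i m) \<bullet> d = h + sqrt c * sinh (s * real i) * d$3"
    and "(d$1)\<^sup>2 + (d$2)\<^sup>2 = h\<^sup>2 + g\<^sup>2"
proof -
  show "fst (side i (m + 1)) \<bullet> d = h * u + g * sin a + sqrt c * sinh (s * real i) * d$3"
    "fst (side i (m - 1)) \<bullet> d = h * u - g * sin a + sqrt c * sinh (s * real i) * d$3"
    by (simp_all add: side_def inner_real3 h_def g_def u_def distrib_right left_diff_distrib cos_add sin_add
        cos_diff sin_diff algebra_simps)
  show "fst (side i m) \<bullet> d = h + sqrt c * sinh (s * real i) * d$3"
    by (simp add: side_def inner_real3 h_def algebra_simps)
  have "h\<^sup>2 + g\<^sup>2 = ((d$1)\<^sup>2 + (d$2)\<^sup>2) * ((sin (of_int m * a))\<^sup>2 + (cos (of_int m * a))\<^sup>2)"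
    unfolding h_def g_def by algebra
  then show "(d$1)\<^sup>2 + (d$2)\<^sup>2 = h\<^sup>2 + g\<^sup>2" by simp
qed

text \<open>Once g = 0, a system of two equations in h and \<open>d$3\<close> remains. These
  inequalities say that its determinant does not vanish, the first for a third side one level below,
  the second for one level above.\<close>

lemma u_sinh_Suc: "u * sinh (s * real i) < sinh (s * (real i + 1))" "sinh (s * real i) < u * sinh (s * (real i + 1))"
proof -
  have x: "0 \<le> s * real i" using s_pos by simp
  have e: "sinh (s * (real i + 1)) = sinh (s * real i) * cosh s + cosh (s * real i) * sinh s"
    by (simp add: distrib_left sinh_add)
  have pos: "0 < u * (cosh (s * real i) * sinh s)" using u_bounds sinh_s_pos by simp
  have "sinh (s * real i) * 1 \<le> sinh (s * real i) * (u * cosh s)"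
    using x u_cosh_s by (intro mult_left_mono) auto
  then show "sinh (s * real i) < u * sinh (s * (real i + 1))" using pos unfolding e by (simp add: algebra_simps)
  have "u * sinh (s * real i) \<le> sinh (s * real i) * cosh s"
    using x u_bounds cosh_real_ge_1[of s] by (subst mult.commute) (intro mult_left_mono, auto)
  then show "u * sinh (s * real i) < sinh (s * (real i + 1))" unfolding e using sinh_s_pos
    by (smt (verit) cosh_real_pos mult_pos_pos)
qed

lemma corner_independent:
  assumes "fst (side i (m - 1)) \<bullet> d = 0" "fst (side i (m + 1)) \<bullet> d = 0" "fst (third up i m) \<bullet> d = 0"
  shows "d = 0"
proof -
  define h where "h = d$1 * cos (of_int m * a) + d$2 * sin (of_int m * a)"
  define g where "g = d$2 * cos (of_int m * a) - d$1 * sin (of_int m * a)"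
  note pm = side_inner_pm[OF h_def g_def]
  have "g * sin a = 0" "h * u + sqrt c * sinh (s * real i) * d$3 = 0"
    using assms(1,2) pm(1)[of i] pm(2)[of i] by linarith+
  then have g: "g = 0" and h: "h * u = - (sqrt c * sinh (s * real i) * d$3)" using sin_a_pos by auto
  have d3: "d$3 = 0"
  proof -
    have side: "d$3 = 0" if "fst (side j m) \<bullet> d = 0" "sinh (s * real i) \<noteq> u * sinh (s * real j)" for j
    proof -
      have "h = - (sqrt c * sinh (s * real j) * d$3)" using that(1) pm(3)[of j] by linarith
      then have "h * u = - (sqrt c * sinh (s * real j) * d$3) * u" by (rule arg_cong)
      then have "sqrt c * d$3 * (sinh (s * real i) - u * sinh (s * real j)) = 0" using h by (simp add: algebra_simps)
      then show ?thesis using that c_pos by simp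
    qed
    show ?thesis
    proof (cases up)
      case True
      then show ?thesis using assms(3) side[of "i + 1"] u_sinh_Suc(2)[of i]
        by (auto simp: third_def top_cap_def inner_real3 add.commute split: if_splits)
    next
      case False
      then show ?thesis using assms(3) side[of "i - 1"] u_sinh_Suc(1)[of "i - 1"]
        by (cases i) (auto simp: third_def bottom_cap_def inner_real3 add.commute split: if_splits)
    qed
  qed
  then have "h = 0" using h u_bounds by simp
  then have "d$1 = 0" "d$2 = 0" using pm(4) g by (auto simp: sum_power2_eq_zero_iff)
  then show "d = 0" using d3 by (simp add: vec_eq_iff forall_3)
qed

section \<open>The corners are exactly the vertices\<close>

lemma third_in_normals:
  assumes "i \<le> k" "odd (m - int i)" shows "third up i m \<in> normals"
proof -
  have "even (m - int (i + 1))" "0 < i \<Longrightarrow> even (m - int (i - 1))" using assms by (auto simp: of_nat_diff)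
  then show ?thesis using assms by (auto simp: third_def normals_def intro!: exI)
qed

lemma side_in_normals: "i \<le> k \<Longrightarrow> even (m - int i) \<Longrightarrow> side i m \<in> normals"
  by (auto simp: normals_def)

lemma corner_extreme:
  assumes "i \<le> k" "odd (m - int i)"
  shows "corner up i m extreme_point_of body"
  unfolding extreme_point_of_halfspaces[OF finite_normals body_def]
proof (intro conjI allI impI)
  show "corner up i m \<in> body" using assms by (rule corner_in_body)
  fix d assume d: "\<forall>(v, b)\<in>normals. v \<bullet> corner up i m = b \<longrightarrow> v \<bullet> d = 0"
  have d': "fst p \<bullet> d = 0" if "p \<in> normals" "fst p \<bullet> corner up i m = snd p" for p
    using d that by (cases p) auto
  show "d = 0"
    by (rule corner_independent[of i m d up])
       (use assms in \<open>auto intro!: d' corner_tight third_in_normals side_in_normals\<close>)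
qed

text \<open>No two planes exhaust the tight ones. If no level had two tight sides, then tight sides
  would occur on at most two consecutive levels, and on one level only when a cap is tight: two
  planes at most. Hence two neighbouring sides of some level i are tight, with an index \<mu>
  between them. A further tight plane must be the one that ends their edge above or below, and the
  three planes have only one point in common.\<close>

lemma extreme_is_corner:
  assumes ex: "x extreme_point_of body"
  shows "\<exists>up i m. i \<le> k \<and> odd (m - int i) \<and> 0 \<le> m \<and> m < 2 * int n \<and> x = corner up i m"
proof -
  have xb: "x \<in> body" using ex by (simp add: extreme_point_of_def)
  have xH: "x \<in> H3" using xb body_subset by blast
  define T where "T = {p \<in> normals. fst p \<bullet> x = snd p}"
  have span: "d = 0" if "\<And>p. p \<in> T \<Longrightarrow> fst p \<bullet> d = 0" for d
    using ex that unfolding extreme_point_of_halfspaces[OF finite_normals body_def] T_def by fastforce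
  have notpair: "\<exists>p\<in>T. p \<noteq> p1 \<and> p \<noteq> p2" for p1 p2
    using orthogonal_to_pair_exists[of "fst p1" "fst p2"] span by metis
  have sT: "hor x m = lvl i (x$3)" if "side i m \<in> T" for i m
    using that by (simp add: T_def side_eq_iff)
  have capT: "i = k" if "side i m \<in> T" "top_cap \<in> T" for i m
    using that sT[of i m] cap_side_disjoint[OF xH, of k m i] by (auto simp: T_def top_cap_eq_iff)
  have capB: "i = 0" if "side i m \<in> T" "bottom_cap \<in> T" for i m
    using that sT[of i m] cap_side_disjoint[OF xH, of 0 m i] by (auto simp: T_def bottom_cap_eq_iff)
  have capTB: "\<not> (top_cap \<in> T \<and> bottom_cap \<in> T)"
    using s_pos k_ge unfolding T_def mem_Collect_eq top_cap_eq_iff bottom_cap_eq_iff by auto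
  have Tcases: "(\<exists>i m. p = side i m \<and> i \<le> k \<and> even (m - int i)) \<or> p = top_cap \<or> p = bottom_cap" if "p \<in> T" for p
  proof -
    have "p \<in> normals" using that by (simp add: T_def)
    then show ?thesis by (cases rule: normals_cases) auto
  qed
  have "\<exists>i m1 m2. i \<le> k \<and> even (m1 - int i) \<and> even (m2 - int i) \<and> side i m1 \<in> T \<and> side i m2 \<in> T \<and>
      side i m1 \<noteq> side i m2"
  proof (rule ccontr)
    assume neg: "\<not> ?thesis"
    define S where "S i = {side i m | m. i \<le> k \<and> even (m - int i) \<and> side i m \<in> T}" for i
    have one: "p = q" if "p \<in> S i" "q \<in> S i" for p q i using that neg unfolding S_def by blast
    have TS: "p \<in> T \<Longrightarrow> (\<exists>i. p \<in> S i) \<or> p = top_cap \<or> p = bottom_cap" for p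
      using Tcases unfolding S_def by blast
    have capT': "p \<in> S i \<Longrightarrow> top_cap \<in> T \<Longrightarrow> i = k" for p i using capT unfolding S_def by blast
    have capB': "p \<in> S i \<Longrightarrow> bottom_cap \<in> T \<Longrightarrow> i = 0" for p i using capB unfolding S_def by blast
    define pick where "pick i = (SOME p. p \<in> S i)" for i
    have pick: "p = pick i" if "p \<in> S i" for p i
      using that one unfolding pick_def by (metis someI)
    have adj: "\<bar>int i - int j\<bar> = 1" if pq: "p \<in> S i" "q \<in> S j" "i \<noteq> j" for p q i j
    proof -
      obtain m m' where *: "p = side i m" "even (m - int i)" "p \<in> T" "q = side j m'" "even (m' - int j)" "q \<in> T"
        using pq unfolding S_def by blast
      have "p \<noteq> q"
      proof
        assume "p = q"
        then have "snd p = snd q" by simp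
        then have "\<bar>s * real i\<bar> = \<bar>s * real j\<bar>" using * c_pos by (simp add: side_def)
        then show False using s_pos pq(3) by (simp add: abs_mult)
      qed
      then show ?thesis using adjacent_sides[OF xH, of m i m' j] sT * pq(3) by auto
    qed
    consider "top_cap \<in> T" | "bottom_cap \<in> T" | "\<And>i. S i = {}" "top_cap \<notin> T" "bottom_cap \<notin> T"
      | i where "S i \<noteq> {}" "top_cap \<notin> T" "bottom_cap \<notin> T" by blast
    then show False
    proof cases
      case 1
      then have "p = top_cap \<or> p = pick k" if "p \<in> T" for p
        using TS[OF that] capT' pick capTB that by metis
      then show False using notpair by metis
    next
      case 2
      then have "p = bottom_cap \<or> p = pick 0" if "p \<in> T" for p
        using TS[OF that] capB' pick capTB that by metis
      then show False using notpair by metis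
    next
      case 3
      then show False using notpair TS by blast
    next
      case (4 i)
      \<comment> \<open>Any two levels with a tight side differ by one, so besides the least of them
        only its successor can occur.\<close>
      define i0 where "i0 = (LEAST i. S i \<noteq> {})"
      have i0: "S i0 \<noteq> {}" unfolding i0_def using 4(1) by (rule LeastI)
      have "p = pick i0 \<or> p = pick (i0 + 1)" if pT: "p \<in> T" for p
      proof -
        obtain j where j: "p \<in> S j" using TS[OF pT] 4 pT by blast
        then have "i0 \<le> j" unfolding i0_def by (intro Least_le) blast
        moreover have "j = i0 \<or> \<bar>int j - int i0\<bar> = 1" using adj j i0 by blast
        ultimately have "j = i0 \<or> j = i0 + 1" by linarith
        then show ?thesis using pick j by blast
      qed
      then show False using notpair by metis
    qed
  qed
  then obtain i m1 m2 where i: "i \<le> k" and par: "even (m1 - int i)" "even (m2 - int i)"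
    and m12: "side i m1 \<in> T" "side i m2 \<in> T" and ne: "side i m1 \<noteq> side i m2" by blast
  have "\<exists>\<mu>. odd (\<mu> - int i) \<and> side i (\<mu> + 1) \<in> T \<and> side i (\<mu> - 1) \<in> T"
  proof -
    have "(m1 - m2) mod (2 * int n) = 2 \<or> (m1 - m2) mod (2 * int n) = 2 * int n - 2"
      using adjacent_sides[OF xH sT[OF m12(1)] sT[OF m12(2)] par ne] by auto
    then show ?thesis
    proof
      assume "(m1 - m2) mod (2 * int n) = 2"
      then have "(m1 - (m2 + 2)) mod (2 * int n) = 0"
        by (metis diff_diff_eq diff_self mod_0 mod_diff_left_eq)
      then have "side i m1 = side i (m2 + 1 + 1)" by (intro side_cong_mod) (simp add: algebra_simps)
      then show ?thesis using m12 par by (intro exI[of _ "m2 + 1"]) auto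
    next
      assume "(m1 - m2) mod (2 * int n) = 2 * int n - 2"
      then have "(m1 - m2 - (2 * int n - 2)) mod (2 * int n) = 0"
        by (metis diff_self mod_0 mod_diff_left_eq)
      then have "(m1 + 2 - m2 - 2 * int n) mod (2 * int n) = 0" by (simp add: algebra_simps)
      then have "(m1 + 2 - m2) mod (2 * int n) = 0" by simp
      then have "side i m2 = side i (m1 + 1 + 1)" by (metis side_cong_mod add.assoc one_add_one)
      then show ?thesis using m12 par by (intro exI[of _ "m1 + 1"]) auto
    qed
  qed
  then obtain \<mu>' where \<mu>': "odd (\<mu>' - int i)" "side i (\<mu>' + 1) \<in> T" "side i (\<mu>' - 1) \<in> T" by blast
  define \<mu> where "\<mu> = \<mu>' mod (2 * int n)"
  have \<mu>b: "0 \<le> \<mu>" "\<mu> < 2 * int n" using n_ge by (auto simp: \<mu>_def)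
  have "\<mu>' = \<mu> + 2 * int n * (\<mu>' div (2 * int n))" by (simp add: \<mu>_def)
  then have \<mu>o: "odd (\<mu> - int i)" using \<mu>'(1) by (metis add_diff_eq diff_add_eq dvd_add_left_iff dvd_mult2 dvd_triv_left)
  have "side i (\<mu>' + 1) = side i (\<mu> + 1)" "side i (\<mu>' - 1) = side i (\<mu> - 1)"
    by (intro side_cong_mod; simp add: \<mu>_def mod_diff_right_eq)+
  then have T12: "side i (\<mu> + 1) \<in> T" "side i (\<mu> - 1) \<in> T" using \<mu>' by auto
  define h where "h = x$1 * cos (of_int \<mu> * a) + x$2 * sin (of_int \<mu> * a)"
  define g where "g = x$2 * cos (of_int \<mu> * a) - x$1 * sin (of_int \<mu> * a)"
  note pm = side_inner_pm[OF h_def g_def]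
  have "g * sin a = 0" using T12 pm(1,2)[of i] by (simp add: T_def side_def)
  then have g: "g = 0" using sin_a_pos by simp
  have hor: "hor x m = h * cos (of_int (\<mu> - m) * a)" for m
  proof -
    have "hor x m = h * cos (of_int (\<mu> - m) * a) + g * sin (of_int (m - \<mu>) * a)"
    proof -
      let ?C = "cos (of_int \<mu> * a)" and ?S = "sin (of_int \<mu> * a)"
      have "h * cos (of_int (\<mu> - m) * a) + g * sin (of_int (m - \<mu>) * a) = hor x m * (?S\<^sup>2 + ?C\<^sup>2)"
        unfolding h_def g_def hor_def of_int_diff left_diff_distrib cos_diff sin_diff by algebra
      then show ?thesis by simp
    qed
    then show ?thesis using g by simp
  qed
  have lvl: "lvl i (x$3) = h * u" using sT[OF T12(1)] hor[of "\<mu> + 1"] by (simp add: u_def)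
  have hpos: "0 < h"
  proof -
    have x3: "0 \<le> x$3" "x$3 \<le> tanh (s * real k)" using xb by (auto simp: body_iff)
    then have "x$3 < 1" using tanh_real_lt_1[of "s * real k"] by linarith
    moreover have "0 \<le> sinh (s * real i)" "sinh (s * real i) < cosh (s * real i)"
      using s_pos sinh_less_cosh_real[of "s * real i"] by auto
    ultimately have "x$3 * sinh (s * real i) < cosh (s * real i)"
      by (smt (verit) mult_left_le_one_le x3(1))
    then have "0 < h * u" using lvl c_pos by (simp add: lvl_def flip: lvl)
    then show ?thesis using u_bounds by (simp add: zero_less_mult_iff)
  qed
  obtain p where p: "p \<in> T" "p \<noteq> side i (\<mu> + 1)" "p \<noteq> side i (\<mu> - 1)" using notpair by metis
  have "\<exists>up. third up i \<mu> \<in> T"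
    using Tcases[OF p(1)]
  proof (elim disjE exE conjE)
    assume top: "p = top_cap"
    then have "i = k" using p(1) capT[OF T12(1)] by blast
    then have "third True i \<mu> = top_cap" unfolding third_def if_True by (rule if_P)
    then have "third True i \<mu> \<in> T" using p(1) top by argo
    then show ?thesis ..
  next
    assume bottom: "p = bottom_cap"
    then have "i = 0" using p(1) capB[OF T12(1)] by blast
    then have "third False i \<mu> = bottom_cap" unfolding third_def if_False by (rule if_P)
    then have "third False i \<mu> \<in> T" using p(1) bottom by argo
    then show ?thesis ..
  next
    fix j m assume j: "p = side j m" "j \<le> k" "even (m - int j)"
    have pT: "side j m \<in> T" using p j by simp
    have tm: "h * cos (of_int (\<mu> - m) * a) = lvl j (x$3)" using sT[OF pT] hor by simp
    show ?thesis
    proof (cases "j = i")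
      case True
      then have "cos (of_int (\<mu> - m) * a) = u" using tm lvl hpos by simp
      moreover have "odd (\<mu> - m)" using True j \<mu>o by presburger
      ultimately have "(\<mu> - m) mod (2 * int n) = 1 \<or> (\<mu> - m) mod (2 * int n) = 2 * int n - 1"
        by (intro cos_multiple_eq_u)
      then have "(\<mu> - 1 - m) mod (2 * int n) = 0 \<or> (\<mu> + 1 - m) mod (2 * int n) = 0"
      proof
        assume "(\<mu> - m) mod (2 * int n) = 1"
        then have "(\<mu> - m - 1) mod (2 * int n) = 0" by (metis diff_self mod_0 mod_diff_left_eq)
        then show ?thesis by (simp add: algebra_simps)
      next
        assume "(\<mu> - m) mod (2 * int n) = 2 * int n - 1"
        then have "(\<mu> - m - (2 * int n - 1)) mod (2 * int n) = 0" by (metis diff_self mod_0 mod_diff_left_eq)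
        then have "(\<mu> + 1 - m - 2 * int n) mod (2 * int n) = 0" by (simp add: algebra_simps)
        then show ?thesis by simp
      qed
      then show ?thesis using p(2,3) j True side_cong_mod by metis
    next
      case False
      have "even (m - int j)" "even (\<mu> + 1 - int i)" using j \<mu>o by auto
      then have ij: "\<bar>int j - int i\<bar> = 1"
        using adjacent_sides[OF xH sT[OF pT] sT[OF T12(1)]] p j False by auto
      then have "even (\<mu> - int j)" using \<mu>o by presburger
      \<comment> \<open>Level j also has a side in direction \<mu>, straight over the edge. Since h
        > 0, a point of the body on another side of level j would violate it.\<close>
      then have "hor x \<mu> \<le> lvl j (x$3)" using xb j by (simp add: body_iff)
      then have "h * 1 \<le> h * cos (of_int (\<mu> - m) * a)" using hor[of \<mu>] tm by simp
      then have "1 \<le> cos (of_int (\<mu> - m) * a)" using hpos by simp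
      then have "(\<mu> - m) mod (2 * int n) = 0" using cos_multiple_less_1[of "\<mu> - m"] by linarith
      then have "side j \<mu> \<in> T" using pT side_cong_mod by metis
      moreover have "j = i + 1 \<and> i \<noteq> k \<or> j = i - 1 \<and> i \<noteq> 0" using ij j by linarith
      ultimately have "third True i \<mu> \<in> T \<or> third False i \<mu> \<in> T" by (auto simp: third_def)
      then show ?thesis by blast
    qed
  qed
  then obtain up where up: "third up i \<mu> \<in> T" by blast
  have "x - corner up i \<mu> = 0"
    using T12 up corner_tight[OF i, where m = \<mu> and up = up]
    by (intro corner_independent[of i \<mu> _ up]) (simp_all add: T_def inner_diff_right)
  then show ?thesis using i \<mu>o \<mu>b by auto
qed

text \<open>Projecting each corner on the direction of the other bounds the radii both ways; they
  agree, and so do the angles. A corner lying on the sides of a second level would need the profile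
  value u < 1 there. Translated back to level i, the coordinates recover the tilt; it tells up from
  down because \<kappa> > 0 and, as k is positive, level i is not at once the lowest and the
  highest.\<close>

lemma corner_inj:
  assumes eq: "corner up i m = corner up' i' m'"
    and i: "i \<le> k" "odd (m - int i)" "0 \<le> m" "m < 2 * int n"
    and i': "i' \<le> k" "odd (m' - int i')" "0 \<le> m'" "m' < 2 * int n"
  shows "up = up' \<and> i = i' \<and> m = m'"
proof -
  let ?\<rho> = "sqrt c / corner_t up i" and ?\<rho>' = "sqrt c / corner_t up' i'"
  have \<rho>: "0 < ?\<rho>" "0 < ?\<rho>'" using corner_t_pos c_pos by simp_all
  have hm: "?\<rho> * cos (of_int (m - l) * a) = ?\<rho>' * cos (of_int (m' - l) * a)" for l
    using arg_cong[OF eq, of "\<lambda>x. hor x l"] by (simp add: corner_hor)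
  have "?\<rho> = ?\<rho>' * cos (of_int (m' - m) * a)" "?\<rho> * cos (of_int (m - m') * a) = ?\<rho>'"
    using hm[of m] hm[of m'] by simp_all
  then have le: "?\<rho> \<le> ?\<rho>'" "?\<rho>' \<le> ?\<rho>" using \<rho> by (metis cos_le_one mult.right_neutral mult_left_mono less_imp_le)+
  then have \<rho>eq: "?\<rho> = ?\<rho>'" by simp
  then have "cos (of_int (m - m') * a) = 1"
    using \<open>?\<rho> * cos (of_int (m - m') * a) = ?\<rho>'\<close> \<rho> by (metis less_irrefl mult_cancel_left2)
  then have "(m - m') mod (2 * int n) = 0" using cos_multiple_less_1[of "m - m'"] by auto
  then have mm: "m = m'" using i i' by (metis mod_pos_pos_trivial mod_eq_dvd_iff mod_eq_0_iff_dvd)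
  have "i = i'"
  proof (rule ccontr)
    assume "i \<noteq> i'"
    have "hor (corner up i m) (m + 1) = lvl i' (corner up i m $ 3)"
      using corner_tight(2)[OF i'(1), where m = m' and up = up'] eq mm by (simp add: side_eq_iff)
    then have "u = profile (tilt up i) (real i' - real i)" unfolding corner_eq_iff by (simp add: u_def)
    moreover have "1 \<le> profile (tilt up i) (real i' - real i)" using \<open>i \<noteq> i'\<close> by (intro tilt_profile) auto
    ultimately show False using u_bounds by simp
  qed
  have vt: "corner_t up i = corner_t up' i'" using \<rho>eq c_pos corner_t_pos[of up i] corner_t_pos[of up' i'] by (simp add: field_simps)
  have "corner_z up i / corner_t up i = corner_z up' i' / corner_t up' i'" using arg_cong[OF eq, of "\<lambda>x. x $ 3"] by (simp add: corner_def)
  then have vz: "corner_z up i = corner_z up' i'" using vt corner_t_pos[of up' i'] by simp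
  have "tilt up i = tilt up' i'"
    using vt vz profile_shift(2)[of up i i] profile_shift(2)[of up' i' i'] \<open>i = i'\<close> by (simp add: profile'_def)
  then have "up = up'" using \<open>i = i'\<close> \<kappa>_pos k_ge by (auto simp: tilt_def split: if_splits)
  then show ?thesis using mm \<open>i = i'\<close> by simp
qed

lemma card_parity:
  fixes p :: int
  shows "card {m. odd (m - p) \<and> 0 \<le> m \<and> m < 2 * int n} = n"
proof -
  define q where "q = (p + 1) mod 2"
  have q: "q = 0 \<or> q = 1" and qp: "odd (q - p)" unfolding q_def by presburger+
  have "{m. odd (m - p) \<and> 0 \<le> m \<and> m < 2 * int n} = (\<lambda>l. 2 * int l + q) ` {..<n}"
  proof (intro set_eqI iffI)
    fix m assume m: "m \<in> {m. odd (m - p) \<and> 0 \<le> m \<and> m < 2 * int n}"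
    then have "even (m - q)" using qp by simp
    then obtain l where "m = 2 * l + q" by (metis add_diff_cancel_right' dvdE diff_add_cancel)
    then show "m \<in> (\<lambda>l. 2 * int l + q) ` {..<n}" using m q by (intro image_eqI[of _ _ "nat l"]) auto
  next
    fix m assume "m \<in> (\<lambda>l. 2 * int l + q) ` {..<n}"
    then obtain l where l: "m = 2 * int l + q" "l < n" by blast
    then show "m \<in> {m. odd (m - p) \<and> 0 \<le> m \<and> m < 2 * int n}" using q qp by auto
  qed
  also have "card \<dots> = n" by (subst card_image) (auto simp: inj_on_def)
  finally show ?thesis .
qed

theorem vert_body: "vert body = 2 * n * (k + 1)"
proof -
  define I where "I = (UNIV :: bool set) \<times> (SIGMA i:{..k}. {m. odd (m - int i) \<and> 0 \<le> m \<and> m < 2 * int n})"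
  have "bij_betw (\<lambda>(up, i, m). corner up i m) I {v. v extreme_point_of body}"
    unfolding bij_betw_def
  proof
    show "inj_on (\<lambda>(up, i, m). corner up i m) I"
      by (intro inj_onI) (auto simp: I_def dest: corner_inj)
    show "(\<lambda>(up, i, m). corner up i m) ` I = {v. v extreme_point_of body}"
    proof (intro set_eqI iffI)
      fix x assume "x \<in> (\<lambda>(up, i, m). corner up i m) ` I"
      then show "x \<in> {v. v extreme_point_of body}" by (auto simp: I_def corner_extreme)
    next
      fix x assume "x \<in> {v. v extreme_point_of body}"
      then obtain up i m where "i \<le> k" "odd (m - int i)" "0 \<le> m" "m < 2 * int n" "x = corner up i m"
        using extreme_is_corner by blast
      then show "x \<in> (\<lambda>(up, i, m). corner up i m) ` I"
        by (intro image_eqI[of _ _ "(up, i, m)"]) (auto simp: I_def)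
    qed
  qed
  then have "vert body = card I" unfolding vert_def by (metis bij_betw_same_card)
  also have "\<dots> = 2 * (\<Sum>i\<le>k. card {m. odd (m - int i) \<and> 0 \<le> m \<and> m < 2 * int n})"
    unfolding I_def by (subst card_cartesian_product, subst card_SigmaI) (auto intro: finite_subset[of _ "{0..<2 * int n}"])
  also have "\<dots> = 2 * n * (k + 1)" unfolding card_parity by simp
  finally show ?thesis .
qed

end

section \<open>Polar coordinates\<close>

text \<open>Comparing measures on boxes shows that Lebesgue measure is the image under tan of the
  density 1 + tan^2; the substitution then holds for every measurable g.\<close>

lemma nn_integral_tan_substitution:
  fixes g :: "real \<Rightarrow> ennreal"
  assumes [measurable]: "g \<in> borel_measurable borel"
  shows "(\<integral>\<^sup>+t. g t \<partial>lborel) =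
    (\<integral>\<^sup>+\<psi>. ennreal (1 + (tan \<psi>)\<^sup>2) * g (tan \<psi>) * indicator {-(pi/2)<..<pi/2} \<psi> \<partial>lborel)"
proof -
  have [measurable]: "(tan :: real \<Rightarrow> real) \<in> borel_measurable borel"
    unfolding tan_def[abs_def] by measurable
  let ?d = "\<lambda>\<psi>::real. ennreal (1 + (tan \<psi>)\<^sup>2) * indicator {-(pi/2)<..<pi/2} \<psi>"
  have "lborel = distr (density lborel ?d) borel tan"
  proof (rule lborel_eqI)
    fix l u :: real assume "\<And>b. b \<in> Basis \<Longrightarrow> l \<bullet> b \<le> u \<bullet> b"
    then have lu: "l \<le> u" by simp
    have S: "tan -` box l u \<in> sets (borel :: real measure)"
      using measurable_sets[of tan borel "borel :: real measure" "box l u"] by simp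
    have "emeasure (distr (density lborel ?d) borel tan) (box l u) =
        emeasure (density lborel ?d) (tan -` box l u)"
      by (subst emeasure_distr) auto
    also have "\<dots> =
        (\<integral>\<^sup>+\<psi>. ?d \<psi> * indicator (tan -` box l u) \<psi> \<partial>lborel)"
      by (rule emeasure_density) (use S in auto)
    also have "\<dots> = (\<integral>\<^sup>+\<psi>. ennreal (1 + (tan \<psi>)\<^sup>2) * indicator {arctan l..arctan u} \<psi> \<partial>lborel)"
    proof (rule nn_integral_cong_AE)
      have "AE \<psi> in lborel. \<psi> \<noteq> arctan l" "AE \<psi> in lborel. \<psi> \<noteq> arctan u" by (rule AE_lborel_singleton)+
      then show "AE \<psi> in lborel. ?d \<psi> * indicator (tan -` box l u) \<psi> =
          ennreal (1 + (tan \<psi>)\<^sup>2) * indicator {arctan l..arctan u} \<psi>"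
      proof eventually_elim
        case (elim \<psi>)
        show ?case
        proof (cases "-(pi/2) < \<psi> \<and> \<psi> < pi/2")
          case True
          then have "arctan (tan \<psi>) = \<psi>" by (intro arctan_tan) auto
          then have "l < tan \<psi> \<longleftrightarrow> arctan l < \<psi>" "tan \<psi> < u \<longleftrightarrow> \<psi> < arctan u"
            by (metis arctan_less_iff)+
          then show ?thesis using True elim by (auto simp: indicator_def)
        next
          case False
          then show ?thesis using arctan_lbound[of l] arctan_ubound[of u] by (auto simp: indicator_def)
        qed
      qed
    qed
    also have "\<dots> = ennreal (tan (arctan u) - tan (arctan l))"
    proof (rule nn_integral_FTC_Icc)
      fix x assume x: "x \<in> {arctan l..arctan u}"
      then have "cos x \<noteq> 0" using cos_gt_zero_pi[of x] arctan_lbound[of l] arctan_ubound[of u] by fastforce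
      then show "(tan has_real_derivative 1 + (tan x)\<^sup>2) (at x)"
        using DERIV_tan[of x] tan_sec[of x] by (simp add: power_inverse)
    qed (use lu in \<open>auto simp: arctan_le_iff\<close>)
    finally show "emeasure (distr (density lborel ?d) borel tan) (box l u) = (\<Prod>b\<in>Basis. (u - l) \<bullet> b)"
      by (simp add: tan_arctan)
  qed simp
  then have "(\<integral>\<^sup>+t. g t \<partial>lborel) = (\<integral>\<^sup>+t. g t \<partial>distr (density lborel ?d) borel tan)" by simp
  also have "\<dots> = (\<integral>\<^sup>+\<psi>. ?d \<psi> * g (tan \<psi>) \<partial>lborel)"
    by (simp add: nn_integral_distr nn_integral_density)
  finally show ?thesis by (simp add: ac_simps)
qed

text \<open>One-dimensional substitutions suffice: on the line at height y put x = y t, exchange the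
  integrals, then put t = tan \<psi> and y = r cos \<psi>, and finally \<phi> = pi/2 - \<psi>. The
  factors y, 1 + tan^2 and cos combine to r.\<close>

lemma nn_integral_upper_half_plane_polar:
  fixes f :: "real \<times> real \<Rightarrow> ennreal"
  assumes "f \<in> borel_measurable borel"
  shows "(\<integral>\<^sup>+y. (\<integral>\<^sup>+x. f (x, y) * indicator {0<..} y \<partial>lborel) \<partial>lborel) =
    (\<integral>\<^sup>+\<phi>. (\<integral>\<^sup>+r. ennreal r * f (r * cos \<phi>, r * sin \<phi>) * indicator {0<..} r \<partial>lborel) *
       indicator {0<..<pi} \<phi> \<partial>lborel)"
proof -
  have f[measurable]: "f \<in> borel_measurable (borel \<Otimes>\<^sub>M borel)" using assms by (simp add: borel_prod)
  have [measurable]: "(tan :: real \<Rightarrow> real) \<in> borel_measurable borel"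
    unfolding tan_def[abs_def] by measurable
  have "(\<integral>\<^sup>+y. (\<integral>\<^sup>+x. f (x, y) * indicator {0<..} y \<partial>lborel) \<partial>lborel) =
      (\<integral>\<^sup>+y. (\<integral>\<^sup>+t. ennreal y * f (y * t, y) * indicator {0<..} y \<partial>lborel) \<partial>lborel)"
  proof (rule nn_integral_cong)
    fix y :: real
    show "(\<integral>\<^sup>+x. f (x, y) * indicator {0<..} y \<partial>lborel) =
      (\<integral>\<^sup>+t. ennreal y * f (y * t, y) * indicator {0<..} y \<partial>lborel)"
    proof (cases "y > 0")
      case True
      have "(\<integral>\<^sup>+x. f (x, y) \<partial>lborel) = ennreal \<bar>y\<bar> * (\<integral>\<^sup>+t. f (0 + y * t, y) \<partial>lborel)"
        by (rule nn_integral_real_affine) (use True in auto)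
      also have "\<dots> = (\<integral>\<^sup>+t. ennreal y * f (y * t, y) \<partial>lborel)"
        using True by (simp add: nn_integral_cmult)
      finally show ?thesis using True by simp
    qed simp
  qed
  also have "\<dots> = (\<integral>\<^sup>+t. (\<integral>\<^sup>+y. ennreal y * f (y * t, y) * indicator {0<..} y \<partial>lborel) \<partial>lborel)"
    by (rule lborel_pair.Fubini') measurable
  also have "\<dots> = (\<integral>\<^sup>+\<psi>. ennreal (1 + (tan \<psi>)\<^sup>2) *
      (\<integral>\<^sup>+y. ennreal y * f (y * tan \<psi>, y) * indicator {0<..} y \<partial>lborel) *
      indicator {-(pi/2)<..<pi/2} \<psi> \<partial>lborel)"
    by (rule nn_integral_tan_substitution) measurable
  also have "\<dots> = (\<integral>\<^sup>+\<psi>. (\<integral>\<^sup>+r. ennreal r * f (r * sin \<psi>, r * cos \<psi>) * indicator {0<..} r \<partial>lborel) *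
      indicator {-(pi/2)<..<pi/2} \<psi> \<partial>lborel)"
  proof (rule nn_integral_cong)
    fix \<psi> :: real
    show "ennreal (1 + (tan \<psi>)\<^sup>2) * (\<integral>\<^sup>+y. ennreal y * f (y * tan \<psi>, y) * indicator {0<..} y \<partial>lborel) *
      indicator {-(pi/2)<..<pi/2} \<psi> =
      (\<integral>\<^sup>+r. ennreal r * f (r * sin \<psi>, r * cos \<psi>) * indicator {0<..} r \<partial>lborel) *
      indicator {-(pi/2)<..<pi/2} \<psi>"
    proof (cases "\<psi> \<in> {-(pi/2)<..<pi/2}")
      case True
      then have cp: "0 < cos \<psi>" by (intro cos_gt_zero_pi) auto
      let ?C = "cos \<psi>"
      have "(\<integral>\<^sup>+y. ennreal y * f (y * tan \<psi>, y) * indicator {0<..} y \<partial>lborel) = ennreal \<bar>?C\<bar> *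
        (\<integral>\<^sup>+r. ennreal (0 + ?C * r) * f ((0 + ?C * r) * tan \<psi>, 0 + ?C * r) * indicator {0<..} (0 + ?C * r) \<partial>lborel)"
        by (rule nn_integral_real_affine) (use cp in \<open>auto\<close>)
      also have "\<dots> = ennreal ?C * (\<integral>\<^sup>+r. ennreal ?C * (ennreal r * f (r * sin \<psi>, r * cos \<psi>) * indicator {0<..} r) \<partial>lborel)"
      proof -
        have "ennreal (0 + ?C * r) * f ((0 + ?C * r) * tan \<psi>, 0 + ?C * r) * indicator {0<..} (0 + ?C * r) =
            ennreal ?C * (ennreal r * f (r * sin \<psi>, r * cos \<psi>) * indicator {0<..} r)" for r
        proof (cases "0 < r")
          case True
          then show ?thesis using cp by (simp add: ennreal_mult tan_def mult_ac)
        next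
          case False
          then have "\<not> 0 < ?C * r" using cp by (simp add: zero_less_mult_iff)
          then show ?thesis using False by simp
        qed
        then show ?thesis using cp by simp
      qed
      also have "\<dots> = ennreal ?C * ennreal ?C * (\<integral>\<^sup>+r. ennreal r * f (r * sin \<psi>, r * cos \<psi>) * indicator {0<..} r \<partial>lborel)"
        by (simp add: nn_integral_cmult mult.assoc)
      finally have eq: "(\<integral>\<^sup>+y. ennreal y * f (y * tan \<psi>, y) * indicator {0<..} y \<partial>lborel) = ennreal ?C * ennreal ?C *
         (\<integral>\<^sup>+r. ennreal r * f (r * sin \<psi>, r * cos \<psi>) * indicator {0<..} r \<partial>lborel)" .
      have "(1 + (tan \<psi>)\<^sup>2) * (?C * ?C) = 1"
        using cp sin_cos_squared_add2[of \<psi>] by (simp add: tan_def field_simps power2_eq_square)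
      then have "ennreal (1 + (tan \<psi>)\<^sup>2) * (ennreal ?C * ennreal ?C) = 1"
        using cp by (simp add: ennreal_mult[symmetric] del: ennreal_plus)
      then show ?thesis unfolding eq by (simp add: mult.assoc[symmetric])
    qed simp
  qed
  also have "\<dots> = ennreal \<bar>-1\<bar> * (\<integral>\<^sup>+\<phi>. (\<integral>\<^sup>+r. ennreal r * f (r * sin (pi/2 + (-1) * \<phi>), r * cos (pi/2 + (-1) * \<phi>)) *
      indicator {0<..} r \<partial>lborel) * indicator {-(pi/2)<..<pi/2} (pi/2 + (-1) * \<phi>) \<partial>lborel)"
    by (rule nn_integral_real_affine) auto
  also have "\<dots> = (\<integral>\<^sup>+\<phi>. (\<integral>\<^sup>+r. ennreal r * f (r * cos \<phi>, r * sin \<phi>) * indicator {0<..} r \<partial>lborel) *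
       indicator {0<..<pi} \<phi> \<partial>lborel)"
    by (auto intro!: nn_integral_cong simp: sin_diff cos_diff indicator_def)
  finally show ?thesis .
qed

text \<open>The line y = 0 is a null set, and the point reflection in the origin, which adds pi to
  the angle, carries the lower half-plane to the upper one.\<close>

lemma nn_integral_polar:
  fixes f :: "real \<times> real \<Rightarrow> ennreal"
  assumes "f \<in> borel_measurable borel"
  shows "(\<integral>\<^sup>+p. f p \<partial>lborel) =
    (\<integral>\<^sup>+\<phi>. (\<integral>\<^sup>+r. ennreal r * f (r * cos \<phi>, r * sin \<phi>) * indicator {0<..} r \<partial>lborel) *
       indicator {0<..<2*pi} \<phi> \<partial>lborel)"
proof -
  have f[measurable]: "f \<in> borel_measurable (borel \<Otimes>\<^sub>M borel)" using assms by (simp add: borel_prod)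
  define g where "g p = f (- fst p, - snd p)" for p
  have g[measurable]: "g \<in> borel_measurable (borel \<Otimes>\<^sub>M borel)" unfolding g_def by measurable
  have gb: "g \<in> borel_measurable borel" using g by (simp add: borel_prod)
  define F where "F \<phi> = (\<integral>\<^sup>+r. ennreal r * f (r * cos \<phi>, r * sin \<phi>) * indicator {0<..} r \<partial>lborel)" for \<phi>
  have [measurable]: "F \<in> borel_measurable borel" unfolding F_def by measurable
  have "(\<integral>\<^sup>+p. f p \<partial>lborel) = (\<integral>\<^sup>+p. f p \<partial>(lborel \<Otimes>\<^sub>M lborel))" by (simp add: lborel_prod)
  also have "\<dots> = (\<integral>\<^sup>+y. (\<integral>\<^sup>+x. f (x, y) \<partial>lborel) \<partial>lborel)"
    by (rule lborel_pair.nn_integral_snd[symmetric]) simp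
  also have "\<dots> = (\<integral>\<^sup>+y. (\<integral>\<^sup>+x. f (x, y) * indicator {0<..} y \<partial>lborel) +
      (\<integral>\<^sup>+x. f (x, y) * indicator {..<0} y \<partial>lborel) \<partial>lborel)"
  proof (rule nn_integral_cong_AE)
    have "AE y in lborel. y \<noteq> (0::real)" by (rule AE_lborel_singleton)
    then show "AE y in lborel. (\<integral>\<^sup>+x. f (x, y) \<partial>lborel) = (\<integral>\<^sup>+x. f (x, y) * indicator {0<..} y \<partial>lborel) +
      (\<integral>\<^sup>+x. f (x, y) * indicator {..<0} y \<partial>lborel)"
      by eventually_elim (auto simp: indicator_def)
  qed
  also have "\<dots> = (\<integral>\<^sup>+y. (\<integral>\<^sup>+x. f (x, y) * indicator {0<..} y \<partial>lborel) \<partial>lborel) +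
      (\<integral>\<^sup>+y. (\<integral>\<^sup>+x. f (x, y) * indicator {..<0} y \<partial>lborel) \<partial>lborel)"
    by (rule nn_integral_add) measurable
  also have "(\<integral>\<^sup>+y. (\<integral>\<^sup>+x. f (x, y) * indicator {..<0} y \<partial>lborel) \<partial>lborel) =
     ennreal \<bar>-1\<bar> * (\<integral>\<^sup>+y. (\<integral>\<^sup>+x. f (x, 0 + (-1) * y) * indicator {..<0} (0 + (-1) * y) \<partial>lborel) \<partial>lborel)"
    by (rule nn_integral_real_affine) auto
  also have "\<dots> = (\<integral>\<^sup>+y. (\<integral>\<^sup>+x. f (x, - y) * indicator {0<..} y \<partial>lborel) \<partial>lborel)"
    by (auto intro!: nn_integral_cong simp: indicator_def)
  also have "\<dots> = (\<integral>\<^sup>+y. (\<integral>\<^sup>+x. g (x, y) * indicator {0<..} y \<partial>lborel) \<partial>lborel)"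
  proof (rule nn_integral_cong)
    fix y :: real
    have "(\<integral>\<^sup>+x. f (x, - y) * indicator {0<..} y \<partial>lborel) = ennreal \<bar>-1\<bar> *
       (\<integral>\<^sup>+x. f (0 + (-1) * x, - y) * indicator {0<..} y \<partial>lborel)"
      by (rule nn_integral_real_affine) auto
    then show "(\<integral>\<^sup>+x. f (x, - y) * indicator {0<..} y \<partial>lborel) = (\<integral>\<^sup>+x. g (x, y) * indicator {0<..} y \<partial>lborel)"
      by (simp add: g_def)
  qed
  also have "\<dots> = (\<integral>\<^sup>+\<phi>. F (pi + 1 * \<phi>) * indicator {pi<..<2*pi} (pi + 1 * \<phi>) \<partial>lborel)"
    unfolding nn_integral_upper_half_plane_polar[OF gb] F_def
    by (intro nn_integral_cong) (auto simp: g_def indicator_def)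
  also have "\<dots> = ennreal \<bar>1\<bar> * (\<integral>\<^sup>+\<phi>. F (pi + 1 * \<phi>) * indicator {pi<..<2*pi} (pi + 1 * \<phi>) \<partial>lborel)" by simp
  also have "\<dots> = (\<integral>\<^sup>+\<phi>. F \<phi> * indicator {pi<..<2*pi} \<phi> \<partial>lborel)"
    by (rule nn_integral_real_affine[symmetric]) auto
  also have "(\<integral>\<^sup>+y. (\<integral>\<^sup>+x. f (x, y) * indicator {0<..} y \<partial>lborel) \<partial>lborel) =
      (\<integral>\<^sup>+\<phi>. F \<phi> * indicator {0<..<pi} \<phi> \<partial>lborel)"
    unfolding F_def by (rule nn_integral_upper_half_plane_polar[OF assms])
  also have "(\<integral>\<^sup>+\<phi>. F \<phi> * indicator {0<..<pi} \<phi> \<partial>lborel) + (\<integral>\<^sup>+\<phi>. F \<phi> * indicator {pi<..<2*pi} \<phi> \<partial>lborel) =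
      (\<integral>\<^sup>+\<phi>. F \<phi> * indicator {0<..<pi} \<phi> + F \<phi> * indicator {pi<..<2*pi} \<phi> \<partial>lborel)"
    by (rule nn_integral_add[symmetric]) measurable
  also have "\<dots> = (\<integral>\<^sup>+\<phi>. F \<phi> * indicator {0<..<2*pi} \<phi> \<partial>lborel)"
  proof (rule nn_integral_cong_AE)
    have "AE y in lborel. y \<noteq> pi" by (rule AE_lborel_singleton)
    then show "AE \<phi> in lborel. F \<phi> * indicator {0<..<pi} \<phi> + F \<phi> * indicator {pi<..<2*pi} \<phi> =
        F \<phi> * indicator {0<..<2*pi} \<phi>"
      by eventually_elim (use pi_gt_zero in \<open>auto simp: indicator_def\<close>)
  qed
  finally show ?thesis unfolding F_def .
qed

lemma vector3_eq_axis: "vector [x, y, z] = x *\<^sub>R axis 1 1 + y *\<^sub>R axis 2 1 + z *\<^sub>R (axis 3 1 :: real^3)"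
  by (simp add: vec_eq_iff forall_3 axis_def)

text \<open>The third coordinate is outermost because the body is sliced orthogonally to its axis.
  Comparison on boxes shows that the permutation of coordinates preserves the measure.\<close>

lemma nn_integral_real3:
  fixes f :: "real^3 \<Rightarrow> ennreal"
  assumes f[measurable]: "f \<in> borel_measurable borel"
  shows "(\<integral>\<^sup>+v. f v \<partial>lborel) =
    (\<integral>\<^sup>+z. (\<integral>\<^sup>+p. f (vector [fst p, snd p, z]) \<partial>lborel) \<partial>lborel)"
proof -
  define T :: "real \<times> real \<times> real \<Rightarrow> real^3" where "T q = vector [fst (snd q), snd (snd q), fst q]" for q
  have "continuous_on UNIV T" unfolding T_def vector3_eq_axis by (intro continuous_intros)
  then have T[measurable]: "T \<in> borel_measurable borel" by (rule borel_measurable_continuous_onI)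
  have "lborel = distr lborel borel T"
  proof (rule lborel_eqI)
    fix l u :: "real^3" assume le: "\<And>b. b \<in> Basis \<Longrightarrow> l \<bullet> b \<le> u \<bullet> b"
    have le': "l $ i \<le> u $ i" for i
      using le[of "axis i 1"] by (simp add: inner_axis Basis_vec_def axis_eq_axis)
    have "T -` box l u = box (l$3) (u$3) \<times> box (l$1) (u$1) \<times> box (l$2) (u$2)"
      by (auto simp: T_def mem_box_cart forall_3)
    then have "emeasure (distr lborel borel T) (box l u) =
        emeasure lborel (box (l$3) (u$3) \<times> (box (l$1) (u$1) \<times> box (l$2) (u$2)))"
      by (simp add: emeasure_distr)
    also have "\<dots> = emeasure (lborel \<Otimes>\<^sub>M lborel) (box (l$3) (u$3) \<times> (box (l$1) (u$1) \<times> box (l$2) (u$2)))"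
      by (simp add: lborel_prod)
    also have "\<dots> = emeasure lborel (box (l$3) (u$3)) * emeasure lborel (box (l$1) (u$1) \<times> box (l$2) (u$2))"
      by (rule lborel.emeasure_pair_measure_Times) (auto intro!: borel_open open_Times)
    also have "emeasure lborel (box (l$1) (u$1) \<times> box (l$2) (u$2)) =
        emeasure (lborel \<Otimes>\<^sub>M lborel) (box (l$1) (u$1) \<times> box (l$2) (u$2))"
      by (simp add: lborel_prod)
    also have "\<dots> = emeasure lborel (box (l$1) (u$1)) * emeasure lborel (box (l$2) (u$2))"
      by (rule lborel.emeasure_pair_measure_Times) auto
    also have "emeasure lborel (box (l$3) (u$3)) * \<dots> =
        ennreal (u$3 - l$3) * (ennreal (u$1 - l$1) * ennreal (u$2 - l$2))"
      using le' by simp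
    also have "\<dots> = ennreal ((u$1 - l$1) * (u$2 - l$2) * (u$3 - l$3))"
      using le' by (simp add: ennreal_mult mult_ac)
    also have "(u$1 - l$1) * (u$2 - l$2) * (u$3 - l$3) = (\<Prod>b\<in>Basis. (u - l) \<bullet> b)"
    proof -
      have B: "(Basis :: (real^3) set) = (\<lambda>i. axis i 1) ` UNIV" by (auto simp: Basis_vec_def)
      have "inj (\<lambda>i. axis i 1 :: real^3)" by (simp add: inj_on_def axis_eq_axis)
      then have "(\<Prod>b\<in>Basis. (u - l) \<bullet> b) = (\<Prod>i\<in>UNIV. (u - l) $ i)"
        unfolding B by (subst prod.reindex) (simp_all add: inner_axis)
      also have "\<dots> = (u - l) $ 1 * (u - l) $ 2 * (u - l) $ 3"
        unfolding UNIV_3 by (simp add: mult.assoc)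
      finally show ?thesis by simp
    qed
    finally show "emeasure (distr lborel borel T) (box l u) = (\<Prod>b\<in>Basis. (u - l) \<bullet> b)" .
  qed simp
  then have "(\<integral>\<^sup>+v. f v \<partial>lborel) = (\<integral>\<^sup>+v. f v \<partial>distr lborel borel T)" by simp
  also have "\<dots> = (\<integral>\<^sup>+q. f (T q) \<partial>lborel)" by (rule nn_integral_distr) auto
  also have "\<dots> = (\<integral>\<^sup>+q. f (T q) \<partial>(lborel \<Otimes>\<^sub>M lborel))" by (simp add: lborel_prod)
  also have "\<dots> = (\<integral>\<^sup>+z. (\<integral>\<^sup>+p. f (T (z, p)) \<partial>lborel) \<partial>lborel)"
  proof (rule lborel.nn_integral_fst[symmetric])
    have "(\<lambda>q. f (T q)) \<in> borel_measurable borel" by measurable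
    then show "(\<lambda>q. f (T q)) \<in> borel_measurable (lborel \<Otimes>\<^sub>M lborel)" by (simp add: lborel_prod)
  qed
  finally show ?thesis by (simp add: T_def)
qed

section \<open>The Lobachevsky function\<close>

definition ln_sin :: "real \<Rightarrow> real" where
  "ln_sin t = ln \<bar>2 * sin t\<bar>"

lemma has_integral_affine_real:
  fixes f :: "real \<Rightarrow> real"
  assumes "(f has_integral I) {a..b}" "m > 0" "a' = (a - c) / m" "b' = (b - c) / m"
  shows "((\<lambda>x. f (m * x + c)) has_integral (I / m)) {a'..b'}"
  using has_integral_affinity'[of f I a b m c] assms by (simp add: divide_inverse mult.commute)

lemma has_integral_reflect_affine_real:
  fixes f :: "real \<Rightarrow> real"
  assumes "(f has_integral I) {a..b}"
  shows "((\<lambda>x. f (d - x)) has_integral I) {d - b..d - a}"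
proof -
  have "((\<lambda>x. f (- x)) has_integral I) {- b..- a}" using assms by simp
  from has_integral_affine_real[OF this, of 1 "d - b" "- d" "d - a"] show ?thesis by simp
qed

text \<open>The singularity at 0 is dominated by a multiple of 1 / sqrt x, which has an explicit
  antiderivative: concavity gives sin x at least 2x/pi, and ln y is at most y/2, applied to y = sqrt
  (pi/x).\<close>

lemma ln_sin_integrable_half: "ln_sin absolutely_integrable_on {0..pi/2}"
proof (rule measurable_bounded_by_integrable_imp_absolutely_integrable)
  have "ln_sin \<in> borel_measurable lborel" unfolding ln_sin_def[abs_def] by measurable
  then show "ln_sin \<in> borel_measurable (lebesgue_on {0..pi/2})"
    by (intro measurable_restrict_space1 measurable_completion)
  have "((\<lambda>x. 1 / sqrt x) has_integral (2 * sqrt (pi / 2) - 2 * sqrt 0)) {0..pi/2}"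
  proof (rule fundamental_theorem_of_calculus_interior)
    fix x :: real assume "x \<in> {0<..<pi/2}"
    then show "((\<lambda>x. 2 * sqrt x) has_vector_derivative 1 / sqrt x) (at x)"
      unfolding has_real_derivative_iff_has_vector_derivative[symmetric]
      by (auto intro!: derivative_eq_intros simp: field_simps)
  qed (auto intro!: continuous_intros)
  from has_integral_mult_right[OF this, of "sqrt pi"]
  have "(\<lambda>x. sqrt pi * (1 / sqrt x)) integrable_on {0..pi/2}" by blast
  then show "(\<lambda>x. ln 2 + sqrt pi * (1 / sqrt x)) integrable_on {0..pi/2}"
    by (intro integrable_add integrable_const_ivl)
  fix x :: real assume x: "x \<in> {0..pi/2}"
  show "norm (ln_sin x) \<le> ln 2 + sqrt pi * (1 / sqrt x)"
  proof (cases "x = 0")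
    \<comment> \<open>The conventions ln 0 = 0 and 1 / 0 = 0 apply at the endpoint.\<close>
    case True then show ?thesis by (simp add: ln_sin_def)
  next
    case False
    then have x0: "0 < x" using x by simp
    have "2 * x / pi \<le> sin x"
    proof -
      have "concave_on {0..pi} sin"
        unfolding concave_on_def
        by (rule f''_ge0_imp_convex[where f' = "\<lambda>x. - cos x" and f'' = sin])
           (auto intro!: derivative_eq_intros sin_ge_zero)
      then have "sin ((1 - 2 * x / pi) *\<^sub>R 0 + (2 * x / pi) *\<^sub>R (pi / 2)) \<ge>
          (1 - 2 * x / pi) * sin 0 + (2 * x / pi) * sin (pi / 2)"
        using x pi_gt_zero by (intro concave_onD) (auto simp: field_simps)
      then show ?thesis by simp
    qed
    moreover have "x / pi \<le> 2 * (2 * x / pi)" "0 < 2 * x / pi" using x0 by (auto simp: field_simps)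
    ultimately have s: "x / pi \<le> 2 * sin x" "0 < 2 * sin x" by linarith+
    have l: "ln_sin x = ln (2 * sin x)" using s by (simp add: ln_sin_def)
    have "ln (2 * sin x) \<le> ln 2" using s sin_le_one[of x] by (subst ln_le_cancel_iff) auto
    moreover have "- ln (2 * sin x) \<le> sqrt (pi / x)"
    proof -
      have "ln (x / pi) \<le> ln (2 * sin x)" using s x0 by (subst ln_le_cancel_iff) auto
      moreover have "- ln (x / pi) = 2 * ln (sqrt (pi / x))" using x0 by (simp add: ln_sqrt ln_div)
      moreover have "ln (sqrt (pi / x)) \<le> sqrt (pi / x) / 2"
      proof -
        \<comment> \<open>The tangent of ln at 2; its constant term is absorbed by ln 2 < 1.\<close>
        have "ln (sqrt (pi / x) / 2) \<le> sqrt (pi / x) / 2 - 1" using x0 by (intro ln_le_minus_one) auto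
        then have "ln (sqrt (pi / x)) \<le> sqrt (pi / x) / 2 - 1 + ln 2" using x0 by (simp add: ln_div)
        then show ?thesis using ln_2_less_1 by linarith
      qed
      ultimately show ?thesis by linarith
    qed
    moreover have "sqrt (pi / x) = sqrt pi * (1 / sqrt x)" by (simp add: real_sqrt_divide)
    moreover have "0 \<le> sqrt (pi / x)" "0 \<le> ln (2::real)" using x0 by auto
    ultimately show ?thesis unfolding l real_norm_def abs_le_iff by linarith
  qed
qed auto

lemma ln_sin_reflect: "ln_sin (pi - t) = ln_sin t"
  by (simp add: ln_sin_def)

lemma ln_sin_double:
  assumes "sin t \<noteq> 0" "cos t \<noteq> 0"
  shows "ln_sin (2 * t) = ln_sin t + ln_sin (pi / 2 - t)"
proof -
  have "\<bar>2 * sin (2 * t)\<bar> = \<bar>2 * sin t\<bar> * \<bar>2 * cos t\<bar>" by (simp add: sin_double abs_mult)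
  moreover have "sin (pi / 2 - t) = cos t" by (simp add: sin_diff)
  ultimately show ?thesis using assms by (simp add: ln_sin_def ln_mult)
qed

definition ln_sin_int :: "real \<Rightarrow> real" where "ln_sin_int x = integral {0..x} ln_sin"

lemma ln_sin_integrable: "0 \<le> a \<Longrightarrow> b \<le> pi \<Longrightarrow> ln_sin integrable_on {a..b}"
proof -
  have 1: "(ln_sin has_integral ln_sin_int (pi/2)) {0..pi/2}"
    unfolding ln_sin_int_def using ln_sin_integrable_half set_lebesgue_integral_eq_integral(1) by blast
  have "((\<lambda>t. ln_sin (pi - t)) has_integral ln_sin_int (pi/2)) {pi - pi/2..pi - 0}"
    by (rule has_integral_reflect_affine_real[OF 1])
  then have "(ln_sin has_integral ln_sin_int (pi/2)) {pi/2..pi}" by (simp add: ln_sin_reflect)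
  then have "ln_sin integrable_on {0..pi}"
    using 1 has_integral_combine[of 0 "pi/2" pi] by (auto simp: integrable_on_def)
  then show "ln_sin integrable_on {a..b}" if "0 \<le> a" "b \<le> pi"
    using that by (rule_tac integrable_on_subinterval) auto
qed

lemma ln_sin_has_integral:
  assumes "0 \<le> a" "a \<le> b" "b \<le> pi"
  shows "(ln_sin has_integral (ln_sin_int b - ln_sin_int a)) {a..b}"
proof -
  have "ln_sin_int a + integral {a..b} ln_sin = ln_sin_int b"
    unfolding ln_sin_int_def using assms by (intro Henstock_Kurzweil_Integration.integral_combine ln_sin_integrable) auto
  moreover have "(ln_sin has_integral integral {a..b} ln_sin) {a..b}"
    using ln_sin_integrable assms by blast
  ultimately show ?thesis by (metis add_diff_cancel_left')
qed

lemma ln_sin_int_0: "ln_sin_int 0 = 0" by (simp add: ln_sin_int_def)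

text \<open>The duplication formula of the Lobachevsky function, obtained by integrating 2 sin (2t)
  = (2 sin t)(2 cos t) in logarithmic form.\<close>

lemma ln_sin_int_double:
  assumes "0 \<le> x" "x \<le> pi / 2"
  shows "ln_sin_int (2 * x) / 2 = ln_sin_int x + (ln_sin_int (pi / 2) - ln_sin_int (pi / 2 - x))"
proof -
  have "((\<lambda>t. ln_sin (2 * t + 0)) has_integral ((ln_sin_int (2 * x) - ln_sin_int 0) / 2)) {0..x}"
    by (rule has_integral_affine_real[OF ln_sin_has_integral]) (use assms in auto)
  then have 1: "((\<lambda>t. ln_sin (2 * t)) has_integral (ln_sin_int (2 * x) / 2)) {0..x}" by (simp add: ln_sin_int_0)
  have "((\<lambda>t. ln_sin (pi/2 - t)) has_integral (ln_sin_int (pi / 2) - ln_sin_int (pi / 2 - x)))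
      {pi/2 - pi/2..pi/2 - (pi/2 - x)}"
    by (rule has_integral_reflect_affine_real[OF ln_sin_has_integral]) (use assms in auto)
  then have "((\<lambda>t. ln_sin t + ln_sin (pi/2 - t)) has_integral
      (ln_sin_int x - ln_sin_int 0) + (ln_sin_int (pi / 2) - ln_sin_int (pi / 2 - x))) {0..x}"
    using assms by (intro has_integral_add ln_sin_has_integral) auto
  then have 2: "((\<lambda>t. ln_sin (2 * t)) has_integral ((ln_sin_int x - ln_sin_int 0) + (ln_sin_int (pi / 2) - ln_sin_int (pi / 2 - x)))) {0..x}"
  proof (rule has_integral_spike_finite[of "{0, pi/2}", rotated 2])
    fix t assume "t \<in> {0..x} - {0, pi / 2}"
    then have t: "0 < t" "t < pi / 2" using assms by auto
    then have "sin t > 0" "cos t > 0" by (auto intro: sin_gt_zero cos_gt_zero)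
    then show "ln_sin (2 * t) = ln_sin t + ln_sin (pi / 2 - t)" by (intro ln_sin_double) auto
  qed simp
  show ?thesis using has_integral_unique[OF 1 2] by (simp add: ln_sin_int_0)
qed

text \<open>The value at pi is twice this one by symmetry about pi/2 and four times it by the
  duplication formula.\<close>

lemma ln_sin_int_pi_half: "ln_sin_int (pi / 2) = 0"
proof -
  have "((\<lambda>t. ln_sin (pi - t)) has_integral (ln_sin_int (pi/2) - ln_sin_int 0)) {pi - pi/2..pi - 0}"
    by (rule has_integral_reflect_affine_real[OF ln_sin_has_integral]) auto
  then have "(ln_sin has_integral ln_sin_int (pi/2)) {pi/2..pi}" by (simp add: ln_sin_reflect ln_sin_int_0)
  moreover have "(ln_sin has_integral (ln_sin_int pi - ln_sin_int (pi/2))) {pi/2..pi}"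
    by (rule ln_sin_has_integral) auto
  ultimately have "ln_sin_int (pi / 2) = ln_sin_int pi - ln_sin_int (pi / 2)" by (rule has_integral_unique)
  then have "ln_sin_int pi = 2 * ln_sin_int (pi / 2)" by simp
  then show ?thesis using ln_sin_int_double[of "pi / 2"] ln_sin_int_0 by simp
qed

text \<open>At x = pi/6 the arguments 2x and pi/2 - x coincide, so the duplication formula relates
  only two values.\<close>

lemma ln_sin_int_pi_sixth: "ln_sin_int (pi / 6) = 3 / 2 * ln_sin_int (pi / 3)"
proof -
  have "pi / 2 - pi / 6 = pi / 3" by simp
  then show ?thesis using ln_sin_int_double[of "pi / 6"] ln_sin_int_pi_half by simp
qed

text \<open>The definition uses a Lebesgue integral over an interval, the computations a gauge
  integral; absolute integrability makes them agree.\<close>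

lemma Lobachevsky_eq_ln_sin_int:
  assumes "0 \<le> x" "x \<le> pi / 2" shows "Lobachevsky x = - ln_sin_int x"
proof -
  have "ln_sin absolutely_integrable_on {0..x}"
    using absolutely_integrable_on_subinterval[OF ln_sin_integrable_half] assms by auto
  moreover have "(\<lambda>t. indicator {0..x} t *\<^sub>R ln_sin t) \<in> borel_measurable lborel"
    unfolding ln_sin_def by measurable
  ultimately have "set_integrable lborel {0..x} ln_sin"
    unfolding set_integrable_def by (simp add: integrable_completion)
  then have "(LBINT t=0..x. ln_sin t) = ln_sin_int x"
    unfolding ln_sin_int_def using assms interval_integral_eq_integral[of 0 x ln_sin] by (simp add: zero_ereal_def)
  then show ?thesis by (simp add: Lobachevsky_def ln_sin_def)
qed

text \<open>The argument of ln equals 2 cos (2 \<phi>) / (2 cos \<phi>)^2, so the integrand is 2 ln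
  (2 cos \<phi>) - ln (2 cos (2 \<phi>)). With \<Lambda> for the Lobachevsky function, the two parts
  contribute 2 \<Lambda>(pi/3) and \<Lambda>(pi/6)/2 = 3/4 \<Lambda>(pi/3), which is the origin of
  the 5/4.\<close>

lemma has_integral_ln_cos:
  "((\<lambda>\<phi>. - ln (1 - 1 / (2 * (cos \<phi>)\<^sup>2))) has_integral (5 / 4 * Lobachevsky (pi / 3))) {0..pi/6}"
proof -
  have "((\<lambda>t. ln_sin (pi/2 - t)) has_integral (ln_sin_int (pi / 2) - ln_sin_int (pi / 3))) {pi/2 - pi/2..pi/2 - pi/3}"
    by (rule has_integral_reflect_affine_real[OF ln_sin_has_integral]) auto
  then have 1: "((\<lambda>t. ln_sin (pi/2 - t)) has_integral (- ln_sin_int (pi / 3))) {0..pi/6}"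
    by (simp add: ln_sin_int_pi_half)
  have "((\<lambda>t. ln_sin (pi/2 - t)) has_integral (ln_sin_int (pi / 2) - ln_sin_int (pi / 6))) {pi/2 - pi/2..pi/2 - pi/6}"
    by (rule has_integral_reflect_affine_real[OF ln_sin_has_integral]) auto
  then have "((\<lambda>t. ln_sin (pi/2 - t)) has_integral (- ln_sin_int (pi / 6))) {0..pi/3}"
    by (simp add: ln_sin_int_pi_half)
  from has_integral_affine_real[OF this, of 2 0 0 "pi/6"]
  have 2: "((\<lambda>t. ln_sin (pi/2 - 2 * t)) has_integral (- ln_sin_int (pi / 6) / 2)) {0..pi/6}" by simp
  have H: "((\<lambda>t. 2 * ln_sin (pi/2 - t) - ln_sin (pi/2 - 2 * t)) has_integral
      (2 * (- ln_sin_int (pi / 3)) - (- ln_sin_int (pi / 6) / 2))) {0..pi/6}"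
    by (intro has_integral_diff has_integral_mult_right 1 2)
  have E: "2 * (- ln_sin_int (pi / 3)) - (- ln_sin_int (pi / 6) / 2) = 5 / 4 * Lobachevsky (pi / 3)"
    by (simp add: ln_sin_int_pi_sixth Lobachevsky_eq_ln_sin_int)
  have C: "2 * ln_sin (pi/2 - t) - ln_sin (pi/2 - 2 * t) = - ln (1 - 1 / (2 * (cos t)\<^sup>2))"
    if "t \<in> {0..pi/6}" for t
  proof -
    have c: "0 < cos t" "0 < cos (2 * t)"
      by (rule cos_gt_zero_pi; use that pi_gt_zero in \<open>simp; linarith\<close>)+
    have "2 * ln_sin (pi/2 - t) - ln_sin (pi/2 - 2 * t) = 2 * ln (2 * cos t) - ln (2 * cos (2 * t))"
      using c by (simp add: ln_sin_def sin_diff)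
    also have "\<dots> = ln ((2 * cos t)\<^sup>2) - ln (2 * cos (2 * t))" using c by (subst ln_realpow) auto
    also have "\<dots> = - ln (2 * cos (2 * t) / (2 * cos t)\<^sup>2)" using c by (subst ln_div) auto
    also have "2 * cos (2 * t) / (2 * cos t)\<^sup>2 = 1 - 1 / (2 * (cos t)\<^sup>2)"
      using c(1) cos_double_cos[of t] by (simp add: power_mult_distrib field_simps)
    finally show ?thesis .
  qed
  show ?thesis using has_integral_eq[OF C H] by (simp only: E)
qed

section \<open>The limit integral\<close>

text \<open>Twice the integral of r / (2 - r^2) from the centre of a regular hexagon of inradius 1
  to its boundary, along a ray at angle \<phi> to the normal of the edge that it hits.\<close>

definition kernel :: "real \<Rightarrow> real" where
  "kernel \<phi> = - ln (1 - 1 / (2 * (cos \<phi>)\<^sup>2))"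

lemma cos_square_gt_half:
  assumes "\<bar>\<phi>\<bar> \<le> pi / 6" shows "0 < cos \<phi>" "1 < 2 * (cos \<phi>)\<^sup>2"
proof -
  have "cos (pi / 6) \<le> cos \<bar>\<phi>\<bar>" using assms pi_gt_zero by (intro cos_monotone_0_pi_le) auto
  then have c: "sqrt 3 / 2 \<le> cos \<phi>" by (simp add: cos_30)
  then show "0 < cos \<phi>" by (rule less_le_trans[rotated]) simp
  have "(sqrt 3 / 2)\<^sup>2 \<le> (cos \<phi>)\<^sup>2" using c by (intro power_mono) auto
  then show "1 < 2 * (cos \<phi>)\<^sup>2" by (simp add: power_divide)
qed

lemma kernel_nonneg:
  assumes "\<bar>\<phi>\<bar> \<le> pi / 6" shows "0 \<le> kernel \<phi>"
  using cos_square_gt_half[OF assms] unfolding kernel_def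
  by (simp add: field_simps)

lemma kernel_even: "kernel (- \<phi>) = kernel \<phi>" by (simp add: kernel_def)

text \<open>The signed angle to the nearer of the edge normals at 0 and pi/3, the only ones that
  matter in the first quadrant.\<close>

definition tent :: "real \<Rightarrow> real" where
  "tent \<phi> = (if \<phi> \<le> pi / 6 then \<phi> else \<phi> - pi / 3)"

text \<open>A quadrant of the hexagon consists of three sectors of angle pi/6, each between an edge
  normal and a corner; reflections identify them.\<close>

lemma has_integral_kernel_tent:
  "((\<lambda>\<phi>. kernel (tent \<phi>)) has_integral (15 / 4 * Lobachevsky (pi / 3))) {0..pi/2}"
proof -
  let ?J = "5 / 4 * Lobachevsky (pi / 3)"
  have 1: "(kernel has_integral ?J) {0..pi/6}"
    using has_integral_ln_cos by (simp add: kernel_def[abs_def])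
  have "((\<lambda>\<phi>. kernel (0 - \<phi>)) has_integral ?J) {0 - pi/6..0 - 0}"
    by (rule has_integral_reflect_affine_real[OF 1])
  then have "(kernel has_integral ?J) {- (pi/6)..0}" by (simp add: kernel_even)
  from has_integral_combine[OF _ _ this 1] have "(kernel has_integral (?J + ?J)) {-(pi/6)..pi/6}" by simp
  from has_integral_affine_real[OF this, of 1 "pi/6" "- (pi/3)" "pi/2"]
  have 2: "((\<lambda>\<phi>. kernel (\<phi> - pi/3)) has_integral (?J + ?J)) {pi/6..pi/2}" by simp
  have j1: "((\<lambda>\<phi>. kernel (tent \<phi>)) has_integral ?J) {0..pi/6}"
    by (rule has_integral_eq[OF _ 1]) (auto simp: tent_def)
  have j2: "((\<lambda>\<phi>. kernel (tent \<phi>)) has_integral (?J + ?J)) {pi/6..pi/2}"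
    by (rule has_integral_spike_finite[of "{pi/6}", OF _ _ 2]) (auto simp: tent_def)
  from has_integral_combine[OF _ _ j1 j2] show ?thesis by simp
qed

lemma tent_bound:
  assumes "0 \<le> \<phi>" "\<phi> \<le> pi / 2"
  shows "\<bar>tent \<phi>\<bar> \<le> pi / 6" "max (cos \<phi>) (cos (\<phi> - pi / 3)) = cos (tent \<phi>)"
proof -
  show "\<bar>tent \<phi>\<bar> \<le> pi / 6"
  proof (cases "\<phi> \<le> pi / 6")
    case True then show ?thesis using assms by (simp add: tent_def)
  next
    case False
    then have "tent \<phi> = \<phi> - pi / 3" by (simp add: tent_def)
    then show ?thesis using False assms unfolding abs_le_iff by linarith
  qed
  show "max (cos \<phi>) (cos (\<phi> - pi / 3)) = cos (tent \<phi>)"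
  proof (cases "\<phi> \<le> pi / 6")
    case True
    then have "cos (pi / 3 - \<phi>) \<le> cos \<phi>" using assms by (intro cos_monotone_0_pi_le) auto
    moreover have "cos (\<phi> - pi / 3) = cos (pi / 3 - \<phi>)" by (metis cos_minus minus_diff_eq)
    ultimately show ?thesis using True by (simp add: tent_def max_def)
  next
    case False
    then have "cos \<phi> \<le> cos \<bar>\<phi> - pi / 3\<bar>" using assms by (intro cos_monotone_0_pi_le) auto
    then show ?thesis using False by (simp add: tent_def max_def)
  qed
qed

lemma nn_integral_radial_kernel:
  assumes "\<bar>\<theta>\<bar> \<le> pi / 6"
  shows "(\<integral>\<^sup>+r. ennreal (r / (2 - r\<^sup>2)) * indicator {0..1 / cos \<theta>} r \<partial>lborel) = ennreal (kernel \<theta> / 2)"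
proof -
  let ?m = "1 / cos \<theta>" and ?F = "\<lambda>r::real. - ln (2 - r\<^sup>2) / 2"
  note c = cos_square_gt_half[OF assms]
  have m: "0 < ?m" "?m\<^sup>2 < 2" using c by (auto simp: power_divide field_simps)
  have r2: "r\<^sup>2 < 2" if "r \<in> {0..?m}" for r
  proof -
    have "r\<^sup>2 \<le> ?m\<^sup>2" using that by (intro power_mono) auto
    then show ?thesis using m by linarith
  qed
  have "(\<integral>\<^sup>+r. ennreal (r / (2 - r\<^sup>2)) * indicator {0..?m} r \<partial>lborel) = ennreal (?F ?m - ?F 0)"
  proof (rule nn_integral_FTC_Icc)
    fix r assume r: "r \<in> {0..?m}"
    then show "(?F has_real_derivative r / (2 - r\<^sup>2)) (at r)"
      using r2[OF r] by (auto intro!: derivative_eq_intros simp: field_simps)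
    show "0 \<le> r / (2 - r\<^sup>2)" using r r2[OF r] by auto
  qed (use m in auto)
  also have "?F ?m - ?F 0 = kernel \<theta> / 2"
  proof -
    have "1 - 1 / (2 * (cos \<theta>)\<^sup>2) = (2 - ?m\<^sup>2) / 2" by (simp add: power_divide field_simps)
    then have "ln (1 - 1 / (2 * (cos \<theta>)\<^sup>2)) = ln ((2 - ?m\<^sup>2) / 2)" by (rule arg_cong)
    moreover have "ln ((2 - ?m\<^sup>2) / 2) = ln (2 - ?m\<^sup>2) - ln 2" using m by (subst ln_div) auto
    ultimately show ?thesis unfolding kernel_def by (simp add: diff_divide_distrib del: power_divide)
  qed
  finally show ?thesis .
qed

text \<open>A quarter of the Voronoi hexagon of the origin in the triangular lattice of side 2: the
  edges p = 1 and p + sqrt 3 * y = 2 bisect the segments to the neighbours (2, 0) and (1, sqrt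
  3).\<close>

definition quad :: "(real \<times> real) set" where
  "quad = {(p, y). 0 \<le> p \<and> p \<le> 1 \<and> 0 \<le> y \<and> p + sqrt 3 * y \<le> 2}"

lemma quad_polar:
  assumes "0 < r" "0 < \<phi>" "\<phi> < pi / 2"
  shows "(r * cos \<phi>, r * sin \<phi>) \<in> quad \<longleftrightarrow> r \<le> 1 / cos (tent \<phi>)"
proof -
  have cs: "0 < cos \<phi>" "0 < sin \<phi>" using assms by (auto intro: cos_gt_zero sin_gt_zero2)
  have "r * cos \<phi> + sqrt 3 * (r * sin \<phi>) = 2 * (r * cos (\<phi> - pi / 3))"
    by (simp add: cos_diff cos_60 sin_60 algebra_simps)
  then have "(r * cos \<phi>, r * sin \<phi>) \<in> quad \<longleftrightarrow> r * cos \<phi> \<le> 1 \<and> r * cos (\<phi> - pi / 3) \<le> 1"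
    using assms cs by (auto simp: quad_def)
  also have "\<dots> \<longleftrightarrow> r * max (cos \<phi>) (cos (\<phi> - pi / 3)) \<le> 1"
    using assms(1) by (simp add: max_mult_distrib_left)
  also have "\<dots> \<longleftrightarrow> r \<le> 1 / cos (tent \<phi>)"
  proof -
    have "0 < cos (tent \<phi>)" using assms by (intro cos_square_gt_half(1) tent_bound(1)) auto
    moreover have "max (cos \<phi>) (cos (\<phi> - pi / 3)) = cos (tent \<phi>)" using assms by (intro tent_bound(2)) auto
    ultimately show ?thesis by (simp only:) (simp add: field_simps)
  qed
  finally show ?thesis .
qed

lemma quad_borel: "quad \<in> sets borel"
proof -
  have "closed quad"
    unfolding quad_def case_prod_beta
    by (intro closed_Collect_conj closed_Collect_le continuous_intros)
  then show ?thesis by (rule borel_closed)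
qed

text \<open>Integrating dz / z^3 from the height sqrt (2 - r^2) upwards shows that the weight is
  twice the hyperbolic volume above the hemisphere of radius sqrt 2, per unit of base area.\<close>

lemma nn_integral_quad:
  "(\<integral>\<^sup>+p. ennreal (1 / (2 - (fst p)\<^sup>2 - (snd p)\<^sup>2)) * indicator quad p \<partial>lborel) =
    ennreal (15 / 8 * Lobachevsky (pi / 3))"
proof -
  let ?f = "\<lambda>p. ennreal (1 / (2 - (fst p)\<^sup>2 - (snd p)\<^sup>2)) * indicator quad p"
  have meas: "?f \<in> borel_measurable borel"
    using quad_borel unfolding borel_prod[symmetric] by measurable
  have "(\<integral>\<^sup>+p. ?f p \<partial>lborel) =
      (\<integral>\<^sup>+\<phi>. (\<integral>\<^sup>+r. ennreal r * ?f (r * cos \<phi>, r * sin \<phi>) * indicator {0<..} r \<partial>lborel) *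
       indicator {0<..<2*pi} \<phi> \<partial>lborel)"
    by (rule nn_integral_polar[OF meas])
  also have "\<dots> = (\<integral>\<^sup>+\<phi>. ennreal (kernel (tent \<phi>) / 2) * indicator {0..pi/2} \<phi> \<partial>lborel)"
  proof (rule nn_integral_cong_AE)
    have "AE x in lborel. x \<noteq> (0::real)" "AE x in lborel. x \<noteq> pi/2" "AE x in lborel. x \<noteq> pi"
      "AE x in lborel. x \<noteq> 3*pi/2" by (rule AE_lborel_singleton)+
    then show "AE \<phi> in lborel. (\<integral>\<^sup>+r. ennreal r * ?f (r * cos \<phi>, r * sin \<phi>) * indicator {0<..} r \<partial>lborel) *
       indicator {0<..<2*pi} \<phi> = ennreal (kernel (tent \<phi>) / 2) * indicator {0..pi/2} \<phi>"
    proof eventually_elim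
      case (elim \<phi>)
      consider "0 < \<phi>" "\<phi> < pi / 2" | "\<phi> < 0 \<or> 2 * pi \<le> \<phi>" | "pi / 2 < \<phi>" "\<phi> < pi" | "pi < \<phi>" "\<phi> < 2 * pi"
        using elim by linarith
      then show ?case
      proof cases
        case 1
        have "(\<integral>\<^sup>+r. ennreal r * ?f (r * cos \<phi>, r * sin \<phi>) * indicator {0<..} r \<partial>lborel) =
          (\<integral>\<^sup>+r. ennreal (r / (2 - r\<^sup>2)) * indicator {0..1 / cos (tent \<phi>)} r \<partial>lborel)"
        proof (rule nn_integral_cong)
          fix r :: real
          show "ennreal r * ?f (r * cos \<phi>, r * sin \<phi>) * indicator {0<..} r =
              ennreal (r / (2 - r\<^sup>2)) * indicator {0..1 / cos (tent \<phi>)} r"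
          proof (cases "0 < r")
            case True
            have "(r * cos \<phi>)\<^sup>2 + (r * sin \<phi>)\<^sup>2 = r\<^sup>2 * ((sin \<phi>)\<^sup>2 + (cos \<phi>)\<^sup>2)" by algebra
            then have "(r * cos \<phi>)\<^sup>2 + (r * sin \<phi>)\<^sup>2 = r\<^sup>2" by simp
            then have e: "2 - (r * cos \<phi>)\<^sup>2 - (r * sin \<phi>)\<^sup>2 = 2 - r\<^sup>2" by linarith
            show ?thesis unfolding fst_conv snd_conv e using True quad_polar[OF True 1]
              by (auto simp: indicator_def ennreal_mult'[symmetric])
          qed (auto simp: indicator_def)
        qed
        also have "\<dots> = ennreal (kernel (tent \<phi>) / 2)"
          using 1 by (intro nn_integral_radial_kernel tent_bound(1)) auto
        finally show ?thesis using 1 by simp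
      next
        case 2
        then have "\<phi> \<notin> {0..pi/2}" "\<phi> \<notin> {0<..<2*pi}" using pi_gt_zero by (simp; linarith)+
        then show ?thesis by simp
      next
        case 3
        have "0 < sin (\<phi> - pi / 2)" using 3 by (intro sin_gt_zero) auto
        then have "cos \<phi> < 0" by (simp add: sin_diff)
        then have z: "ennreal r * ?f (r * cos \<phi>, r * sin \<phi>) * indicator {0<..} r = 0" for r
          by (auto simp: quad_def zero_le_mult_iff indicator_def)
        show ?thesis unfolding z using 3 by (simp add: indicator_def)
      next
        case 4
        have "sin \<phi> < 0" using 4 by (intro sin_lt_zero) auto
        then have z: "ennreal r * ?f (r * cos \<phi>, r * sin \<phi>) * indicator {0<..} r = 0" for r
          by (auto simp: quad_def zero_le_mult_iff indicator_def)
        show ?thesis unfolding z using 4 by (simp add: indicator_def)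
      qed
    qed
  qed
  also have "\<dots> = ennreal (15 / 8 * Lobachevsky (pi / 3))"
  proof (rule nn_integral_has_integral_lebesgue')
    show "0 \<le> kernel (tent \<phi>) / 2" if "\<phi> \<in> {0..pi/2}" for \<phi>
    proof -
      have "\<bar>tent \<phi>\<bar> \<le> pi / 6" using that tent_bound(1) by simp
      then show ?thesis using kernel_nonneg by simp
    qed
    show "((\<lambda>\<phi>. kernel (tent \<phi>) / 2) has_integral 15 / 8 * Lobachevsky (pi / 3)) {0..pi/2}"
      using has_integral_divide[OF has_integral_kernel_tent, of 2] by simp
  qed
  finally show ?thesis .
qed

lemma Lobachevsky_pi_third_nonneg: "0 \<le> Lobachevsky (pi / 3)"
proof -
  have "0 \<le> kernel (tent \<phi>)" if "\<phi> \<in> {0..pi/2}" for \<phi>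
  proof -
    have "\<bar>tent \<phi>\<bar> \<le> pi / 6" using that tent_bound(1) by simp
    then show ?thesis using kernel_nonneg by simp
  qed
  then have "0 \<le> 15 / 4 * Lobachevsky (pi / 3)" by (rule has_integral_nonneg[OF has_integral_kernel_tent])
  then show ?thesis by simp
qed

text \<open>In the coordinates p and sqrt 3 * q, the maximum is the squared height of the upper one
  of two hemispheres of radius sqrt 2, centred at opposite corners of a rectangle; sqrt 3 is the
  area of this rectangle.\<close>

definition cell :: "real \<Rightarrow> real \<Rightarrow> real" where
  "cell p q = sqrt 3 / max (2 - p\<^sup>2 - 3 * q\<^sup>2) (2 - (1 - p)\<^sup>2 - 3 * (1 - q)\<^sup>2)"

definition half_cell :: "real \<Rightarrow> real \<Rightarrow> ennreal" where
  "half_cell p q = ennreal (sqrt 3 / (2 - p\<^sup>2 - 3 * q\<^sup>2)) * indicator {0..1} p * indicator {0..1} q"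

lemma half_cell_measurable [measurable (raw)]:
  assumes [measurable]: "f \<in> borel_measurable M" "h \<in> borel_measurable M"
  shows "(\<lambda>x. half_cell (f x) (h x)) \<in> borel_measurable M"
  unfolding half_cell_def by measurable

text \<open>Both hemispheres are equally high over the bisector p + 3q = 2, and a half-turn of the
  rectangle exchanges the two parts. Stretching q by sqrt 3 carries the part at the origin onto
  \<open>quad\<close>.\<close>

proposition nn_integral_cell:
  "(\<integral>\<^sup>+q. (\<integral>\<^sup>+p. ennreal (cell p q) * indicator {0..1} p \<partial>lborel) * indicator {0..1} q \<partial>lborel) =
    ennreal (15 / 4 * Lobachevsky (pi / 3))"
proof -
  let ?A = "\<lambda>p q. half_cell p q * indicator {..2} (p + 3 * q)"
  let ?B = "\<lambda>p q. half_cell (1 - p) (1 - q) * indicator {2<..} (p + 3 * q)"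
  have split: "ennreal (cell p q) * indicator {0..1} p * indicator {0..1} q = ?A p q + ?B p q" for p q
  proof -
    have "2 - p\<^sup>2 - 3 * q\<^sup>2 - (2 - (1 - p)\<^sup>2 - 3 * (1 - q)\<^sup>2) = 2 * (2 - (p + 3 * q))"
      by (simp add: power2_eq_square algebra_simps)
    then have "cell p q = (if p + 3 * q \<le> 2 then sqrt 3 / (2 - p\<^sup>2 - 3 * q\<^sup>2)
        else sqrt 3 / (2 - (1 - p)\<^sup>2 - 3 * (1 - q)\<^sup>2))"
      unfolding cell_def by (auto simp: max_def)
    then show ?thesis by (auto simp: half_cell_def indicator_def)
  qed
  have "(\<integral>\<^sup>+q. (\<integral>\<^sup>+p. ennreal (cell p q) * indicator {0..1} p \<partial>lborel) * indicator {0..1} q \<partial>lborel) =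
      (\<integral>\<^sup>+q. (\<integral>\<^sup>+p. ?A p q + ?B p q \<partial>lborel) \<partial>lborel)"
    unfolding split[symmetric] by (intro nn_integral_cong) (auto simp: indicator_def)
  also have "\<dots> = (\<integral>\<^sup>+q. (\<integral>\<^sup>+p. ?A p q \<partial>lborel) + (\<integral>\<^sup>+p. ?B p q \<partial>lborel) \<partial>lborel)"
    by (intro nn_integral_cong nn_integral_add) measurable
  also have "\<dots> = (\<integral>\<^sup>+q. (\<integral>\<^sup>+p. ?A p q \<partial>lborel) \<partial>lborel) + (\<integral>\<^sup>+q. (\<integral>\<^sup>+p. ?B p q \<partial>lborel) \<partial>lborel)"
    by (rule nn_integral_add) measurable
  also have "(\<integral>\<^sup>+q. (\<integral>\<^sup>+p. ?B p q \<partial>lborel) \<partial>lborel) =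
      ennreal \<bar>-1\<bar> * (\<integral>\<^sup>+q. (\<integral>\<^sup>+p. ?B p (1 + (-1) * q) \<partial>lborel) \<partial>lborel)"
    by (rule nn_integral_real_affine) auto
  also have "\<dots> = (\<integral>\<^sup>+q. (\<integral>\<^sup>+p. ?B p (1 - q) \<partial>lborel) \<partial>lborel)" by simp
  also have "\<dots> = (\<integral>\<^sup>+q. (\<integral>\<^sup>+p. ?A p q \<partial>lborel) \<partial>lborel)"
  proof (rule nn_integral_cong)
    fix q :: real
    have "(\<integral>\<^sup>+p. ?B p (1 - q) \<partial>lborel) = ennreal \<bar>-1\<bar> * (\<integral>\<^sup>+p. ?B (1 + (-1) * p) (1 - q) \<partial>lborel)"
      by (rule nn_integral_real_affine) auto
    also have "\<dots> = (\<integral>\<^sup>+p. ?B (1 - p) (1 - q) \<partial>lborel)" by simp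
    also have "\<dots> = (\<integral>\<^sup>+p. ?A p q \<partial>lborel)"
    proof (rule nn_integral_cong_AE)
      \<comment> \<open>The half-turn exchanges a closed and an open half, so the two integrands may
        differ on the bisector.\<close>
      have "AE p in lborel. p \<noteq> 2 - 3 * q" by (rule AE_lborel_singleton)
      then show "AE p in lborel. ?B (1 - p) (1 - q) = ?A p q" by eventually_elim (auto simp: indicator_def)
    qed
    finally show "(\<integral>\<^sup>+p. ?B p (1 - q) \<partial>lborel) = (\<integral>\<^sup>+p. ?A p q \<partial>lborel)" .
  qed
  also have "(\<integral>\<^sup>+q. (\<integral>\<^sup>+p. ?A p q \<partial>lborel) \<partial>lborel) =
      ennreal \<bar>1 / sqrt 3\<bar> * (\<integral>\<^sup>+y. (\<integral>\<^sup>+p. ?A p (0 + 1 / sqrt 3 * y) \<partial>lborel) \<partial>lborel)"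
    by (rule nn_integral_real_affine) auto
  also have "\<dots> = (\<integral>\<^sup>+y. (\<integral>\<^sup>+p. ennreal (1 / sqrt 3) * ?A p (y / sqrt 3) \<partial>lborel) \<partial>lborel)"
    by (simp add: nn_integral_cmult)
  also have "\<dots> = (\<integral>\<^sup>+y. (\<integral>\<^sup>+p. ennreal (1 / (2 - (fst (p, y))\<^sup>2 - (snd (p, y))\<^sup>2)) * indicator quad (p, y) \<partial>lborel) \<partial>lborel)"
  proof (intro nn_integral_cong)
    fix y p :: real
    have s3: "3 * (y / sqrt 3) = sqrt 3 * y" "3 * (y / sqrt 3)\<^sup>2 = y\<^sup>2"
      by (simp_all add: power_divide real_div_sqrt field_simps)
    have iff: "p + 3 * (y / sqrt 3) \<le> 2 \<and> p \<in> {0..1} \<and> y / sqrt 3 \<in> {0..1} \<longleftrightarrow> (p, y) \<in> quad"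
    proof -
      have "y / sqrt 3 \<le> 1" if "0 \<le> p" "p + sqrt 3 * y \<le> 2"
      proof -
        have "sqrt 3 * y \<le> 2" using that by simp
        then have "3 * (y / sqrt 3) \<le> 2" using s3 by simp
        then show ?thesis by linarith
      qed
      then show ?thesis unfolding s3 using zero_le_divide_iff[of y "sqrt 3"] by (auto simp: quad_def)
    qed
    have "ennreal (1 / sqrt 3) * ?A p (y / sqrt 3) =
        ennreal (1 / sqrt 3) * ennreal (sqrt 3 / (2 - p\<^sup>2 - 3 * (y / sqrt 3)\<^sup>2)) * indicator quad (p, y)"
      using iff by (auto simp: half_cell_def indicator_def)
    also have "ennreal (1 / sqrt 3) * ennreal (sqrt 3 / (2 - p\<^sup>2 - 3 * (y / sqrt 3)\<^sup>2)) = ennreal (1 / (2 - p\<^sup>2 - y\<^sup>2))"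
      unfolding s3 by (subst ennreal_mult'[symmetric]) auto
    finally show "ennreal (1 / sqrt 3) * ?A p (y / sqrt 3) =
        ennreal (1 / (2 - (fst (p, y))\<^sup>2 - (snd (p, y))\<^sup>2)) * indicator quad (p, y)" by simp
  qed
  also have "\<dots> = (\<integral>\<^sup>+p. ennreal (1 / (2 - (fst p)\<^sup>2 - (snd p)\<^sup>2)) * indicator quad p \<partial>(lborel \<Otimes>\<^sub>M lborel))"
  proof (rule lborel_pair.nn_integral_snd)
    have "quad \<in> sets (borel \<Otimes>\<^sub>M borel)" unfolding borel_prod by (rule quad_borel)
    then show "(\<lambda>p. ennreal (1 / (2 - (fst p)\<^sup>2 - (snd p)\<^sup>2)) * indicator quad p) \<in>
        borel_measurable (lborel \<Otimes>\<^sub>M lborel)" by measurable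
  qed
  also have "\<dots> = ennreal (15 / 8 * Lobachevsky (pi / 3))"
    unfolding lborel_prod by (rule nn_integral_quad)
  also have "ennreal (15 / 8 * Lobachevsky (pi / 3)) + ennreal (15 / 8 * Lobachevsky (pi / 3)) =
      ennreal (15 / 4 * Lobachevsky (pi / 3))"
    using Lobachevsky_pi_third_nonneg by (simp flip: ennreal_plus)
  finally show ?thesis .
qed

section \<open>Volume\<close>

text \<open>Serves twice: for the height, cut into storeys of length s, and for the angle, cut into
  2n sectors of width a.\<close>

lemma nn_integral_split_intervals:
  fixes F :: "real \<Rightarrow> ennreal"
  assumes [measurable]: "F \<in> borel_measurable borel" and s: "0 < s"
  shows "(\<integral>\<^sup>+t. F t * indicator {0..s * real k} t \<partial>lborel) =
    (\<Sum>j<k. ennreal s * (\<integral>\<^sup>+q. F (s * real j + s * q) * indicator {0..1} q \<partial>lborel))"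
proof (induction k)
  case 0
  have "(\<integral>\<^sup>+t. F t * indicator {0..s * real 0} t \<partial>lborel) = (\<integral>\<^sup>+(t::real). 0 \<partial>lborel)"
  proof (rule nn_integral_cong_AE)
    have "AE t in lborel. t \<noteq> (0::real)" by (rule AE_lborel_singleton)
    then show "AE t in lborel. F t * indicator {0..s * real 0} t = 0" by eventually_elim auto
  qed
  then show ?case by simp
next
  case (Suc k)
  let ?c = "s * real k" and ?d = "s * real (Suc k)"
  have cd: "0 \<le> ?c" "?c \<le> ?d" using s by auto
  have "(\<integral>\<^sup>+t. F t * indicator {0..?d} t \<partial>lborel) =
      (\<integral>\<^sup>+t. F t * indicator {0..?c} t + F t * indicator {?c..?d} t \<partial>lborel)"
  proof (rule nn_integral_cong_AE)
    have "AE t in lborel. t \<noteq> ?c" by (rule AE_lborel_singleton)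
    then show "AE t in lborel. F t * indicator {0..?d} t =
        F t * indicator {0..?c} t + F t * indicator {?c..?d} t"
      by eventually_elim (use cd in \<open>auto simp: indicator_def\<close>)
  qed
  also have "\<dots> = (\<integral>\<^sup>+t. F t * indicator {0..?c} t \<partial>lborel) + (\<integral>\<^sup>+t. F t * indicator {?c..?d} t \<partial>lborel)"
    by (rule nn_integral_add) auto
  also have "(\<integral>\<^sup>+t. F t * indicator {?c..?d} t \<partial>lborel) =
      ennreal \<bar>s\<bar> * (\<integral>\<^sup>+q. F (?c + s * q) * indicator {?c..?d} (?c + s * q) \<partial>lborel)"
    by (rule nn_integral_real_affine) (use s in auto)
  also have "\<dots> = ennreal s * (\<integral>\<^sup>+q. F (?c + s * q) * indicator {0..1} q \<partial>lborel)"
  proof -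
    have "indicator {?c..?d} (?c + s * q) = (indicator {0..1} q :: ennreal)" for q
    proof -
      have "?d = ?c + s * 1" by (simp add: algebra_simps)
      then have "?c + s * q \<in> {?c..?d} \<longleftrightarrow> 0 \<le> s * q \<and> s * q \<le> s * 1" by auto
      also have "\<dots> \<longleftrightarrow> q \<in> {0..1}" using s by (simp add: zero_le_mult_iff)
      finally show ?thesis by (simp add: indicator_def)
    qed
    then show ?thesis using s by simp
  qed
  finally show ?case using Suc.IH by simp
qed

lemma cos_le_cos_reflect:
  assumes "0 \<le> x" "x \<le> y" "y \<le> 2 * pi - x"
  shows "cos y \<le> cos x"
proof (cases "y \<le> pi")
  case True then show ?thesis using assms by (intro cos_monotone_0_pi_le) auto
next
  case False
  then have "cos (2 * pi - y) \<le> cos x" using assms by (intro cos_monotone_0_pi_le) auto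
  then show ?thesis by (simp add: cos_diff)
qed

lemma borel_measurable_vector3 [measurable (raw)]:
  assumes [measurable]: "f \<in> borel_measurable M" "g \<in> borel_measurable M" "h \<in> borel_measurable M"
  shows "(\<lambda>x. vector [f x, g x, h x] :: real^3) \<in> borel_measurable M"
  unfolding vector3_eq_axis by measurable

lemma borel_measurable_cosh_tanh [measurable (raw)]:
  assumes [measurable]: "f \<in> borel_measurable M"
  shows "(\<lambda>x. cosh (f x :: real)) \<in> borel_measurable M" "(\<lambda>x. tanh (f x :: real)) \<in> borel_measurable M"
  unfolding cosh_def sinh_def tanh_def by measurable

lemma tanh_less_1_square: "(tanh x)\<^sup>2 < 1" for x :: real
  using one_minus_tanh_square[of x] by (smt (verit) cosh_real_pos zero_less_divide_1_iff zero_less_power)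

lemma norm_vector3: "(norm (vector [x, y, z] :: real^3))\<^sup>2 = x\<^sup>2 + y\<^sup>2 + z\<^sup>2"
  by (simp only: power2_norm_eq_inner) (simp add: inner_vec_def sum_3 power2_eq_square)

text \<open>With \<kappa> = 1 - z^2 this is the volume density on the slice at height z, integrated
  along a ray. The result is proportional to 1 / \<kappa>, which will cancel against the derivative
  of z = tanh \<tau>.\<close>

lemma nn_integral_radial_density:
  fixes \<kappa> M :: real
  assumes \<kappa>: "0 < \<kappa>" and M: "1 < M"
  shows "(\<integral>\<^sup>+r. ennreal (r / (\<kappa> - r\<^sup>2)\<^sup>2) * indicator {0..sqrt (\<kappa> / M)} r \<partial>lborel) =
    ennreal (1 / (2 * \<kappa> * (M - 1)))"
proof -
  let ?\<rho> = "sqrt (\<kappa> / M)" and ?F = "\<lambda>r::real. 1 / (2 * (\<kappa> - r\<^sup>2))"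
  have \<rho>: "0 < ?\<rho>" "?\<rho>\<^sup>2 = \<kappa> / M" using assms by auto
  have kM: "\<kappa> / M < \<kappa>" using assms by (simp add: field_simps)
  have r2: "r\<^sup>2 < \<kappa>" if "r \<in> {0..?\<rho>}" for r
  proof -
    have "r\<^sup>2 \<le> ?\<rho>\<^sup>2" using that by (intro power_mono) auto
    then show ?thesis using \<rho> kM by linarith
  qed
  have "(\<integral>\<^sup>+r. ennreal (r / (\<kappa> - r\<^sup>2)\<^sup>2) * indicator {0..?\<rho>} r \<partial>lborel) = ennreal (?F ?\<rho> - ?F 0)"
  proof (rule nn_integral_FTC_Icc)
    fix r assume r: "r \<in> {0..?\<rho>}"
    then have ne: "\<kappa> - r\<^sup>2 \<noteq> 0" using r2 by fastforce
    have "((\<lambda>r. inverse (\<kappa> - r\<^sup>2)) has_real_derivative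
        - (inverse (\<kappa> - r\<^sup>2) * (0 - 2 * r) * inverse (\<kappa> - r\<^sup>2))) (at r)"
      by (rule DERIV_inverse') (use ne in \<open>auto intro!: derivative_eq_intros\<close>)
    note D = DERIV_cdivide[OF this, of 2]
    have F: "?F = (\<lambda>r. inverse (\<kappa> - r\<^sup>2) / 2)" by (simp add: inverse_eq_divide mult.commute)
    have d: "- (inverse X * (0 - 2 * r) * inverse X) / 2 = r / X\<^sup>2" for X
      by (cases "X = 0") (auto simp: power2_eq_square field_simps)
    show "(?F has_real_derivative r / (\<kappa> - r\<^sup>2)\<^sup>2) (at r)"
      using D unfolding d F .
    show "0 \<le> r / (\<kappa> - r\<^sup>2)\<^sup>2" using r by auto
  qed (use \<rho> in auto)
  also have "?F ?\<rho> - ?F 0 = 1 / (2 * \<kappa> * (M - 1))"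
    unfolding \<rho>(2) using assms by (simp add: field_simps)
  finally show ?thesis .
qed

section \<open>The volume of the tower in cylindrical coordinates\<close>

context tower
begin

text \<open>
  At the point with cylindrical coordinates \<open>\<phi>\<close> and \<open>\<tau>\<close> (angle and hyperbolic height), \<open>p\<close> and \<open>q\<close>
  are the angle and the height relative to a side in units of \<open>a\<close> and \<open>s\<close>, and \<open>inv_sq p q\<close> is
  the inverse square of \<open>tanh\<close> of the distance from the axis at which the side is reached. In each
  cell only two sides bound the body.
\<close>

definition inv_sq :: "real \<Rightarrow> real \<Rightarrow> real" where
  "inv_sq p q = (cos (a * p))\<^sup>2 / (c * (cosh (s * q))\<^sup>2)"

definition cell_max :: "real \<Rightarrow> real \<Rightarrow> real" where
  "cell_max p q = max (inv_sq p q) (inv_sq (1 - p) (1 - q))"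

lemma cos_a_ge: "0 \<le> p \<Longrightarrow> p \<le> 1 \<Longrightarrow> u \<le> cos (a * p)"
  unfolding u_def using a_bounds pi_gt_zero by (intro cos_monotone_0_pi_le) (auto simp: mult_left_le)

text \<open>A quantitative form of the estimate that puts the body inside the ball: u^2 / ((c +
  u)/2) - 1 = (1 - u)/(c + u), and c + u < 2. The bound is of order a^2, as the dominating constant
  will require.\<close>

lemma inv_sq_ge:
  assumes "0 \<le> p" "p \<le> 1" "0 \<le> q" "q \<le> 1 / 2"
  shows "(1 - u) / 2 \<le> inv_sq p q - 1"
proof -
  have "cosh (s * q) \<le> cosh (s / 2)" using assms s_pos by (intro cosh_mono_abs) (auto simp: abs_mult)
  then have "(cosh (s * q))\<^sup>2 \<le> (cosh (s / 2))\<^sup>2" by (intro power_mono) auto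
  also have "\<dots> = (cosh s + 1) / 2" using cosh_double_cosh[of "s / 2"] by simp
  finally have "c * (cosh (s * q))\<^sup>2 \<le> c * ((cosh s + 1) / 2)" using c_pos by (intro mult_left_mono) auto
  also have "\<dots> = (c + u) / 2" using c_pos by (simp add: cosh_s field_simps)
  finally have d: "c * (cosh (s * q))\<^sup>2 \<le> (c + u) / 2" .
  have "u\<^sup>2 \<le> (cos (a * p))\<^sup>2" using cos_a_ge[OF assms(1,2)] u_bounds by (intro power_mono) auto
  then have "u\<^sup>2 / ((c + u) / 2) \<le> inv_sq p q"
    unfolding inv_sq_def using d c_pos by (intro frac_le) auto
  moreover have "(1 - u) / 2 \<le> u\<^sup>2 / ((c + u) / 2) - 1"
  proof -
    have "u\<^sup>2 / ((c + u) / 2) - 1 = (1 - u) / (c + u)" using c_pos u_bounds c_u by (simp add: field_simps)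
    moreover have "(1 - u) / 2 \<le> (1 - u) / (c + u)" using c_pos u_bounds c_less by (intro divide_left_mono) auto
    ultimately show ?thesis by simp
  qed
  ultimately show ?thesis by linarith
qed

lemma cell_max_ge:
  assumes "0 \<le> p" "p \<le> 1" "0 \<le> q" "q \<le> 1"
  shows "(1 - u) / 2 \<le> cell_max p q - 1"
proof (cases "q \<le> 1 / 2")
  case True then show ?thesis using inv_sq_ge[of p q] assms by (simp add: cell_max_def)
next
  case False then show ?thesis using inv_sq_ge[of "1 - p" "1 - q"] assms by (simp add: cell_max_def)
qed

lemma cell_max_gt_1:
  assumes "0 \<le> p" "p \<le> 1" "0 \<le> q" "q \<le> 1" shows "1 < cell_max p q"
proof -
  have "0 < (1 - u) / 2" using u_bounds by simp
  then have "0 < cell_max p q - 1" using cell_max_ge[OF assms] by (rule less_le_trans)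
  then show ?thesis by simp
qed

lemma cos_even_le:
  fixes d :: int
  assumes "even d" "0 \<le> p" "p \<le> 1"
  shows "cos (a * (p - of_int d)) \<le> cos (a * p)"
proof -
  define r where "r = d mod (2 * int n)"
  have r: "0 \<le> r" "r < 2 * int n" "even r" using assms(1) n_ge by (auto simp: r_def dvd_mod_iff)
  have "cos (a * (p - of_int d)) = cos (a * p - of_int d * a)" by (simp add: algebra_simps)
  also have "\<dots> = cos (a * p - of_int r * a)"
    using cos_multiple_cong[of d] by (simp add: cos_diff r_def)
  also have "\<dots> = cos (a * (of_int r - p))" by (subst cos_minus[symmetric]) (simp add: algebra_simps)
  also have "\<dots> \<le> cos (a * p)"
  proof (cases "r = 0")
    case True then show ?thesis by simp
  next
    case False
    then have "2 \<le> r" "r \<le> 2 * int n - 2" using r by presburger+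
    then have r': "2 \<le> real_of_int r" "real_of_int r \<le> 2 * real n - 2" by linarith+
    show ?thesis
    proof (rule cos_le_cos_reflect)
      show "0 \<le> a * p" using assms a_bounds by simp
      show "a * p \<le> a * (of_int r - p)" using assms a_bounds r' by (intro mult_left_mono) auto
      have "a * (of_int r - p) \<le> a * (2 * real n - p)" using a_bounds r' by (intro mult_left_mono) auto
      also have "\<dots> = 2 * (real n * a) - a * p" by (simp add: algebra_simps)
      finally show "a * (of_int r - p) \<le> 2 * pi - a * p" using n_a by simp
    qed
  qed
  finally show ?thesis .
qed

text \<open>Seen from an angle between m a and (m + 1) a, the nearest direction with the parity of m
  is m itself, and the nearest of the other parity is m + 1.\<close>

lemma cos_parity_le:
  fixes m m' :: int
  assumes "0 \<le> p" "p \<le> 1"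
  shows "cos (a * (of_int m + p) - of_int m' * a) \<le> (if even (m' - m) then cos (a * p) else cos (a * (1 - p)))"
proof (cases "even (m' - m)")
  case True
  have "cos (a * (of_int m + p) - of_int m' * a) = cos (a * (p - of_int (m' - m)))" by (simp add: algebra_simps)
  then show ?thesis using cos_even_le[OF True assms] True by simp
next
  case False
  have "cos (a * (of_int m + p) - of_int m' * a) = cos (- (a * (of_int m + p) - of_int m' * a))" by (simp only: cos_minus)
  also have "\<dots> = cos (a * ((1 - p) - of_int (m + 1 - m')))" by (simp add: algebra_simps)
  also have "\<dots> \<le> cos (a * (1 - p))" using False assms by (intro cos_even_le) auto
  finally show ?thesis using False by simp
qed

lemma cosh_parity_ge:
  fixes i j :: nat
  assumes "0 \<le> q" "q \<le> 1"
  shows "(if even (int i - int j) then cosh (s * q) else cosh (s * (1 - q))) \<le> cosh (s * (real j + q) - s * real i)"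
proof -
  have e: "s * (real j + q) - s * real i = s * (real j + q - real i)" by (simp add: algebra_simps)
  have "\<bar>if even (int i - int j) then s * q else s * (1 - q)\<bar> \<le> \<bar>s * (real j + q - real i)\<bar>"
  proof (cases "even (int i - int j)")
    case True
    then have "i = j \<or> int i \<le> int j - 2 \<or> int j + 2 \<le> int i" by presburger
    then have "real i = real j \<or> real i \<le> real j - 2 \<or> real j + 2 \<le> real i" by linarith
    then have "\<bar>q\<bar> \<le> \<bar>real j + q - real i\<bar>" using assms by linarith
    then show ?thesis using True s_pos by (simp add: abs_mult mult_left_mono)
  next
    case False
    then have "int i \<le> int j - 1 \<or> int j + 1 \<le> int i" by presburger
    then have "real i \<le> real j - 1 \<or> real j + 1 \<le> real i" by linarith
    then have "\<bar>1 - q\<bar> \<le> \<bar>real j + q - real i\<bar>" using assms by linarith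
    then show ?thesis using False s_pos by (simp add: abs_mult mult_left_mono)
  qed
  then show ?thesis unfolding e by (auto dest: cosh_mono_abs split: if_splits)
qed

text \<open>For odd m - j the cell is the mirror image of an even one, which p' corrects. Level and
  direction of a side have the same parity, so a side whose level has the parity of j is no closer
  than the one of level j at offsets p' and q, and any other side no closer than the one of level j
  + 1 at offsets 1 - p' and 1 - q. Angle and height are estimated separately, and both optima belong
  to the same side.\<close>

lemma body_polar_iff:
  fixes m :: int
  assumes j: "j < k" and pq: "0 \<le> p" "p \<le> 1" "0 \<le> q" "q \<le> 1" and r: "0 < r"
  defines "\<tau> \<equiv> s * (real j + q)" and "\<phi> \<equiv> a * (of_int m + p)"
    and "p' \<equiv> if even (m - int j) then p else 1 - p"
  shows "vector [r * cos \<phi>, r * sin \<phi>, tanh \<tau>] \<in> body \<longleftrightarrow> r \<le> sqrt ((1 - (tanh \<tau>)\<^sup>2) / cell_max p' q)"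
proof -
  have p': "0 \<le> p'" "p' \<le> 1" using pq by (auto simp: p'_def)
  have \<tau>: "0 \<le> \<tau>" "\<tau> \<le> s * real k" using j pq s_pos unfolding \<tau>_def by (auto intro!: mult_left_mono)
  let ?R = "\<lambda>p q. r * cos (a * p) \<le> sqrt c * cosh (s * q) / cosh \<tau>"
  have lv: "lvl i (tanh \<tau>) = sqrt c * cosh (\<tau> - s * real i) / cosh \<tau>" for i by (rule lvl_tanh)
  have "vector [r * cos \<phi>, r * sin \<phi>, tanh \<tau>] \<in> body \<longleftrightarrow>
      (\<forall>i\<le>k. \<forall>m'. even (m' - int i) \<longrightarrow> r * cos (\<phi> - of_int m' * a) \<le> sqrt c * cosh (\<tau> - s * real i) / cosh \<tau>)"
    unfolding body_iff hor_polar using \<tau> by (simp add: lv)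
  also have "\<dots> \<longleftrightarrow> ?R p' q \<and> ?R (1 - p') (1 - q)"
  proof
    assume A: "\<forall>i\<le>k. \<forall>m'. even (m' - int i) \<longrightarrow> r * cos (\<phi> - of_int m' * a) \<le> sqrt c * cosh (\<tau> - s * real i) / cosh \<tau>"
    \<comment> \<open>Of the two directions that bound the sector, \<open>m0\<close> carries a side
      of level j and \<open>m1\<close> one of level j + 1.\<close>
    define m0 m1 where "m0 = (if even (m - int j) then m else m + 1)" and "m1 = (if even (m - int j) then m + 1 else m)"
    have par: "even (m0 - int j)" "even (m1 - int (j + 1))" by (auto simp: m0_def m1_def)
    have e1: "cos (\<phi> - of_int m0 * a) = cos (a * p')"
    proof (cases "even (m - int j)")
      case True then show ?thesis by (simp add: m0_def p'_def \<phi>_def algebra_simps)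
    next
      case False
      then have "\<phi> - of_int m0 * a = - (a * p')" by (simp add: m0_def p'_def \<phi>_def algebra_simps)
      then show ?thesis by simp
    qed
    have e2: "cos (\<phi> - of_int m1 * a) = cos (a * (1 - p'))"
    proof (cases "even (m - int j)")
      case True
      then have "\<phi> - of_int m1 * a = - (a * (1 - p'))" by (simp add: m1_def p'_def \<phi>_def algebra_simps)
      then show ?thesis by simp
    next
      case False then show ?thesis by (simp add: m1_def p'_def \<phi>_def algebra_simps)
    qed
    have e3: "cosh (\<tau> - s * real j) = cosh (s * q)" by (simp add: \<tau>_def algebra_simps)
    have e4: "cosh (\<tau> - s * real (j + 1)) = cosh (s * (1 - q))"
      by (subst cosh_minus[symmetric]) (simp add: \<tau>_def algebra_simps)
    have "j \<le> k" "j + 1 \<le> k" using j by auto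
    then show "?R p' q \<and> ?R (1 - p') (1 - q)"
      using A[rule_format, OF _ par(1)] A[rule_format, OF _ par(2)] unfolding e1 e2 e3 e4 by blast
  next
    assume R: "?R p' q \<and> ?R (1 - p') (1 - q)"
    show "\<forall>i\<le>k. \<forall>m'. even (m' - int i) \<longrightarrow> r * cos (\<phi> - of_int m' * a) \<le> sqrt c * cosh (\<tau> - s * real i) / cosh \<tau>"
    proof (intro allI impI)
      fix i m' assume i: "i \<le> k" "even (m' - int i)"
      have 1: "r * cos (\<phi> - of_int m' * a) \<le> r * (if even (m' - m) then cos (a * p) else cos (a * (1 - p)))"
        unfolding \<phi>_def using r by (intro mult_left_mono cos_parity_le pq) auto
      have 2: "sqrt c * (if even (int i - int j) then cosh (s * q) else cosh (s * (1 - q))) / cosh \<tau>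
          \<le> sqrt c * cosh (\<tau> - s * real i) / cosh \<tau>"
        unfolding \<tau>_def using c_pos pq by (intro divide_right_mono mult_left_mono cosh_parity_ge) auto
      have par: "even (m' - m) \<longleftrightarrow> (even (int i - int j) \<longleftrightarrow> even (m - int j))" using i by presburger
      show "r * cos (\<phi> - of_int m' * a) \<le> sqrt c * cosh (\<tau> - s * real i) / cosh \<tau>"
        using 1 2 R par by (cases "even (int i - int j)"; cases "even (m - int j)") (auto simp: p'_def)
    qed
  qed
  also have "\<dots> \<longleftrightarrow> r\<^sup>2 * inv_sq p' q \<le> 1 - (tanh \<tau>)\<^sup>2 \<and> r\<^sup>2 * inv_sq (1 - p') (1 - q) \<le> 1 - (tanh \<tau>)\<^sup>2"
  proof -
    have "?R p q \<longleftrightarrow> r\<^sup>2 * inv_sq p q \<le> 1 - (tanh \<tau>)\<^sup>2" if "0 \<le> p" "p \<le> 1" for p q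
    proof -
      have "0 \<le> r * cos (a * p)" using cos_a_ge[OF that] u_bounds r by simp
      then have "?R p q \<longleftrightarrow> (r * cos (a * p))\<^sup>2 \<le> (sqrt c * cosh (s * q) / cosh \<tau>)\<^sup>2"
        using c_pos by (simp add: power_mono_iff)
      also have "\<dots> \<longleftrightarrow> r\<^sup>2 * (cos (a * p))\<^sup>2 \<le> c * (cosh (s * q))\<^sup>2 * (1 - (tanh \<tau>)\<^sup>2)"
        unfolding one_minus_tanh_square using c_pos by (simp add: power_mult_distrib power_divide)
      also have "\<dots> \<longleftrightarrow> r\<^sup>2 * inv_sq p q \<le> 1 - (tanh \<tau>)\<^sup>2"
        unfolding inv_sq_def using c_pos by (simp add: field_simps)
      finally show ?thesis .
    qed
    then show ?thesis using p' by simp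
  qed
  also have "\<dots> \<longleftrightarrow> r\<^sup>2 * cell_max p' q \<le> 1 - (tanh \<tau>)\<^sup>2"
    unfolding cell_max_def by (simp add: max_mult_distrib_left)
  also have "\<dots> \<longleftrightarrow> r\<^sup>2 \<le> (1 - (tanh \<tau>)\<^sup>2) / cell_max p' q"
    using cell_max_gt_1[OF p' pq(3,4)] by (simp add: field_simps)
  also have "\<dots> \<longleftrightarrow> r \<le> sqrt ((1 - (tanh \<tau>)\<^sup>2) / cell_max p' q)"
    using r by (simp add: real_le_rsqrt real_sqrt_le_iff sqrt_ge_absD abs_of_pos real_le_lsqrt flip: real_sqrt_le_iff[of "r\<^sup>2"])
  finally show ?thesis .
qed

definition vol_density :: "real^3 \<Rightarrow> ennreal" where
  "vol_density v = ennreal (1 / (1 - (norm v)\<^sup>2)\<^sup>2) * indicator body v"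

lemma body_borel: "body \<in> sets borel"
  using body_right_angled
  by (simp add: compact_right_angled_polyhedron_def compact_hyp_polyhedron_def borel_compact)

lemma vol_density_measurable [measurable]: "vol_density \<in> borel_measurable borel"
  unfolding vol_density_def[abs_def] using body_borel by measurable

lemma hyp_vol_eq: "hyp_vol body = enn2real (\<integral>\<^sup>+v. vol_density v \<partial>lborel)"
proof -
  have e: "indicator body x *\<^sub>R klein_density x = indicator body x * (1 / (1 - (norm x)\<^sup>2)\<^sup>2)" for x
    using klein_density_eq body_subset by (auto simp: indicator_def)
  have "hyp_vol body = (LINT x|lborel. indicator body x * (1 / (1 - (norm x)\<^sup>2)\<^sup>2))"
    unfolding hyp_vol_def set_lebesgue_integral_def e ..
  also have "\<dots> = enn2real (\<integral>\<^sup>+x. ennreal (indicator body x * (1 / (1 - (norm x)\<^sup>2)\<^sup>2)) \<partial>lborel)"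
    using body_borel by (intro integral_eq_nn_integral) auto
  also have "(\<integral>\<^sup>+x. ennreal (indicator body x * (1 / (1 - (norm x)\<^sup>2)\<^sup>2)) \<partial>lborel) = (\<integral>\<^sup>+v. vol_density v \<partial>lborel)"
    by (intro nn_integral_cong) (auto simp: vol_density_def indicator_def)
  finally show ?thesis .
qed

text \<open>The first factor is the derivative of tanh, so that the integral over \<phi> and \<tau>
  without further weight is the volume.\<close>

definition ray_vol :: "real \<Rightarrow> real \<Rightarrow> ennreal" where
  "ray_vol \<phi> \<tau> = ennreal (1 - (tanh \<tau>)\<^sup>2) *
     (\<integral>\<^sup>+r. ennreal r * vol_density (vector [r * cos \<phi>, r * sin \<phi>, tanh \<tau>]) * indicator {0<..} r \<partial>lborel)"

lemma ray_vol_measurable [measurable (raw)]: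
  assumes [measurable]: "f \<in> borel_measurable M" "g \<in> borel_measurable M"
  shows "(\<lambda>x. ray_vol (f x) (g x)) \<in> borel_measurable M"
  unfolding ray_vol_def by measurable

text \<open>The factor 1 - (tanh \<tau>)^2 cancels, and only the position within the cell is left.
  This reflects the invariance of volume under translations and rotations: all cells are alike, up
  to reflection.\<close>

lemma ray_vol_eq:
  fixes m :: int
  assumes j: "j < k" and pq: "0 \<le> p" "p \<le> 1" "0 \<le> q" "q \<le> 1"
  shows "ray_vol (a * (of_int m + p)) (s * (real j + q)) =
    ennreal (1 / (2 * (cell_max (if even (m - int j) then p else 1 - p) q - 1)))"
proof -
  define \<tau> where "\<tau> = s * (real j + q)"
  define \<phi> where "\<phi> = a * (of_int m + p)"
  define p' where "p' = (if even (m - int j) then p else 1 - p)"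
  define \<kappa> where "\<kappa> = 1 - (tanh \<tau>)\<^sup>2"
  have p': "0 \<le> p'" "p' \<le> 1" using pq by (auto simp: p'_def)
  have M: "1 < cell_max p' q" using cell_max_gt_1 p' pq by simp
  have \<kappa>: "0 < \<kappa>" using tanh_less_1_square[of \<tau>] by (simp add: \<kappa>_def)
  have "(\<integral>\<^sup>+r. ennreal r * vol_density (vector [r * cos \<phi>, r * sin \<phi>, tanh \<tau>]) * indicator {0<..} r \<partial>lborel) =
      (\<integral>\<^sup>+r. ennreal (r / (\<kappa> - r\<^sup>2)\<^sup>2) * indicator {0..sqrt (\<kappa> / cell_max p' q)} r \<partial>lborel)"
  proof (rule nn_integral_cong)
    fix r :: real
    show "ennreal r * vol_density (vector [r * cos \<phi>, r * sin \<phi>, tanh \<tau>]) * indicator {0<..} r =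
      ennreal (r / (\<kappa> - r\<^sup>2)\<^sup>2) * indicator {0..sqrt (\<kappa> / cell_max p' q)} r"
    proof (cases "0 < r")
      case True
      have "(r * cos \<phi>)\<^sup>2 + (r * sin \<phi>)\<^sup>2 = r\<^sup>2 * ((sin \<phi>)\<^sup>2 + (cos \<phi>)\<^sup>2)" by algebra
      then have nn: "1 - (norm (vector [r * cos \<phi>, r * sin \<phi>, tanh \<tau>] :: real^3))\<^sup>2 = \<kappa> - r\<^sup>2"
        unfolding norm_vector3 \<kappa>_def by simp
      have "vector [r * cos \<phi>, r * sin \<phi>, tanh \<tau>] \<in> body \<longleftrightarrow> r \<le> sqrt (\<kappa> / cell_max p' q)"
        using body_polar_iff[OF j pq True, of m] unfolding \<tau>_def \<phi>_def p'_def \<kappa>_def .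
      then have "indicator body (vector [r * cos \<phi>, r * sin \<phi>, tanh \<tau>] :: real^3) =
          (indicator {0..sqrt (\<kappa> / cell_max p' q)} r :: ennreal)"
        using True by (simp add: indicator_def)
      then show ?thesis using True unfolding vol_density_def nn
        by (simp add: ennreal_mult'[symmetric] mult.assoc[symmetric])
    qed (auto simp: indicator_def)
  qed
  also have "\<dots> = ennreal (1 / (2 * \<kappa> * (cell_max p' q - 1)))"
    by (rule nn_integral_radial_density[OF \<kappa> M])
  finally have "ray_vol \<phi> \<tau> = ennreal \<kappa> * ennreal (1 / (2 * \<kappa> * (cell_max p' q - 1)))"
    unfolding ray_vol_def \<kappa>_def by simp
  also have "\<dots> = ennreal (\<kappa> * (1 / (2 * \<kappa> * (cell_max p' q - 1))))" using \<kappa> by (intro ennreal_mult'[symmetric]) simp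
  also have "\<kappa> * (1 / (2 * \<kappa> * (cell_max p' q - 1))) = 1 / (2 * (cell_max p' q - 1))" using \<kappa> by simp
  finally show ?thesis unfolding \<tau>_def \<phi>_def p'_def .
qed

lemma nn_integral_vol_density:
  "(\<integral>\<^sup>+v. vol_density v \<partial>lborel) =
    (\<integral>\<^sup>+\<tau>. (\<integral>\<^sup>+\<phi>. ray_vol \<phi> \<tau> * indicator {0..a * real (2 * n)} \<phi> \<partial>lborel) * indicator {0..s * real k} \<tau> \<partial>lborel)"
proof -
  define G where "G z = (\<integral>\<^sup>+p. vol_density (vector [fst p, snd p, z]) \<partial>(lborel \<Otimes>\<^sub>M lborel))" for z
  have [measurable]: "G \<in> borel_measurable borel" unfolding G_def by measurable
  have "(\<integral>\<^sup>+v. vol_density v \<partial>lborel) = (\<integral>\<^sup>+z. G z \<partial>lborel)"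
    unfolding G_def lborel_prod by (rule nn_integral_real3) measurable
  also have "\<dots> = (\<integral>\<^sup>+z. G z * indicator {tanh 0..tanh (s * real k)} z \<partial>lborel)"
  proof (rule nn_integral_cong)
    fix z :: real
    show "G z = G z * indicator {tanh 0..tanh (s * real k)} z"
    proof (cases "z \<in> {tanh 0..tanh (s * real k)}")
      case False
      then have "vol_density (vector [x, y, z]) = 0" for x y
        by (auto simp: vol_density_def indicator_def body_iff)
      then show ?thesis by (simp add: G_def)
    qed simp
  qed
  also have "\<dots> = (\<integral>\<^sup>+\<tau>. G (tanh \<tau>) * ennreal (1 - (tanh \<tau>)\<^sup>2) * indicator {0..s * real k} \<tau> \<partial>lborel)"
  proof (rule nn_integral_substitution_aux)
    show "(tanh has_real_derivative 1 - (tanh \<tau>)\<^sup>2) (at \<tau>)" for \<tau> :: real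
      by (auto intro!: derivative_eq_intros)
    show "continuous_on {0..s * real k} (\<lambda>\<tau>. 1 - (tanh \<tau>)\<^sup>2)" by (intro continuous_intros) auto
    show "0 < s * real k" using s_pos k_ge by simp
  qed (use tanh_less_1_square in \<open>auto intro: less_imp_le\<close>)
  also have "\<dots> = (\<integral>\<^sup>+\<tau>. (\<integral>\<^sup>+\<phi>. ray_vol \<phi> \<tau> * indicator {0..a * real (2 * n)} \<phi> \<partial>lborel) * indicator {0..s * real k} \<tau> \<partial>lborel)"
  proof (rule nn_integral_cong)
    fix \<tau> :: real
    have "(\<lambda>p. vol_density (vector [fst p, snd p, tanh \<tau>])) \<in> borel_measurable (borel \<Otimes>\<^sub>M borel)" by measurable
    then have meas: "(\<lambda>p. vol_density (vector [fst p, snd p, tanh \<tau>])) \<in> borel_measurable borel"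
      unfolding borel_prod .
    have "G (tanh \<tau>) * ennreal (1 - (tanh \<tau>)\<^sup>2) = ennreal (1 - (tanh \<tau>)\<^sup>2) *
       (\<integral>\<^sup>+\<phi>. (\<integral>\<^sup>+r. ennreal r * vol_density (vector [r * cos \<phi>, r * sin \<phi>, tanh \<tau>]) * indicator {0<..} r \<partial>lborel) *
       indicator {0<..<2*pi} \<phi> \<partial>lborel)"
      unfolding G_def lborel_prod nn_integral_polar[OF meas] by (simp add: mult.commute)
    also have "\<dots> = (\<integral>\<^sup>+\<phi>. ray_vol \<phi> \<tau> * indicator {0<..<2*pi} \<phi> \<partial>lborel)"
      unfolding ray_vol_def by (subst nn_integral_cmult[symmetric]) (auto simp: mult.assoc)
    also have "\<dots> = (\<integral>\<^sup>+\<phi>. ray_vol \<phi> \<tau> * indicator {0..a * real (2 * n)} \<phi> \<partial>lborel)"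
    proof (rule nn_integral_cong_AE)
      have "a * real (2 * n) = 2 * (real n * a)" by simp
      then have e: "a * real (2 * n) = 2 * pi" using n_a by simp
      have "AE x in lborel. x \<noteq> (0::real)" "AE x in lborel. x \<noteq> 2 * pi" by (rule AE_lborel_singleton)+
      then show "AE \<phi> in lborel. ray_vol \<phi> \<tau> * indicator {0<..<2*pi} \<phi> = ray_vol \<phi> \<tau> * indicator {0..a * real (2 * n)} \<phi>"
        unfolding e by eventually_elim (auto simp: indicator_def)
    qed
    finally show "G (tanh \<tau>) * ennreal (1 - (tanh \<tau>)\<^sup>2) * indicator {0..s * real k} \<tau> =
      (\<integral>\<^sup>+\<phi>. ray_vol \<phi> \<tau> * indicator {0..a * real (2 * n)} \<phi> \<partial>lborel) * indicator {0..s * real k} \<tau>" by simp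
  qed
  finally show ?thesis .
qed

text \<open>Twice the volume of a cell per unit of p and q, so that the 2nk cells together give the
  factor n k.\<close>

definition tower_cell :: "real \<Rightarrow> real \<Rightarrow> real" where
  "tower_cell p q = a * s / (cell_max p q - 1)"

lemma tower_cell_measurable [measurable (raw)]:
  assumes [measurable]: "f \<in> borel_measurable M" "g \<in> borel_measurable M"
  shows "(\<lambda>x. tower_cell (f x) (g x)) \<in> borel_measurable M"
  unfolding tower_cell_def cell_max_def inv_sq_def by measurable

theorem hyp_vol_body:
  "hyp_vol body = enn2real (ennreal (real n * real k) *
    (\<integral>\<^sup>+q. (\<integral>\<^sup>+p. ennreal (tower_cell p q) * indicator {0..1} p \<partial>lborel) * indicator {0..1} q \<partial>lborel))"
proof -
  let ?S = "\<lambda>j q. \<Sum>m<2*n. ennreal a * (\<integral>\<^sup>+p. ray_vol (a * real m + a * p) (s * real j + s * q) *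
      indicator {0..1} p \<partial>lborel)"
  let ?T = "\<lambda>q. (\<integral>\<^sup>+p. ennreal (tower_cell p q) * indicator {0..1} p \<partial>lborel)"
  have cell: "ennreal s * (ennreal a * (\<integral>\<^sup>+p. ray_vol (a * real m + a * p) (s * real j + s * q) * indicator {0..1} p \<partial>lborel)) =
      ennreal (1 / 2) * ?T q" if j: "j < k" and q: "q \<in> {0..1}" for j m q
  proof -
    define par where "par \<longleftrightarrow> even (int m - int j)"
    have "ray_vol (a * real m + a * p) (s * real j + s * q) * indicator {0..1} p =
        ennreal (1 / (2 * (cell_max (if par then p else 1 - p) q - 1))) * indicator {0..1} p" for p
    proof (cases "p \<in> {0..1}")
      case True
      then show ?thesis using ray_vol_eq[OF j, of p q "int m"] q by (simp add: par_def distrib_left)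
    qed simp
    then have "(\<integral>\<^sup>+p. ray_vol (a * real m + a * p) (s * real j + s * q) * indicator {0..1} p \<partial>lborel) =
      (\<integral>\<^sup>+p. ennreal (1 / (2 * (cell_max (if par then p else 1 - p) q - 1))) * indicator {0..1} p \<partial>lborel)"
      by simp
    also have "\<dots> = (\<integral>\<^sup>+p. ennreal (1 / (2 * (cell_max p q - 1))) * indicator {0..1} p \<partial>lborel)"
    proof (cases par)
      case True then show ?thesis by simp
    next
      case False
      have "(\<lambda>p. cell_max p q) \<in> borel_measurable borel" unfolding cell_max_def inv_sq_def by measurable
      then have "(\<integral>\<^sup>+p. ennreal (1 / (2 * (cell_max p q - 1))) * indicator {0..1} p \<partial>lborel) =
        ennreal \<bar>-1\<bar> * (\<integral>\<^sup>+p. ennreal (1 / (2 * (cell_max (1 + (-1) * p) q - 1))) * indicator {0..1} (1 + (-1) * p) \<partial>lborel)"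
        by (intro nn_integral_real_affine) auto
      also have "\<dots> = (\<integral>\<^sup>+p. ennreal (1 / (2 * (cell_max (1 - p) q - 1))) * indicator {0..1} p \<partial>lborel)"
        by (auto intro!: nn_integral_cong simp: indicator_def)
      finally show ?thesis using False by simp
    qed
    finally have "ennreal s * (ennreal a * (\<integral>\<^sup>+p. ray_vol (a * real m + a * p) (s * real j + s * q) * indicator {0..1} p \<partial>lborel)) =
      ennreal (s * a) * (\<integral>\<^sup>+p. ennreal (1 / (2 * (cell_max p q - 1))) * indicator {0..1} p \<partial>lborel)"
      using s_pos by (simp add: ennreal_mult' mult.assoc)
    also have "\<dots> = (\<integral>\<^sup>+p. ennreal (s * a) * (ennreal (1 / (2 * (cell_max p q - 1))) * indicator {0..1} p) \<partial>lborel)"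
    proof -
      have "(\<lambda>p. cell_max p q) \<in> borel_measurable borel" unfolding cell_max_def inv_sq_def by measurable
      then show ?thesis by (intro nn_integral_cmult[symmetric]) auto
    qed
    also have "\<dots> = (\<integral>\<^sup>+p. ennreal (1 / 2) * (ennreal (tower_cell p q) * indicator {0..1} p) \<partial>lborel)"
    proof -
      have "ennreal (s * a) * ennreal (1 / (2 * (cell_max p q - 1))) = ennreal (1 / 2) * ennreal (tower_cell p q)" for p
        unfolding tower_cell_def using s_pos a_bounds
        by (subst (1 2) ennreal_mult'[symmetric]) (auto simp: mult.commute)
      then show ?thesis by (simp add: mult.assoc[symmetric])
    qed
    also have "\<dots> = ennreal (1 / 2) * ?T q" by (rule nn_integral_cmult) measurable
    finally show ?thesis .
  qed
  have "(\<integral>\<^sup>+v. vol_density v \<partial>lborel) =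
      (\<Sum>j<k. ennreal s * (\<integral>\<^sup>+q. (\<integral>\<^sup>+\<phi>. ray_vol \<phi> (s * real j + s * q) * indicator {0..a * real (2 * n)} \<phi> \<partial>lborel) *
        indicator {0..1} q \<partial>lborel))"
    unfolding nn_integral_vol_density using s_pos by (intro nn_integral_split_intervals) measurable
  also have "\<dots> = (\<Sum>j<k. ennreal s * (\<integral>\<^sup>+q. ?S j q * indicator {0..1} q \<partial>lborel))"
    using a_bounds by (intro sum.cong refl arg_cong2[where f = "(*)"] nn_integral_cong nn_integral_split_intervals) measurable
  also have "\<dots> = (\<Sum>j<k. (\<integral>\<^sup>+q. ennreal (real n) * (?T q * indicator {0..1} q) \<partial>lborel))"
  proof (rule sum.cong[OF refl])
    fix j assume "j \<in> {..<k}"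
    then have j: "j < k" by simp
    have "ennreal s * (\<integral>\<^sup>+q. ?S j q * indicator {0..1} q \<partial>lborel) =
        (\<integral>\<^sup>+q. ennreal s * (?S j q * indicator {0..1} q) \<partial>lborel)"
      by (rule nn_integral_cmult[symmetric]) measurable
    also have "\<dots> = (\<integral>\<^sup>+q. ennreal (real n) * (?T q * indicator {0..1} q) \<partial>lborel)"
    proof (rule nn_integral_cong)
      fix q :: real
      show "ennreal s * (?S j q * indicator {0..1} q) = ennreal (real n) * (?T q * indicator {0..1} q)"
      proof (cases "q \<in> {0..1}")
        case True
        have "ennreal s * ?S j q = (\<Sum>m<2*n. ennreal (1 / 2) * ?T q)"
          unfolding sum_distrib_left using cell[OF j True] by (intro sum.cong) auto
        also have "\<dots> = (of_nat (2 * n) * ennreal (1 / 2)) * ?T q" by (simp add: mult.assoc)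
        also have "of_nat (2 * n) * ennreal (1 / 2) = ennreal (real (2 * n) * (1 / 2))"
          by (subst ennreal_mult') (auto simp: ennreal_of_nat_eq_real_of_nat)
        also have "real (2 * n) * (1 / 2) = real n" by simp
        finally show ?thesis using True by simp
      qed simp
    qed
    finally show "ennreal s * (\<integral>\<^sup>+q. ?S j q * indicator {0..1} q \<partial>lborel) =
        (\<integral>\<^sup>+q. ennreal (real n) * (?T q * indicator {0..1} q) \<partial>lborel)" .
  qed
  also have "\<dots> = of_nat k * (ennreal (real n) * (\<integral>\<^sup>+q. ?T q * indicator {0..1} q \<partial>lborel))"
    by (subst nn_integral_cmult) auto
  also have "\<dots> = ennreal (real n * real k) * (\<integral>\<^sup>+q. ?T q * indicator {0..1} q \<partial>lborel)"
    by (simp add: ennreal_mult ennreal_of_nat_eq_real_of_nat mult_ac)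
  finally show ?thesis unfolding hyp_vol_eq by simp
qed

end

section \<open>Asymptotics\<close>

text \<open>Dominated convergence with the constant K on the unit interval, in p for each fixed q
  and then in q.\<close>

lemma nn_integral_unit_square_dominated:
  fixes f :: "nat \<Rightarrow> real \<Rightarrow> real \<Rightarrow> real" and g :: "real \<Rightarrow> real \<Rightarrow> real"
  assumes f[measurable]: "\<And>n. (\<lambda>x. f n (fst x) (snd x)) \<in> borel_measurable (borel \<Otimes>\<^sub>M borel)"
    and g[measurable]: "(\<lambda>x. g (fst x) (snd x)) \<in> borel_measurable (borel \<Otimes>\<^sub>M borel)"
    and K: "\<And>n p q. p \<in> {0..1} \<Longrightarrow> q \<in> {0..1} \<Longrightarrow> f n p q \<le> K"
    and lim: "\<And>p q. p \<in> {0..1} \<Longrightarrow> q \<in> {0..1} \<Longrightarrow> (\<lambda>n. f n p q) \<longlonglongrightarrow> g p q"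
  shows "(\<lambda>n. \<integral>\<^sup>+q. (\<integral>\<^sup>+p. ennreal (f n p q) * indicator {0..1} p \<partial>lborel) * indicator {0..1} q \<partial>lborel)
    \<longlonglongrightarrow> (\<integral>\<^sup>+q. (\<integral>\<^sup>+p. ennreal (g p q) * indicator {0..1} p \<partial>lborel) * indicator {0..1} q \<partial>lborel)"
proof -
  let ?F = "\<lambda>n q. \<integral>\<^sup>+p. ennreal (f n p q) * indicator {0..1} p \<partial>lborel"
  let ?G = "\<lambda>q. \<integral>\<^sup>+p. ennreal (g p q) * indicator {0..1} p \<partial>lborel"
  have f1: "(\<lambda>p. f n p q) \<in> borel_measurable borel" for n q
    using measurable_compose[OF _ f, of "\<lambda>p. (p, q)" borel n] by simp
  have g1: "(\<lambda>p. g p q) \<in> borel_measurable borel" for q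
    using measurable_compose[OF _ g, of "\<lambda>p. (p, q)" borel] by simp
  have f2: "(\<lambda>x. f n (snd x) (fst x)) \<in> borel_measurable (borel \<Otimes>\<^sub>M borel)" for n
    using measurable_compose[OF _ f, of "\<lambda>x. (snd x, fst x)" "borel \<Otimes>\<^sub>M borel" n] by simp
  have g2: "(\<lambda>x. g (snd x) (fst x)) \<in> borel_measurable (borel \<Otimes>\<^sub>M borel)"
    using measurable_compose[OF _ g, of "\<lambda>x. (snd x, fst x)" "borel \<Otimes>\<^sub>M borel"] by simp
  have unit: "(\<integral>\<^sup>+p. ennreal K * indicator {0..1::real} p \<partial>lborel) = ennreal K"
    by (simp add: nn_integral_cmult)
  show ?thesis
  proof (rule nn_integral_dominated_convergence[where w = "\<lambda>q. ennreal K * indicator {0..1} q"])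
    show "(\<lambda>q. ?F n q * indicator {0..1} q) \<in> borel_measurable lborel" for n
      using f2[of n] by (simp add: case_prod_beta) measurable
    show "(\<lambda>q. ?G q * indicator {0..1} q) \<in> borel_measurable lborel"
      using g2 by (simp add: case_prod_beta) measurable
    show "(\<lambda>q. ennreal K * indicator {0..1::real} q) \<in> borel_measurable lborel" by simp
    have bound: "?F n q \<le> ennreal K" if "q \<in> {0..1}" for n q
    proof -
      have "?F n q \<le> (\<integral>\<^sup>+p. ennreal K * indicator {0..1::real} p \<partial>lborel)"
        using K that by (intro nn_integral_mono) (auto simp: indicator_def intro: ennreal_leI)
      then show ?thesis by (simp only: unit)
    qed
    show "AE q in lborel. ?F n q * indicator {0..1} q
        \<le> ennreal K * indicator {0..1} q" for n
      using bound by (intro AE_I2) (auto simp: indicator_def)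
    show "(\<integral>\<^sup>+q. ennreal K * indicator {0..1::real} q \<partial>lborel) < \<infinity>"
      unfolding unit by simp
    have "(\<lambda>n. \<integral>\<^sup>+p. ennreal (f n p q) * indicator {0..1} p \<partial>lborel) \<longlonglongrightarrow>
        ?G q" if q: "q \<in> {0..1}" for q
    proof (rule nn_integral_dominated_convergence[where w = "\<lambda>p. ennreal K * indicator {0..1} p"])
      show "(\<lambda>p. ennreal (f n p q) * indicator {0..1} p) \<in> borel_measurable lborel" for n
        using f1[of n q] by simp
      show "(\<lambda>p. ennreal (g p q) * indicator {0..1} p) \<in> borel_measurable lborel"
        using g1[of q] by simp
      show "(\<lambda>q. ennreal K * indicator {0..1::real} q) \<in> borel_measurable lborel" by simp
      show "AE p in lborel. ennreal (f n p q) * indicator {0..1} p \<le> ennreal K * indicator {0..1} p" for n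
        using K q by (intro AE_I2) (auto simp: indicator_def intro: ennreal_leI)
      show "(\<integral>\<^sup>+q. ennreal K * indicator {0..1::real} q \<partial>lborel) < \<infinity>"
        unfolding unit by simp
      show "AE p in lborel. (\<lambda>n. ennreal (f n p q) * indicator {0..1} p) \<longlonglongrightarrow> ennreal (g p q) * indicator {0..1} p"
        using lim q by (intro AE_I2) (auto simp: indicator_def intro: tendsto_ennrealI)
    qed
    then show "AE q in lborel. (\<lambda>n. ?F n q * indicator {0..1} q)
        \<longlonglongrightarrow> ?G q * indicator {0..1} q"
      by (intro AE_I2) (auto simp: indicator_def)
  qed
qed

lemma tendsto_quotient_at_0:
  fixes f :: "real \<Rightarrow> real"
  assumes "DERIV f 0 :> D" "f 0 = 0" "X \<longlonglongrightarrow> 0" "\<And>n::nat. X n \<noteq> 0"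
  shows "(\<lambda>n. f (X n) / X n) \<longlonglongrightarrow> D"
proof -
  have "((\<lambda>h. f h / h) \<longlongrightarrow> D) (at 0)" using assms(1,2) by (simp add: DERIV_def)
  moreover have "filterlim X (at 0) sequentially"
    using assms(3,4) by (intro filterlim_atI) auto
  ultimately show ?thesis by (rule filterlim_compose)
qed

context tower
begin

text \<open>Since u^2 = (1 + c)/2, the number (u/c)^2 - 1 factors as (1 - c)(1 + 2c) / (2c^2), and 1
  - c = 2 (sin a)^2. As c tends to 1, the square root becomes the sqrt 3 of the triangular
  lattice.\<close>

lemma sinh_s: "sinh s = sin a * sqrt (1 + 2 * c) / c"
proof -
  have "(sin a * sqrt (1 + 2 * c) / c)\<^sup>2 = (sin a)\<^sup>2 * (1 + 2 * c) / c\<^sup>2"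
    using c_pos by (simp add: power_mult_distrib power_divide)
  also have "(sin a)\<^sup>2 = 1 - u\<^sup>2" by (simp add: sin_squared_eq u_def)
  also have "(1 - u\<^sup>2) * (1 + 2 * c) / c\<^sup>2 = (u / c)\<^sup>2 - 1"
  proof -
    have u2: "u\<^sup>2 = (1 + c) / 2" using c_u by simp
    show ?thesis unfolding power_divide u2 using c_pos by (simp add: field_simps power2_eq_square)
  qed
  also have "\<dots> = (sinh s)\<^sup>2" unfolding cosh_s[symmetric] by (simp add: sinh_square_eq)
  finally have "(sinh s)\<^sup>2 = (sin a * sqrt (1 + 2 * c) / c)\<^sup>2" by (rule sym)
  then show ?thesis by (rule power2_eq_imp_eq) (use c_pos sin_a_pos s_pos in auto)
qed

text \<open>A difference of numbers close to 1 is rewritten with a numerator whose terms all have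
  order a^2; divided by a^2, they tend to 2, p^2 and 3 q^2.\<close>

lemma inv_sq_minus_1:
  "inv_sq p q - 1 = (2 * (sin a)\<^sup>2 - (sin (a * p))\<^sup>2 - c * (sinh (s * q))\<^sup>2) / (c * (cosh (s * q))\<^sup>2)"
proof -
  have "1 - c = 2 * (sin a)\<^sup>2" by (simp add: c_def cos_double_sin)
  then have "(cos (a * p))\<^sup>2 - c * (cosh (s * q))\<^sup>2 = 2 * (sin a)\<^sup>2 - (sin (a * p))\<^sup>2 - c * (sinh (s * q))\<^sup>2"
    by (simp add: cosh_square_eq cos_squared_eq algebra_simps)
  then show ?thesis using c_pos by (simp add: inv_sq_def field_simps)
qed

lemma tower_cell_scaled:
  "tower_cell p q = (s / a) / max ((inv_sq p q - 1) / a\<^sup>2) ((inv_sq (1 - p) (1 - q) - 1) / a\<^sup>2)"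
proof -
  have M: "max ((inv_sq p q - 1) / a\<^sup>2) ((inv_sq (1 - p) (1 - q) - 1) / a\<^sup>2) = (cell_max p q - 1) / a\<^sup>2"
    unfolding cell_max_def using a_bounds by (simp add: max_def divide_right_mono divide_le_cancel)
  show ?thesis unfolding M tower_cell_def using a_bounds by (simp add: power2_eq_square)
qed

lemma tower_cell_le:
  assumes "p \<in> {0..1}" "q \<in> {0..1}"
  shows "tower_cell p q \<le> (s / a) * (2 / ((1 - u) / a\<^sup>2))"
proof -
  have "tower_cell p q \<le> a * s / ((1 - u) / 2)"
    unfolding tower_cell_def using assms cell_max_ge[of p q] a_bounds s_pos u_bounds
    by (intro divide_left_mono) (auto intro!: mult_pos_pos)
  also have "\<dots> = (s / a) * (2 / ((1 - u) / a\<^sup>2))"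
    using a_bounds by (simp add: power2_eq_square)
  finally show ?thesis .
qed

end

lemma tower_limits:
  fixes k :: nat
  assumes k: "1 \<le> k"
  defines "a \<equiv> \<lambda>n. tower.a (n + 5)" and "u \<equiv> \<lambda>n. tower.u (n + 5)"
    and "c \<equiv> \<lambda>n. tower.c (n + 5)" and "s \<equiv> \<lambda>n. tower.s (n + 5)"
  shows "(\<lambda>n. s n / a n) \<longlonglongrightarrow> sqrt 3"
    and "(\<lambda>n. (1 - u n) / (a n)\<^sup>2) \<longlonglongrightarrow> 1 / 2"
    and "(\<lambda>n. (tower.inv_sq (n + 5) p q - 1) / (a n)\<^sup>2) \<longlonglongrightarrow> 2 - p\<^sup>2 - 3 * q\<^sup>2"
proof -
  have T: "tower (n + 5) k" for n using k by unfold_locales auto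
  have a_def': "a n = pi / real (n + 5)" for n unfolding a_def by (rule tower.a_def[OF T])
  have u_eq: "u n = cos (a n)" for n unfolding a_def u_def by (rule tower.u_def[OF T])
  have c_eq: "c n = cos (2 * a n)" for n unfolding a_def c_def by (rule tower.c_def[OF T])
  have a_pos: "0 < a n" for n by (simp add: a_def')
  have s_pos: "0 < s n" for n unfolding s_def by (rule tower.s_pos[OF T])
  have c_pos: "0 < c n" for n unfolding c_def by (rule tower.c_pos[OF T])
  have "(\<lambda>n. pi / real (n + 5)) \<longlonglongrightarrow> 0"
    by (intro real_tendsto_divide_at_top[OF tendsto_const]
        filterlim_compose[OF filterlim_real_sequentially filterlim_add_const_nat_at_top])
  then have a0: "a \<longlonglongrightarrow> 0" by (simp add: a_def'[abs_def] fun_eq_iff)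
  have sin_lim: "(\<lambda>n. sin (a n * p) / a n) \<longlonglongrightarrow> p" for p
    by (rule tendsto_quotient_at_0[where f = "\<lambda>x. sin (x * p)"])
       (use a0 a_pos in \<open>auto intro!: derivative_eq_intros simp: less_imp_neq[symmetric]\<close>)
  have c1: "c \<longlonglongrightarrow> 1"
    using tendsto_cos[OF tendsto_mult_right[OF a0, of 2]] by (simp add: c_eq[abs_def] mult.commute)
  have "(\<lambda>n. sin (a n * 1) / a n * sqrt (1 + 2 * c n) / c n) \<longlonglongrightarrow> 1 * sqrt (1 + 2 * 1) / 1"
    by (intro tendsto_intros sin_lim c1) auto
  moreover have "sinh (s n) / a n = sin (a n * 1) / a n * sqrt (1 + 2 * c n) / c n" for n
    unfolding s_def a_def c_def tower.sinh_s[OF T] by simp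
  ultimately have sinh_lim: "(\<lambda>n. sinh (s n) / a n) \<longlonglongrightarrow> sqrt 3" by simp
  have "(\<lambda>n. sinh (s n) / a n * a n) \<longlonglongrightarrow> sqrt 3 * 0" by (intro tendsto_mult sinh_lim a0)
  then have sinh0: "(\<lambda>n. sinh (s n)) \<longlonglongrightarrow> 0" using a_pos by (simp add: less_imp_neq[symmetric])
  \<comment> \<open>The explicit formula concerns the hyperbolic sine of s; the derivative of arsinh
    at 0 transfers its asymptotics to s.\<close>
  have "(\<lambda>n. arsinh (sinh (s n)) / sinh (s n)) \<longlonglongrightarrow> 1"
    by (rule tendsto_quotient_at_0) (use sinh0 s_pos in \<open>auto intro!: derivative_eq_intros simp: less_imp_neq[symmetric]\<close>)
  then have "(\<lambda>n. s n / sinh (s n) * (sinh (s n) / a n)) \<longlonglongrightarrow> 1 * sqrt 3"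
    unfolding arsinh_sinh_real by (intro tendsto_mult sinh_lim)
  moreover have "s n / sinh (s n) * (sinh (s n) / a n) = s n / a n" for n using s_pos[of n] by simp
  ultimately show sa: "(\<lambda>n. s n / a n) \<longlonglongrightarrow> sqrt 3" by simp
  have "(\<lambda>n. s n / a n * a n) \<longlonglongrightarrow> sqrt 3 * 0" by (intro tendsto_mult sa a0)
  then have s0: "s \<longlonglongrightarrow> 0" using a_pos by (simp add: less_imp_neq[symmetric])
  have "(\<lambda>n. 2 * (sin (a n * (1/2)) / a n)\<^sup>2) \<longlonglongrightarrow> 2 * (1/2)\<^sup>2"
    by (intro tendsto_intros sin_lim)
  moreover have "2 * (sin (a n * (1/2)) / a n)\<^sup>2 = (1 - u n) / (a n)\<^sup>2" for n
    using cos_double_sin[of "a n / 2"] by (simp add: u_eq power_divide)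
  ultimately have "(\<lambda>n. (1 - u n) / (a n)\<^sup>2) \<longlonglongrightarrow> 2 * (1/2)\<^sup>2" by (simp only:)
  then show "(\<lambda>n. (1 - u n) / (a n)\<^sup>2) \<longlonglongrightarrow> 1 / 2" by (simp add: power_divide)
  have "(\<lambda>n. sinh (s n * q) / s n) \<longlonglongrightarrow> q"
    by (rule tendsto_quotient_at_0[where f = "\<lambda>x. sinh (x * q)"])
       (use s0 s_pos in \<open>auto intro!: derivative_eq_intros simp: less_imp_neq[symmetric]\<close>)
  then have "(\<lambda>n. sinh (s n * q) / s n * (s n / a n)) \<longlonglongrightarrow> q * sqrt 3"
    by (intro tendsto_mult sa)
  moreover have "sinh (s n * q) / s n * (s n / a n) = sinh (s n * q) / a n" for n using s_pos[of n] by simp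
  ultimately have sinhq: "(\<lambda>n. sinh (s n * q) / a n) \<longlonglongrightarrow> q * sqrt 3" by (simp only:)
  have "(\<lambda>n. cosh (s n * q)) \<longlonglongrightarrow> cosh (0 * q)" by (intro tendsto_intros s0)
  then have cosh1: "(\<lambda>n. cosh (s n * q)) \<longlonglongrightarrow> 1" by simp
  have "(\<lambda>n. (2 * (sin (a n * 1) / a n)\<^sup>2 - (sin (a n * p) / a n)\<^sup>2 - c n * (sinh (s n * q) / a n)\<^sup>2) /
      (c n * (cosh (s n * q))\<^sup>2)) \<longlonglongrightarrow> (2 * 1\<^sup>2 - p\<^sup>2 - 1 * (q * sqrt 3)\<^sup>2) / (1 * 1\<^sup>2)"
    by (intro tendsto_intros sin_lim c1 cosh1 sinhq) auto
  moreover have "(2 * (sin (a n * 1) / a n)\<^sup>2 - (sin (a n * p) / a n)\<^sup>2 - c n * (sinh (s n * q) / a n)\<^sup>2) /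
      (c n * (cosh (s n * q))\<^sup>2) = (tower.inv_sq (n + 5) p q - 1) / (a n)\<^sup>2" for n
  proof -
    have "tower.inv_sq (n + 5) p q - 1 = (2 * (sin (a n))\<^sup>2 - (sin (a n * p))\<^sup>2 - c n * (sinh (s n * q))\<^sup>2) / (c n * (cosh (s n * q))\<^sup>2)"
      unfolding s_def a_def c_def by (rule tower.inv_sq_minus_1[OF T])
    then show ?thesis by (simp add: power_divide diff_divide_distrib mult.commute)
  qed
  ultimately show "(\<lambda>n. (tower.inv_sq (n + 5) p q - 1) / (a n)\<^sup>2) \<longlonglongrightarrow> 2 - p\<^sup>2 - 3 * q\<^sup>2"
    by (simp add: power_mult_distrib mult.commute)
qed

text \<open>One of q and 1 - q is at most 1/2, and the corresponding term is at least 2 - 1 -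
  3/4.\<close>

lemma cell_denominator_pos:
  fixes p q :: real
  assumes "p \<in> {0..1}" "q \<in> {0..1}"
  shows "0 < max (2 - p\<^sup>2 - 3 * q\<^sup>2) (2 - (1 - p)\<^sup>2 - 3 * (1 - q)\<^sup>2)"
proof -
  have aux: "0 < 2 - p\<^sup>2 - 3 * q\<^sup>2" if "0 \<le> p" "p \<le> 1" "0 \<le> q" "q \<le> 1 / 2" for p q :: real
  proof -
    have "p\<^sup>2 \<le> 1\<^sup>2" "q\<^sup>2 \<le> (1/2)\<^sup>2" using that by (intro power_mono; simp)+
    then show ?thesis by (simp add: power_divide)
  qed
  show ?thesis
    using assms aux[of p q] aux[of "1 - p" "1 - q"] by (cases "q \<le> 1 / 2") (auto simp: less_max_iff_disj)
qed

lemma cell_measurable: "(\<lambda>x. cell (fst x) (snd x)) \<in> borel_measurable (borel \<Otimes>\<^sub>M borel)"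
  unfolding cell_def by measurable

lemma tower_cell_integral_limit:
  fixes k :: nat
  assumes k: "1 \<le> k"
  shows "(\<lambda>n. \<integral>\<^sup>+q. (\<integral>\<^sup>+p. ennreal (tower.tower_cell (n + 5) p q) * indicator {0..1} p \<partial>lborel) *
    indicator {0..1} q \<partial>lborel) \<longlonglongrightarrow> ennreal (15 / 4 * Lobachevsky (pi / 3))"
proof -
  have T: "tower (n + 5) k" for n using k by unfold_locales auto
  note lims = tower_limits[OF k]
  \<comment> \<open>The uniform bound on the cells, arranged in quotients that converge; a
    convergent sequence is bounded, and this yields the dominating constant.\<close>
  define B where "B n = (tower.s (n + 5) / tower.a (n + 5)) * (2 / ((1 - tower.u (n + 5)) / (tower.a (n + 5))\<^sup>2))" for n
  have "B \<longlonglongrightarrow> sqrt 3 * (2 / (1 / 2))"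
    unfolding B_def by (intro tendsto_intros lims(1,2)) auto
  then have "Bseq B" by (intro convergent_imp_Bseq convergentI)
  then obtain K where K: "\<And>n. \<bar>B n\<bar> \<le> K" unfolding Bseq_def by auto
  show ?thesis
    unfolding nn_integral_cell[symmetric]
  proof (rule nn_integral_unit_square_dominated)
    show "(\<lambda>x. tower.tower_cell (n + 5) (fst x) (snd x)) \<in> borel_measurable (borel \<Otimes>\<^sub>M borel)" for n
      by (rule tower.tower_cell_measurable[OF T]) auto
    show "tower.tower_cell (n + 5) p q \<le> K" if "p \<in> {0..1}" "q \<in> {0..1}" for n p q
      using tower.tower_cell_le[OF T that, of n] K[of n] unfolding B_def by linarith
    fix p q :: real assume pq: "p \<in> {0..1}" "q \<in> {0..1}"
    have "(\<lambda>n. (tower.s (n + 5) / tower.a (n + 5)) / max ((tower.inv_sq (n + 5) p q - 1) / (tower.a (n + 5))\<^sup>2)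
        ((tower.inv_sq (n + 5) (1 - p) (1 - q) - 1) / (tower.a (n + 5))\<^sup>2)) \<longlonglongrightarrow>
      sqrt 3 / max (2 - p\<^sup>2 - 3 * q\<^sup>2) (2 - (1 - p)\<^sup>2 - 3 * (1 - q)\<^sup>2)"
      using cell_denominator_pos[OF pq] by (intro tendsto_divide tendsto_max lims) simp
    then show "(\<lambda>n. tower.tower_cell (n + 5) p q) \<longlonglongrightarrow> cell p q"
      unfolding tower.tower_cell_scaled[OF T] cell_def .
  qed (rule cell_measurable)
qed

theorem theorem1p3:
  fixes k :: nat
  assumes "k \<ge> 1"
  shows "\<exists>R :: nat \<Rightarrow> (real^3) set.
    (\<forall>n. compact_right_angled_polyhedron (R n)) \<and>
    (\<lambda>n. hyp_vol (R n) / real (vert (R n)))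
      \<longlonglongrightarrow> real k / (real k + 1) * (5 * v3 / 8)"
proof (intro exI conjI allI)
  \<comment> \<open>The shift by 5 makes every index admissible for the tower.\<close>
  let ?R = "\<lambda>n. tower.body (n + 5) k"
  let ?I = "\<lambda>n. \<integral>\<^sup>+q. (\<integral>\<^sup>+p. ennreal (tower.tower_cell (n + 5) p q) * indicator {0..1} p \<partial>lborel) *
    indicator {0..1} q \<partial>lborel"
  have T: "tower (n + 5) k" for n using assms by unfold_locales auto
  show "compact_right_angled_polyhedron (?R n)" for n by (rule tower.body_right_angled[OF T])
  have "hyp_vol (?R n) / real (vert (?R n)) = real k / (2 * (real k + 1)) * enn2real (?I n)" for n
  proof -
    have "hyp_vol (?R n) = real (n + 5) * real k * enn2real (?I n)"
      unfolding tower.hyp_vol_body[OF T] enn2real_mult by simp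
    moreover have "real (vert (?R n)) = 2 * real (n + 5) * (real k + 1)"
      unfolding tower.vert_body[OF T] of_nat_mult by (simp only: of_nat_add of_nat_numeral of_nat_1)
    moreover have aux: "N * x * E / (2 * N * (x + 1)) = x / (2 * (x + 1)) * E" if "0 < N" for N x E :: real
      using that by simp
    have "0 < real (n + 5)" by simp
    note aux[OF this]
    ultimately show ?thesis by (simp only:)
  qed
  moreover have "(\<lambda>n. enn2real (?I n)) \<longlonglongrightarrow> 15 / 4 * Lobachevsky (pi / 3)"
    using tower_cell_integral_limit[OF assms] Lobachevsky_pi_third_nonneg by (intro tendsto_enn2real) auto
  ultimately have "(\<lambda>n. hyp_vol (?R n) / real (vert (?R n))) \<longlonglongrightarrow>
      real k / (2 * (real k + 1)) * (15 / 4 * Lobachevsky (pi / 3))"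
    by (simp only: tendsto_mult_left)
  moreover have "real k / (2 * (real k + 1)) * (15 / 4 * Lobachevsky (pi / 3)) = real k / (real k + 1) * (5 * v3 / 8)"
    by (simp add: v3_def field_simps)
  ultimately show "(\<lambda>n. hyp_vol (?R n) / real (vert (?R n))) \<longlonglongrightarrow> real k / (real k + 1) * (5 * v3 / 8)"
    by (simp only:)
qed

end
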